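(* Let $\Gamma\le\mathrm{SL}_{d+1}(\mathbb{R})$ be a discrete subgroup that is Zariski dense in $\mathrm{SL}_{d+1}(\mathbb{R})$ and preserves a properly convex domain $\Omega\subset\mathbb{P}(\mathbb{R}^{d+1})$. Let $\Lambda_\Gamma\subset\mathbb{P}(\mathbb{R}^{d+1})$ be the proximal limit set of $\Gamma$. Then $(\Omega,\Gamma)$ is a rank one Hilbert geometry (i.e. $\Gamma$ contains a rank one isometry) if and only if $\Omega$ contains a rank one geodesic $(a',b')\subset\Omega$ with $a',b'\in\Lambda_\Gamma\cap\partial\Omega$.
   Context: A properly convex domain is a nonempty open set $\Omega\subset\mathbb{P}(\mathbb{R}^{d+1})$ such that some affine chart contains $\overline\Omega$ and in it $\Omega$ is a bounded convex set. For $x,y\in\overline\Omega$, $[x,y]\subset\overline\Omega$ is the closed projective line segment joining them, and $(x,y)=[x,y]\setminus\{x,y\}$. The Hilbert metric is $d_\Omega(x,y)=\frac12\log\frac{|b-x||y-a|}{|b-y||x-a|}$, where $a,b\in\partial\Omega$ are the endpoints of the intersection of $\overline\Omega$ with the projective line through $x\ne y$, ordered $a,x,y,b$ (computed in an affine chart containing $\overline{\Omega}$). $\mathrm{Aut}(\Omega)=\{g\in\mathrm{PGL}_{d+1}(\mathbb{R}): g\Omega=\Omega\}$. Elements of $\mathrm{SL}_{d+1}(\mathbb{R})$ preserving $\Omega$ are viewed as automorphisms of $\Omega$. Rank one geodesic: for $a,b\in\partial\Omega$ with $(a,b)\subset\Omega$, the projective geodesic $(a,b)$ is a rank one geodesic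 if it is not contained in a half triangle in $\Omega$, i.e. for every $z\in\partial\Omega$ either $(a,z)\subset\Omega$ or $(z,b)\subset\Omega$. Rank one isometry: $\gamma\in\mathrm{Aut}(\Omega)$ is a rank one isometry if (a) $\tau_\Omega(\gamma):=\inf_{x\in\Omega}d_\Omega(x,\gamma x)>0$; (b) $\gamma$ has an axis, i.e. a non-trivial (open) projective line segment of the form $\mathbb{P}(V)\cap\Omega$ with $V\le\mathbb{R}^{d+1}$ a two-dimensional $\gamma$-invariant linear subspace; (c) no axis $(a,b)$ of $\gamma$ ($a,b\in\partial\Omega$) is contained in a half triangle in $\Omega$, i.e. there is no $z\in\partial\Omega$ with $[a,z]\cup[z,b]\subset\partial\Omega$. Proximal limit set: write $g\in\mathrm{SL}_{d+1}(\mathbb{R})$ as $g=k_1\,\mathrm{diag}(a_1(g),\dots,a_{d+1}(g))\,k_2$ with $k_1,k_2\in\mathrm{SO}(d+1)$ and $a_1(g)\ge\dots\ge a_{d+1}(g)>0$, and put $E(g)=k_1\cdot[e_1]\in\mathbb{P}(\mathbb{R}^{d+1})$, well defined when $a_1(g)>a_2(g)$. $\Lambda_\Gamma$ is the set of all accumulation points of sequences $\{E(\gamma_n)\}$ where $\{\gamma_n\}$ is a sequence in $\Gamma$ with $\log\frac{a_1(\gamma_n)}{a_2(\gamma_n)}\to\infty$. *)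

theory Defs
  imports "HOL-Analysis.Analysis" "HOL-Algebra.Group"
begin

section \<open>Projective space\<close>

typedef (overloaded) ('a::euclidean_space) projective = "{span {v} | v::'a. v \<noteq> 0}"
  morphisms line_of projective_of_line
  using nonzero_Basis nonempty_Basis by blast

definition proj :: "'a::euclidean_space \<Rightarrow> 'a projective" where
  "proj v = projective_of_line (span {v})"

lemma line_of_proj: "v \<noteq> 0 \<Longrightarrow> line_of (proj v) = span {v}"
  unfolding proj_def by (rule projective_of_line_inverse) blast

text \<open>The quotient topology from the (open) set of nonzero vectors.\<close>

instantiation projective :: (euclidean_space) topological_space
begin

definition open_projective :: "'a projective set \<Rightarrow> bool" where
  "open_projective U \<longleftrightarrow> open {v. v \<noteq> 0 \<and> proj v \<in> U}"

instance
proof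
  have "{v::'a. v \<noteq> 0 \<and> proj v \<in> UNIV} = - {0}" by auto
  then show "open (UNIV :: 'a projective set)"
    unfolding open_projective_def by (simp add: open_Compl)
next
  fix S T :: "'a projective set"
  assume "open S" "open T"
  then have "open ({v. v \<noteq> 0 \<and> proj v \<in> S} \<inter> {v. v \<noteq> 0 \<and> proj v \<in> T})"
    unfolding open_projective_def by (rule open_Int)
  also have "{v. v \<noteq> 0 \<and> proj v \<in> S} \<inter> {v. v \<noteq> 0 \<and> proj v \<in> T}
      = {v. v \<noteq> 0 \<and> proj v \<in> S \<inter> T}" by auto
  finally show "open (S \<inter> T)" unfolding open_projective_def .
next
  fix K :: "'a projective set set"
  assume "\<forall>S\<in>K. open S"
  then have "open (\<Union>S\<in>K. {v. v \<noteq> 0 \<and> proj v \<in> S})"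
    unfolding open_projective_def by (intro open_UN) auto
  also have "(\<Union>S\<in>K. {v. v \<noteq> 0 \<and> proj v \<in> S}) = {v. v \<noteq> 0 \<and> proj v \<in> \<Union>K}" by auto
  finally show "open (\<Union>K)" unfolding open_projective_def .
qed

end

definition proj_space :: "'a::euclidean_space set \<Rightarrow> 'a projective set" where
  "proj_space V = {p. line_of p \<subseteq> V}"

definition proj_line :: "'a::euclidean_space projective \<Rightarrow> 'a projective \<Rightarrow> 'a projective set" where
  "proj_line x y = proj_space (span (line_of x \<union> line_of y))"

definition proj_act :: "real^'n^'n \<Rightarrow> (real^'n) projective \<Rightarrow> (real^'n) projective" where
  "proj_act g p = projective_of_line ((*v) g ` line_of p)"


section \<open>Affine charts and properly convex domains\<close>

text \<open>A vector \<open>w \<noteq> 0\<close> gives the affine chart \<open>[v] \<mapsto> v / (w \<bullet> v)\<close>, which identifies the complement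
  of the projective hyperplane \<open>w \<bullet> v = 0\<close> with the affine space \<open>w \<bullet> v = 1\<close>.\<close>

definition affine_chart :: "'a::euclidean_space \<Rightarrow> 'a projective set" where
  "affine_chart w = {p. \<exists>v \<in> line_of p. w \<bullet> v \<noteq> 0}"

definition chart :: "'a::euclidean_space \<Rightarrow> 'a projective \<Rightarrow> 'a" where
  "chart w p = (THE v. v \<in> line_of p \<and> w \<bullet> v = 1)"

lemma chart_proj:
  assumes "w \<bullet> v \<noteq> 0"
  shows "chart w (proj v) = (1 / (w \<bullet> v)) *\<^sub>R v"
proof -
  have "v \<noteq> 0" using assms by auto
  then have line: "line_of (proj v) = span {v}" by (rule line_of_proj)
  show ?thesis
    unfolding chart_def line span_singleton
    using assms by (intro the_equality) (auto simp: field_simps)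
qed

definition chart_contains :: "'a::euclidean_space \<Rightarrow> 'a projective set \<Rightarrow> bool" where
  "chart_contains w S \<longleftrightarrow> w \<noteq> 0 \<and> S \<subseteq> affine_chart w"

definition properly_convex_domain :: "'a::euclidean_space projective set \<Rightarrow> bool" where
  "properly_convex_domain \<Omega> \<longleftrightarrow> \<Omega> \<noteq> {} \<and> open \<Omega> \<and>
     (\<exists>w. chart_contains w (closure \<Omega>) \<and> bounded (chart w ` \<Omega>) \<and> convex (chart w ` \<Omega>))"

text \<open>For a properly convex \<open>\<Omega>\<close> and \<open>x\<close>, \<open>y\<close> in its closure, the segment and the distance below
  do not depend on the chart \<open>w\<close>: as \<open>closure \<Omega>\<close> is connected and avoids both hyperplanes, a change
  of chart is a projective map with denominator of constant sign on \<open>closure \<Omega>\<close>.\<close>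

definition proj_seg ::
    "'a::euclidean_space projective set \<Rightarrow> 'a projective \<Rightarrow> 'a projective \<Rightarrow> 'a projective set" where
  "proj_seg \<Omega> x y = {z. \<exists>w. chart_contains w (closure \<Omega>) \<and> z \<in> affine_chart w \<and>
     chart w z \<in> closed_segment (chart w x) (chart w y)}"

definition open_proj_seg ::
    "'a::euclidean_space projective set \<Rightarrow> 'a projective \<Rightarrow> 'a projective \<Rightarrow> 'a projective set" where
  "open_proj_seg \<Omega> x y = proj_seg \<Omega> x y - {x, y}"

definition hilbert_dist ::
    "'a::euclidean_space projective set \<Rightarrow> 'a projective \<Rightarrow> 'a projective \<Rightarrow> real" where
  "hilbert_dist \<Omega> x y = (if x = y then 0 else
     (THE r. \<exists>w a b. chart_contains w (closure \<Omega>) \<and>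
        a \<in> frontier \<Omega> \<and> b \<in> frontier \<Omega> \<and>
        closure \<Omega> \<inter> proj_line x y = proj_seg \<Omega> a b \<and>
        x \<in> proj_seg \<Omega> a y \<and> y \<in> proj_seg \<Omega> x b \<and>
        r = 1/2 * ln ((norm (chart w b - chart w x) * norm (chart w y - chart w a)) /
                      (norm (chart w b - chart w y) * norm (chart w x - chart w a)))))"


section \<open>Rank one geodesics and isometries\<close>

text \<open>Elements of the projective linear group are represented by invertible matrices; everything
  below is invariant under rescaling the matrix.\<close>

definition Aut :: "(real^'n) projective set \<Rightarrow> (real^'n^'n) set" where
  "Aut \<Omega> = {g. invertible g \<and> proj_act g ` \<Omega> = \<Omega>}"

definition rank_one_geodesic ::
    "(real^'n) projective set \<Rightarrow> (real^'n) projective \<Rightarrow> (real^'n) projective \<Rightarrow> bool" where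
  "rank_one_geodesic \<Omega> a b \<longleftrightarrow>
     a \<in> frontier \<Omega> \<and> b \<in> frontier \<Omega> \<and> a \<noteq> b \<and> open_proj_seg \<Omega> a b \<subseteq> \<Omega> \<and>
     (\<forall>z \<in> frontier \<Omega>. open_proj_seg \<Omega> a z \<subseteq> \<Omega> \<or> open_proj_seg \<Omega> z b \<subseteq> \<Omega>)"

definition translation_length :: "(real^'n) projective set \<Rightarrow> real^'n^'n \<Rightarrow> real" where
  "translation_length \<Omega> g = (INF x\<in>\<Omega>. hilbert_dist \<Omega> x (proj_act g x))"

text \<open>As \<open>\<Omega>\<close> is open, \<open>L \<noteq> {}\<close> already makes \<open>L\<close> a non-trivial open segment.\<close>

definition isometry_axis ::
    "(real^'n) projective set \<Rightarrow> real^'n^'n \<Rightarrow> (real^'n) projective set \<Rightarrow> bool" where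
  "isometry_axis \<Omega> g L \<longleftrightarrow> L \<noteq> {} \<and>
     (\<exists>V. subspace V \<and> dim V = 2 \<and> (*v) g ` V \<subseteq> V \<and> L = proj_space V \<inter> \<Omega>)"

definition in_half_triangle ::
    "(real^'n) projective set \<Rightarrow> (real^'n) projective \<Rightarrow> (real^'n) projective \<Rightarrow> bool" where
  "in_half_triangle \<Omega> a b \<longleftrightarrow>
     (\<exists>z \<in> frontier \<Omega>. proj_seg \<Omega> a z \<union> proj_seg \<Omega> z b \<subseteq> frontier \<Omega>)"

definition rank_one_isometry :: "(real^'n) projective set \<Rightarrow> real^'n^'n \<Rightarrow> bool" where
  "rank_one_isometry \<Omega> g \<longleftrightarrow>
     g \<in> Aut \<Omega> \<and> translation_length \<Omega> g > 0 \<and> (\<exists>L. isometry_axis \<Omega> g L) \<and>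
     (\<forall>a \<in> frontier \<Omega>. \<forall>b \<in> frontier \<Omega>.
        isometry_axis \<Omega> g (open_proj_seg \<Omega> a b) \<longrightarrow> \<not> in_half_triangle \<Omega> a b)"

definition rank_one_hilbert_geometry ::
    "(real^'n) projective set \<Rightarrow> (real^'n^'n) set \<Rightarrow> bool" where
  "rank_one_hilbert_geometry \<Omega> \<Gamma> \<longleftrightarrow> (\<exists>g\<in>\<Gamma>. rank_one_isometry \<Omega> g)"


section \<open>The special linear group and Zariski density\<close>

definition SL :: "(real^'n^'n) monoid" where
  "SL = \<lparr>carrier = {g. det g = 1}, mult = (**), one = mat 1\<rparr>"

lemma group_SL: "group (SL :: (real^'n^'n) monoid)"
proof (rule groupI)
  fix g :: "real^'n^'n"
  assume "g \<in> carrier SL"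
  then have g: "det g = 1" by (simp add: SL_def)
  then have "invertible g" by (simp add: invertible_det_nz)
  then obtain h where h: "h ** g = mat 1" by (auto simp: invertible_def)
  then have "det h * det g = 1" by (metis det_mul det_I)
  with g h show "\<exists>y\<in>carrier SL. y \<otimes>\<^bsub>SL\<^esub> g = \<one>\<^bsub>SL\<^esub>" by (auto simp: SL_def)
qed (auto simp: SL_def det_mul matrix_mul_assoc)

text \<open>On the finite-dimensional space of matrices, \<^const>\<open>real_polynomial_function\<close> is exactly the
  class of polynomials in the matrix entries.\<close>

definition zariski_closed :: "(real^'n^'n) set \<Rightarrow> bool" where
  "zariski_closed Z \<longleftrightarrow>
     (\<exists>F \<subseteq> Collect real_polynomial_function. Z = {g. \<forall>f\<in>F. f g = 0})"

definition zariski_dense_in :: "(real^'n^'n) set \<Rightarrow> (real^'n^'n) set \<Rightarrow> bool" where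
  "zariski_dense_in S G \<longleftrightarrow> S \<subseteq> G \<and> (\<forall>Z. zariski_closed Z \<and> S \<subseteq> Z \<longrightarrow> G \<subseteq> Z)"


section \<open>The proximal limit set\<close>

text \<open>The linear order on the index type \<open>'n\<close> plays the role of the order of \<open>1, ..., d+1\<close>.
  If \<open>'n\<close> has a single element there is no second index; then \<open>index2 = index1\<close>, the ratio of
  singular values is always \<open>1\<close>, and the limit set is empty.\<close>

definition index1 :: "'n::{finite,linorder}" where
  "index1 = Min UNIV"

definition index2 :: "'n::{finite,linorder}" where
  "index2 = (if UNIV = {index1 :: 'n} then index1 else Min (UNIV - {index1}))"

definition diag_matrix :: "('n \<Rightarrow> real) \<Rightarrow> real^'n^'n" where
  "diag_matrix a = (\<chi> i j. if i = j then a i else 0)"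

type_synonym 'n sq_matrix = "((real, 'n) vec, 'n) vec"

definition cartan_decomposition ::
    "('n::{finite,linorder}) sq_matrix \<Rightarrow> 'n sq_matrix \<Rightarrow> ('n \<Rightarrow> real) \<Rightarrow> 'n sq_matrix \<Rightarrow> bool" where
  "cartan_decomposition g k1 a k2 \<longleftrightarrow>
     rotation_matrix k1 \<and> rotation_matrix k2 \<and> antimono a \<and> (\<forall>i. a i > 0) \<and>
     g = k1 ** diag_matrix a ** k2"

definition singular_values :: "('n::{finite,linorder}) sq_matrix \<Rightarrow> 'n \<Rightarrow> real" where
  "singular_values g = (THE a. \<exists>k1 k2. cartan_decomposition g k1 a k2)"

text \<open>Determined by \<open>g\<close> only if the first two singular values differ; in the limit set below this
  holds for all but finitely many terms of the sequence.\<close>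

definition attracting_point ::
    "('n::{finite,linorder}) sq_matrix \<Rightarrow> (real^'n::{finite,linorder}) projective" where
  "attracting_point g =
     (THE p. \<exists>k1 a k2. cartan_decomposition g k1 a k2 \<and> p = proj (k1 *v axis index1 1))"

definition proximal_limit_set ::
    "(('n::{finite,linorder}) sq_matrix) set \<Rightarrow> (real^'n::{finite,linorder}) projective set" where
  "proximal_limit_set \<Gamma> = {p. \<exists>(\<gamma> :: nat \<Rightarrow> 'n sq_matrix) (r :: nat \<Rightarrow> nat).
     (\<forall>n. \<gamma> n \<in> \<Gamma>) \<and>
     filterlim (\<lambda>n. ln (singular_values (\<gamma> n) index1 / singular_values (\<gamma> n) index2))
       at_top sequentially \<and>
     strict_mono r \<and> (\<lambda>n. attracting_point (\<gamma> (r n))) \<longlonglongrightarrow> p}"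

end

(* All statements are lifted to the open convex cone C over Omega, with closure D: for nonzero
   boundary vectors, being joined by a segment inside Omega means that the sum lies in C.

   Let A preserve C, with boundary eigenvectors p, q such that p + q is in C and the eigenvalue of p
   is the larger one. The rescaled powers of A are bounded, and if the axis lies in no half triangle
   every limit of them has rank one with image the line of p; so p is proximal, and q is by symmetry.

   Conversely let u, v span a rank one geodesic with proximal end points, so that rescaled elements
   gamma_n and eta_n of the group tend to matrices of rank one with images u and v. For a generic h in
   the group, g_n = gamma_n h eta_n^-1 and its inverse, rescaled, tend to matrices of rank one with
   images u and v. By Brouwer's theorem g_n and its inverse have eigenvectors near u and v, with large
   product of eigenvalues, which bounds the translation length from below. All end points of axes of
   g_n tend to u and v, so half triangles containing them would accumulate on one containing the
   rank one geodesic. *)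

theory Submission
  imports Defs
begin

section \<open>Open convex cones\<close>

text \<open>A limit of rescaled group elements has the form \<open>outer u \<mu>\<close>, an image
  line together with a functional. The rescaled inverses of gamma_n and eta_n accumulate at nonzero
  matrices of unknown rank; h has to be chosen so that the products with these matrices do not
  vanish, and Zariski density provides it. That the kernel of each limit then misses its image comes
  from comparing g_n with its inverse: the product of the two scalings tends to 0, as u and v are
  independent.

  The definition of a rank one isometry speaks about all axes, whereas Brouwer gives one pair of
  eigenvectors, not even known to lie on the boundary. All axes are controlled at once by comparing
  eigenvalues: the attracting end of any axis has an eigenvalue at least as large as that of any
  eigenvector in D, and an eigenvalue that is large against the scaling forces its eigenvector
  towards u.

  An element of SL preserving Omega may exchange C and -C. Hence the signs, and the passage to
  squares in the first direction, where the matrices have to be elements of the group.\<close>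

locale pointed_cone =
  fixes C :: "'a::euclidean_space set" and w :: 'a and M :: real
  assumes open_C: "open C" and convex_C: "convex C" and nonempty_C: "C \<noteq> {}"
    and scale_C: "\<And>v c. v \<in> C \<Longrightarrow> c > 0 \<Longrightarrow> c *\<^sub>R v \<in> C"
    and pos_C: "\<And>v. v \<in> C \<Longrightarrow> w \<bullet> v > 0"
    and bound_C: "\<And>v. v \<in> C \<Longrightarrow> norm v \<le> M * (w \<bullet> v)"
begin

abbreviation "D \<equiv> closure C"

text \<open>Zero is excluded because it lies in the closure of every cone but represents no
  projective point.\<close>

definition bd :: "'a set" where "bd = D - C - {0}"

lemma C_sub_D: "v \<in> C \<Longrightarrow> v \<in> D"
  using closure_subset by blast

lemma bd_D: "v \<in> bd \<Longrightarrow> v \<in> D"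
  by (simp add: bd_def)

lemma nonzero_C: "v \<in> C \<Longrightarrow> v \<noteq> 0"
  using pos_C[of v] by auto

lemma add_C: assumes "x \<in> C" "y \<in> C" shows "x + y \<in> C"
proof -
  have "(1/2) *\<^sub>R x + (1/2) *\<^sub>R y \<in> C"
    using convexD[OF convex_C assms, of "1/2" "1/2"] by simp
  from scale_C[OF this, of 2] show ?thesis by (simp add: scaleR_add_right)
qed

lemma zero_D: "0 \<in> D"
proof -
  obtain v where v: "v \<in> C" using nonempty_C by auto
  have "(\<lambda>n. inverse (real (Suc n)) *\<^sub>R v) \<longlonglongrightarrow> 0 *\<^sub>R v"
    by (intro tendsto_intros LIMSEQ_inverse_real_of_nat)
  moreover have "inverse (real (Suc n)) *\<^sub>R v \<in> C" for n
    by (rule scale_C[OF v]) simp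
  ultimately show ?thesis
    unfolding closure_sequential by (intro exI[of _ "\<lambda>n. inverse (real (Suc n)) *\<^sub>R v"]) simp
qed

lemma scale_D: assumes "v \<in> D" "c \<ge> 0" shows "c *\<^sub>R v \<in> D"
proof (cases "c = 0")
  case False
  obtain x where x: "\<And>n. x n \<in> C" "x \<longlonglongrightarrow> v"
    using assms(1) unfolding closure_sequential by blast
  have "(\<lambda>n. c *\<^sub>R x n) \<longlonglongrightarrow> c *\<^sub>R v" by (intro tendsto_intros x)
  then show ?thesis
    unfolding closure_sequential using scale_C[OF x(1), of c] assms(2) False
    by (intro exI[of _ "\<lambda>n. c *\<^sub>R x n"]) auto
qed (simp add: zero_D)

lemma add_D: assumes "x \<in> D" "y \<in> D" shows "x + y \<in> D"
proof -
  have "(1/2) *\<^sub>R x + (1/2) *\<^sub>R y \<in> D"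
    using convexD[OF convex_closure[OF convex_C] assms, of "1/2" "1/2"] by simp
  from scale_D[OF this, of 2] show ?thesis by (simp add: scaleR_add_right)
qed

lemma M_pos: "M > 0"
proof -
  obtain v where v: "v \<in> C" using nonempty_C by auto
  then have "0 < M * (w \<bullet> v)" using bound_C[OF v] nonzero_C[OF v]
    by (meson less_le_trans zero_less_norm_iff)
  then show ?thesis using pos_C[OF v] by (simp add: zero_less_mult_iff)
qed

text \<open>Proper convexity enters through \<open>M\<close>: slices of the cone by \<open>w\<close>
  are bounded. The bound passes to the closure, where it keeps \<open>w\<close> positive off
  zero.\<close>

lemma bound_D: assumes "v \<in> D" shows "norm v \<le> M * (w \<bullet> v)"
proof -
  obtain x where x: "\<And>n. x n \<in> C" "x \<longlonglongrightarrow> v"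
    using assms(1) unfolding closure_sequential by blast
  show ?thesis
    by (rule LIMSEQ_le[of "\<lambda>n. norm (x n)" _ "\<lambda>n. M * (w \<bullet> x n)"])
      (auto intro!: tendsto_intros x bound_C)
qed

lemma pos_D: assumes "v \<in> D" "v \<noteq> 0" shows "w \<bullet> v > 0"
proof -
  have "0 < M * (w \<bullet> v)" using bound_D[OF assms(1)] assms(2)
    by (meson less_le_trans zero_less_norm_iff)
  then show ?thesis using M_pos by (simp add: zero_less_mult_iff)
qed

lemma nonneg_D: "v \<in> D \<Longrightarrow> w \<bullet> v \<ge> 0"
  using pos_D[of v] by (cases "v = 0") auto

lemma pointed: assumes "v \<in> D" "- v \<in> D" shows "v = 0"
  using nonneg_D[OF assms(2)] pos_D[OF assms(1)] by fastforce

text \<open>The error of approximating \<open>x\<close> from inside the cone is absorbed by the open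
  neighbourhood of \<open>y\<close>.\<close>

lemma add_DC: assumes "x \<in> D" "y \<in> C" shows "x + y \<in> C"
proof -
  obtain e where e: "e > 0" "ball y e \<subseteq> C" using open_C assms(2) open_contains_ball by blast
  obtain x' where x': "x' \<in> C" "dist x' x < e"
    using assms(1) e(1) closure_approachable by blast
  have "y + (x - x') \<in> C" using e x'(2) by (auto simp: subset_eq dist_norm norm_minus_commute)
  from add_C[OF x'(1) this] show ?thesis by (simp add: algebra_simps)
qed

lemma add_CD: "x \<in> C \<Longrightarrow> y \<in> D \<Longrightarrow> x + y \<in> C"
  using add_DC by (metis add.commute)

text \<open>Points of the open cone are order units. Most of the later comparisons start here, often
  with a \<open>y\<close> outside the cone.\<close>

lemma dominates: assumes "x \<in> C" shows "\<exists>d>0. x - d *\<^sub>R y \<in> C"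
proof -
  obtain e where e: "e > 0" "ball x e \<subseteq> C" using open_C assms open_contains_ball by blast
  let ?d = "e / (2 * (norm y + 1))"
  have "?d * norm y = e * (norm y / (2 * (norm y + 1)))" by simp
  also have "norm y / (2 * (norm y + 1)) < 1" by (simp add: divide_less_eq add_pos_nonneg) (use norm_ge_zero[of y] in linarith)
  finally have "?d * norm y < e" using e(1) by simp
  then have "x - ?d *\<^sub>R y \<in> ball x e" using e(1) by (simp add: dist_norm)
  moreover have "?d > 0" using e(1) by (intro divide_pos_pos mult_pos_pos add_nonneg_pos) auto
  ultimately show ?thesis using e(2) by blast
qed

text \<open>Split off \<open>min s t\<close> copies of \<open>x + y\<close>. Thus the sum alone
  decides whether the whole open segment is interior, whatever positive multiples represent its
  ends.\<close>

lemma combo_C: assumes "x \<in> D" "y \<in> D" "x + y \<in> C" "s > 0" "t > 0"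
  shows "s *\<^sub>R x + t *\<^sub>R y \<in> C"
proof -
  let ?m = "min s t"
  have "s *\<^sub>R x + t *\<^sub>R y = ?m *\<^sub>R (x + y) + ((s - ?m) *\<^sub>R x + (t - ?m) *\<^sub>R y)"
    by (simp add: algebra_simps)
  moreover have "?m *\<^sub>R (x + y) \<in> C" using assms by (intro scale_C) auto
  moreover have "(s - ?m) *\<^sub>R x + (t - ?m) *\<^sub>R y \<in> D"
    using assms by (intro add_D scale_D) auto
  ultimately show ?thesis using add_CD by simp
qed

lemma combo_D: "x \<in> D \<Longrightarrow> y \<in> D \<Longrightarrow> s \<ge> 0 \<Longrightarrow> t \<ge> 0 \<Longrightarrow> s *\<^sub>R x + t *\<^sub>R y \<in> D"
  by (intro add_D scale_D)

lemma scale_C_iff: "c > 0 \<Longrightarrow> c *\<^sub>R v \<in> C \<longleftrightarrow> v \<in> C"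
  using scale_C[of v c] scale_C[of "c *\<^sub>R v" "1/c"] by auto

lemma scale_bd: "v \<in> bd \<Longrightarrow> c > 0 \<Longrightarrow> c *\<^sub>R v \<in> bd"
  unfolding bd_def using scale_D[of v c] by (auto simp: scale_C_iff)

text \<open>If \<open>s\<close> were negative, adding \<open>- s\<close> copies of
  \<open>p + q\<close> would leave a multiple of \<open>q\<close> in the open cone.\<close>

lemma bd_coeff_nonneg:
  assumes "p \<in> bd" "q \<in> bd" "p + q \<in> C" "s *\<^sub>R p + t *\<^sub>R q \<in> D"
  shows "s \<ge> 0"
proof (rule ccontr)
  assume s: "\<not> s \<ge> 0"
  have "s *\<^sub>R p + t *\<^sub>R q + (-s) *\<^sub>R (p + q) \<in> C"
    using s by (intro add_DC[OF assms(4)] scale_C[OF assms(3)]) simp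
  then have *: "(t - s) *\<^sub>R q \<in> C" by (simp add: algebra_simps)
  then have "w \<bullet> ((t - s) *\<^sub>R q) > 0" by (rule pos_C)
  moreover have "w \<bullet> q > 0" using assms(2) by (intro pos_D) (auto simp: bd_def)
  ultimately have "t - s > 0" by (simp add: zero_less_mult_iff)
  then show False using * assms(2) by (simp add: scale_C_iff bd_def)
qed

text \<open>In the plane of \<open>p\<close> and \<open>q\<close> the closed cone is a quadrant,
  with these two vectors on its edges. This is what identifies the end points of axes.\<close>

lemma bd_plane_D_iff:
  assumes "p \<in> bd" "q \<in> bd" "p + q \<in> C"
  shows "s *\<^sub>R p + t *\<^sub>R q \<in> D \<longleftrightarrow> s \<ge> 0 \<and> t \<ge> 0"
  using bd_coeff_nonneg[OF assms, of s t] assms combo_D[OF bd_D bd_D, of p q s t]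
    bd_coeff_nonneg[of q p t s, unfolded add.commute[of q p] add.commute[of "t *\<^sub>R q"]]
  by blast

lemma bd_plane_C_iff:
  assumes "p \<in> bd" "q \<in> bd" "p + q \<in> C"
  shows "s *\<^sub>R p + t *\<^sub>R q \<in> C \<longleftrightarrow> s > 0 \<and> t > 0"
proof
  assume *: "s *\<^sub>R p + t *\<^sub>R q \<in> C"
  then have "s \<ge> 0" "t \<ge> 0" using bd_plane_D_iff[OF assms] C_sub_D by auto
  moreover have "s \<noteq> 0"
  proof
    assume "s = 0"
    with * have "t *\<^sub>R q \<in> C" by simp
    then show False using \<open>t \<ge> 0\<close> assms(2) nonzero_C[of 0]
      by (cases "t = 0") (auto simp: bd_def scale_C_iff)
  qed
  moreover have "t \<noteq> 0"
  proof
    assume "t = 0"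
    with * have "s *\<^sub>R p \<in> C" by simp
    then show False using \<open>s \<ge> 0\<close> assms(1) nonzero_C[of 0]
      by (cases "s = 0") (auto simp: bd_def scale_C_iff)
  qed
  ultimately show "s > 0 \<and> t > 0" by simp
next
  assume "s > 0 \<and> t > 0"
  then show "s *\<^sub>R p + t *\<^sub>R q \<in> C" using assms by (intro combo_C) (auto simp: bd_def)
qed

lemma bd_pair_independent:
  assumes "p \<in> bd" "q \<in> bd" "p + q \<in> C" "s *\<^sub>R p + t *\<^sub>R q = 0"
  shows "s = 0 \<and> t = 0"
proof -
  have "(-s) *\<^sub>R p + (-t) *\<^sub>R q = - (s *\<^sub>R p + t *\<^sub>R q)" by simp
  then have "s *\<^sub>R p + t *\<^sub>R q \<in> D" "(-s) *\<^sub>R p + (-t) *\<^sub>R q \<in> D"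
    using assms(4) zero_D by (simp_all only: minus_zero)
  then have "s \<ge> 0 \<and> t \<ge> 0" "-s \<ge> 0 \<and> -t \<ge> 0"
    unfolding bd_plane_D_iff[OF assms(1-3)] by auto
  then show ?thesis by auto
qed

section \<open>Compact slices and comparison in the order of the cone\<close>

lemma compact_slice: "compact {x \<in> D. w \<bullet> x = c}"
proof -
  have "bounded {x \<in> D. w \<bullet> x = c}"
    unfolding bounded_iff using bound_D by (intro exI[of _ "M * c"]) auto
  moreover have "closed ({x. w \<bullet> x = c} \<inter> D)"
    by (intro closed_Int closed_hyperplane closed_closure)
  moreover have "{x. w \<bullet> x = c} \<inter> D = {x \<in> D. w \<bullet> x = c}" by auto
  ultimately show ?thesis using compact_eq_bounded_closed by metis
qed

text \<open>Applying \<open>w\<close> turns the comparison of vectors into one of real numbers,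
  where a geometric sequence with ratio above 1 is unbounded.\<close>

lemma growth_le_1:
  assumes "x \<in> D" "x \<noteq> 0" "\<And>k. y - r ^ k *\<^sub>R x \<in> D"
  shows "r \<le> 1"
proof (rule ccontr)
  assume "\<not> r \<le> 1"
  then obtain k where k: "(w \<bullet> y) / (w \<bullet> x) < r ^ k" using real_arch_pow[of r] by auto
  have "w \<bullet> x > 0" using assms pos_D by auto
  with k have "w \<bullet> (y - r ^ k *\<^sub>R x) < 0" by (simp add: field_simps inner_diff_right)
  then show False using nonneg_D[OF assms(3)[of k]] by simp
qed

text \<open>\<open>b\<close> is the least \<open>t\<close> for which
  \<open>t *\<^sub>R X - Y\<close> is in the closed cone, the constant M(Y/X) in Birkhoff's form of
  the Hilbert metric. If the extremal vector were interior, \<open>t\<close> could still be lowered;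
  independence keeps it nonzero.\<close>

lemma exists_boundary_ratio:
  assumes X: "X \<in> C" and Y: "Y \<in> C" and ind: "\<And>t. Y \<noteq> t *\<^sub>R X"
  shows "\<exists>b>0. b *\<^sub>R X - Y \<in> bd"
proof -
  let ?T = "{t. t *\<^sub>R X - Y \<in> D}"
  have wX: "w \<bullet> X > 0" and wY: "w \<bullet> Y > 0" using X Y pos_C by auto
  have lower: "t \<ge> (w \<bullet> Y) / (w \<bullet> X)" if "t \<in> ?T" for t
    using nonneg_D[of "t *\<^sub>R X - Y"] that wX by (simp add: inner_diff_right field_simps)
  have bdd: "bdd_below ?T" using lower by (rule bdd_belowI)
  obtain d where d: "d > 0" "X - d *\<^sub>R Y \<in> C" using dominates[OF X] by blast
  have "(1/d) *\<^sub>R (X - d *\<^sub>R Y) \<in> C" using d by (intro scale_C) auto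
  then have "1/d \<in> ?T" using d C_sub_D by (simp add: scaleR_diff_right)
  then have ne: "?T \<noteq> {}" by blast
  have "continuous_on UNIV (\<lambda>t. t *\<^sub>R X - Y)" by (intro continuous_intros)
  then have clo: "closed ?T" using closed_vimage[of D "\<lambda>t. t *\<^sub>R X - Y"] by (simp add: vimage_def)
  define b where "b = Inf ?T"
  have bT: "b *\<^sub>R X - Y \<in> D" using closed_contains_Inf[OF ne bdd clo] by (simp add: b_def)
  then have "b \<ge> (w \<bullet> Y) / (w \<bullet> X)" using lower by blast
  then have b0: "b > 0" using wX wY by (smt (verit) divide_pos_pos)
  have "b *\<^sub>R X - Y \<notin> C"
  proof
    assume "b *\<^sub>R X - Y \<in> C"
    then obtain d where d: "d > 0" "(b *\<^sub>R X - Y) - d *\<^sub>R X \<in> C" using dominates by blast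
    then have "b - d \<in> ?T" using C_sub_D by (simp add: algebra_simps)
    then have "b \<le> b - d" unfolding b_def using bdd by (rule cInf_lower)
    then show False using d by simp
  qed
  moreover have "b *\<^sub>R X - Y \<noteq> 0" using ind by auto
  ultimately show ?thesis using bT b0 by (auto simp: bd_def)
qed

text \<open>Adding a positive multiple of \<open>X\<close> to a boundary vector leads into the open
  cone.\<close>

lemma boundary_ratio_unique:
  assumes "X \<in> C" "b *\<^sub>R X - Y \<in> bd" "b' *\<^sub>R X - Y \<in> bd"
  shows "b = b'"
proof -
  have False if "b1 < b2" "b1 *\<^sub>R X - Y \<in> bd" "b2 *\<^sub>R X - Y \<in> bd" for b1 b2
  proof -
    have "(b1 *\<^sub>R X - Y) + (b2 - b1) *\<^sub>R X \<in> C"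
      using that assms(1) by (intro add_DC scale_C) (auto simp: bd_def)
    then show False using that(3) by (simp add: algebra_simps bd_def)
  qed
  then show ?thesis using assms by (meson linorder_neqE_linordered_idom)
qed

lemma exists_independent:
  assumes X: "X \<in> C" and "X \<in> V" "subspace V" "dim V = 2"
  shows "\<exists>Y\<in>C. Y \<in> V \<and> (\<forall>t. Y \<noteq> t *\<^sub>R X)"
proof -
  have "\<not> V \<subseteq> span {X}"
  proof
    assume "V \<subseteq> span {X}"
    then have "dim V \<le> dim {X}" by (metis dim_span dim_subset)
    also have "\<dots> \<le> 1" using dim_le_card[of "{X}" "{X}"] by (simp add: span_superset)
    finally show False using assms by simp
  qed
  then obtain z where z: "z \<in> V" "z \<notin> span {X}" by blast
  obtain d where d: "d > 0" "X - d *\<^sub>R z \<in> C" using dominates[OF X] by blast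
  have "X - d *\<^sub>R z \<in> V" using assms z by (intro subspace_diff subspace_scale) auto
  moreover have "X - d *\<^sub>R z \<noteq> t *\<^sub>R X" for t
  proof
    assume "X - d *\<^sub>R z = t *\<^sub>R X"
    then have "d *\<^sub>R z = (1 - t) *\<^sub>R X" by (simp add: algebra_simps)
    then have "z = ((1-t)/d) *\<^sub>R X" using d(1)
      by (metis scaleR_scaleR divide_inverse mult.commute order_less_irrefl scaleR_one left_inverse)
    then show False using z(2) by (metis rangeI span_singleton)
  qed
  ultimately show ?thesis using d by blast
qed

end

section \<open>Projective space and the cone over a domain\<close>

lemma exists_proj: "\<exists>v. v \<noteq> 0 \<and> p = proj v"
proof -
  obtain v where "v \<noteq> 0" "line_of p = span {v}" using line_of[of p] by blast
  then show ?thesis unfolding proj_def by (metis line_of_inverse)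
qed

lemma proj_eq_iff:
  assumes "u \<noteq> 0" "v \<noteq> 0"
  shows "proj u = proj v \<longleftrightarrow> (\<exists>c. c \<noteq> 0 \<and> u = c *\<^sub>R v)"
proof
  assume "proj u = proj v"
  then have "span {u} = span {v}" using assms line_of_proj by metis
  then have "u \<in> span {v}" by (metis span_base singletonI)
  then show "\<exists>c. c \<noteq> 0 \<and> u = c *\<^sub>R v" using assms by (auto simp: span_singleton)
next
  assume "\<exists>c. c \<noteq> 0 \<and> u = c *\<^sub>R v"
  then obtain c where c: "c \<noteq> 0" "u = c *\<^sub>R v" by blast
  then have "v = (1/c) *\<^sub>R u" by simp
  then have "u \<in> span {v}" "v \<in> span {u}" using c by (metis rangeI span_singleton)+
  then have "span {u} = span {v}" by (simp add: span_eq)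
  then show "proj u = proj v" by (simp add: proj_def)
qed

lemma proj_scale: assumes "c \<noteq> 0" shows "proj (c *\<^sub>R v) = proj v"
proof (cases "v = 0")
  case False
  then have "c *\<^sub>R v \<noteq> 0" using assms by simp
  then show ?thesis using assms False by (subst proj_eq_iff) blast+
qed simp

lemma proj_eqE:
  assumes "proj u = proj v" "u \<noteq> 0" "v \<noteq> 0" obtains c where "c \<noteq> 0" "u = c *\<^sub>R v"
  using assms(1) proj_eq_iff[OF assms(2,3)] that by blast

lemma proj_minus: "proj (- v) = proj v"
  using proj_scale[of "-1" v] by simp

lemma proj_in_proj_space:
  assumes "v \<noteq> 0" "subspace V"
  shows "proj v \<in> proj_space V \<longleftrightarrow> v \<in> V"
proof -
  have "span {v} \<subseteq> V \<longleftrightarrow> v \<in> V"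
    using span_minimal[of "{v}" V] span_superset[of "{v}"] assms(2) by auto
  then show ?thesis by (simp add: proj_space_def line_of_proj assms(1))
qed

lemma proj_act_proj:
  fixes g :: "real^'n^'n"
  assumes "v \<noteq> 0" "g *v v \<noteq> 0"
  shows "proj_act g (proj v) = proj (g *v v)"
  unfolding proj_act_def proj_def[of "g *v v"] line_of_proj[OF assms(1)]
  using linear_span_image[OF matrix_vector_mul_linear, of g "{v}"] by simp

lemma tendsto_proj:
  fixes u :: "'a::euclidean_space"
  assumes "(f \<longlongrightarrow> u) F" "u \<noteq> 0"
  shows "((\<lambda>x. proj (f x)) \<longlongrightarrow> proj u) F"
proof (rule topological_tendstoI)
  fix S :: "'a projective set" assume "open S" "proj u \<in> S"
  then have "open {v. v \<noteq> 0 \<and> proj v \<in> S}" "u \<in> {v. v \<noteq> 0 \<and> proj v \<in> S}"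
    using assms by (auto simp: open_projective_def)
  from topological_tendstoD[OF assms(1) this]
  show "eventually (\<lambda>x. proj (f x) \<in> S) F" by (rule eventually_mono) auto
qed

text \<open>The Hausdorff property of projective space in the one case required. Up to the factor
  \<open>a \<bullet> a\<close>, \<open>f v\<close> is the norm of the part of \<open>v\<close>
  orthogonal to \<open>a\<close>; the condition \<open>f v > d * norm v\<close> is homogeneous and
  cuts out an open set of lines around \<open>u\<close> that stays away from
  \<open>a\<close>.\<close>

lemma proj_limit_unique:
  fixes u :: "'a::euclidean_space"
  assumes lim: "x \<longlonglongrightarrow> a" and a: "a \<noteq> 0" and u: "u \<noteq> 0"
    and plim: "(\<lambda>n. proj (x n)) \<longlonglongrightarrow> proj u"
  shows "proj a = proj u"
proof (rule ccontr)
  assume ne: "proj a \<noteq> proj u"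
  define f where "f v = norm ((a \<bullet> a) *\<^sub>R v - (a \<bullet> v) *\<^sub>R a)" for v
  have cont_f: "continuous_on S f" for S unfolding f_def by (intro continuous_intros)
  have f0: "f u > 0"
  proof (rule ccontr)
    assume "\<not> f u > 0"
    then have "(a \<bullet> a) *\<^sub>R u = (a \<bullet> u) *\<^sub>R a" by (simp add: f_def)
    then have u': "u = ((a \<bullet> u) / (a \<bullet> a)) *\<^sub>R a" using a
      by (metis divide_inverse inner_eq_zero_iff left_inverse mult.commute scaleR_one scaleR_scaleR)
    then have "(a \<bullet> u) / (a \<bullet> a) \<noteq> 0" using u by (metis scaleR_zero_left)
    then show False using proj_scale u' ne by metis
  qed
  define d where "d = f u / (2 * norm u)"
  have d: "d > 0" using f0 u by (simp add: d_def)
  have f_scale: "f (c *\<^sub>R v) = \<bar>c\<bar> * f v" for c v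
  proof -
    have "(a \<bullet> a) *\<^sub>R (c *\<^sub>R v) - (a \<bullet> (c *\<^sub>R v)) *\<^sub>R a = c *\<^sub>R ((a \<bullet> a) *\<^sub>R v - (a \<bullet> v) *\<^sub>R a)"
      by (simp add: algebra_simps)
    then show ?thesis unfolding f_def by simp
  qed
  define U where "U = proj ` {v. v \<noteq> 0 \<and> f v > d * norm v}"
  have U: "proj v \<in> U \<longleftrightarrow> f v > d * norm v" if "v \<noteq> 0" for v
  proof
    assume "proj v \<in> U"
    then obtain y where y: "y \<noteq> 0" "f y > d * norm y" "proj v = proj y" by (auto simp: U_def)
    then obtain c where "c \<noteq> 0" "v = c *\<^sub>R y" using \<open>v \<noteq> 0\<close> by (elim proj_eqE)
    then show "f v > d * norm v" using y(2) by (simp add: f_scale)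
  qed (use that in \<open>auto simp: U_def\<close>)
  have "{v. v \<noteq> 0 \<and> proj v \<in> U} = {v. v \<noteq> 0} \<inter> {v. d * norm v < f v}" using U by auto
  also have "open \<dots>"
    by (intro open_Int open_Collect_neq open_Collect_less continuous_intros cont_f)
  finally have "open U" by (simp add: open_projective_def)
  moreover have "proj u \<in> U" using U[OF u] f0 u by (simp add: d_def)
  ultimately have "eventually (\<lambda>n. proj (x n) \<in> U) sequentially"
    using plim topological_tendstoD by blast
  moreover have "eventually (\<lambda>n. x n \<noteq> 0) sequentially"
    using lim a by (rule tendsto_imp_eventually_ne)
  ultimately have "eventually (\<lambda>n. d * norm (x n) \<le> f (x n)) sequentially"
    by eventually_elim (use U in auto)
  moreover have "(\<lambda>n. f (x n)) \<longlonglongrightarrow> f a" unfolding f_def by (intro tendsto_intros lim)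
  moreover have "(\<lambda>n. d * norm (x n)) \<longlonglongrightarrow> d * norm a" by (intro tendsto_intros lim)
  ultimately have "d * norm a \<le> f a"
    using tendsto_le[OF trivial_limit_sequentially] by blast
  then show False using d a by (simp add: f_def mult_le_0_iff)
qed

lemma affine_chart_proj: "v \<noteq> 0 \<Longrightarrow> proj v \<in> affine_chart w' \<longleftrightarrow> w' \<bullet> v \<noteq> 0"
  unfolding affine_chart_def by (auto simp: line_of_proj span_singleton)

lemma independent_combo_nonzero:
  fixes u v :: "'a::real_vector"
  assumes "\<And>c. u \<noteq> c *\<^sub>R v" "v \<noteq> 0" "s *\<^sub>R u + t *\<^sub>R v = 0"
  shows "s = 0 \<and> t = 0"
proof -
  have "s = 0"
  proof (rule ccontr)
    assume s: "s \<noteq> 0"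
    have "s *\<^sub>R u = (- t) *\<^sub>R v"
      using eq_neg_iff_add_eq_0[THEN iffD2, OF assms(3)] by simp
    then have "u = ((- t) / s) *\<^sub>R v" using s
      by (metis divide_inverse left_inverse mult.commute scaleR_one scaleR_scaleR)
    then show False using assms(1) by blast
  qed
  then show ?thesis using assms by auto
qed

section \<open>The domain below a cone: closure, frontier, charts and segments\<close>

locale cone_domain = pointed_cone C w M
  for C :: "'a::euclidean_space set" and w :: 'a and M :: real +
  fixes \<Omega> :: "'a projective set"
  assumes proj_in_domain: "v \<noteq> 0 \<Longrightarrow> proj v \<in> \<Omega> \<longleftrightarrow> v \<in> C \<or> - v \<in> C"
begin

lemma w_nonzero: "w \<noteq> 0"
proof
  assume "w = 0"
  moreover obtain v where "v \<in> C" using nonempty_C by blast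
  ultimately show False using pos_C[of v] by simp
qed

lemma open_domain: "open \<Omega>"
proof -
  have "{v. v \<noteq> 0 \<and> proj v \<in> \<Omega>} = C \<union> uminus ` C"
    using nonzero_C proj_in_domain by (auto simp: image_iff) (metis minus_minus)+
  also have "open \<dots>" using open_C by (intro open_Un open_negations)
  finally show ?thesis by (simp add: open_projective_def)
qed

text \<open>The topology is a quotient, so closedness of the image of \<open>D\<close> is checked on
  its preimage, which is \<open>D\<close> together with its negative. The converse pushes convergent
  sequences forward.\<close>

lemma proj_in_closure:
  assumes "v \<noteq> 0"
  shows "proj v \<in> closure \<Omega> \<longleftrightarrow> v \<in> D \<or> - v \<in> D"
proof
  let ?S = "proj ` (D - {0})"
  have S: "proj v \<in> ?S \<longleftrightarrow> v \<in> D \<or> - v \<in> D" if "v \<noteq> 0" for v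
  proof
    assume "proj v \<in> ?S"
    then obtain y where y: "y \<in> D" "y \<noteq> 0" "proj v = proj y" by auto
    then obtain c where c: "c \<noteq> 0" "v = c *\<^sub>R y" using \<open>v \<noteq> 0\<close> by (elim proj_eqE)
    show "v \<in> D \<or> - v \<in> D"
      using scale_D[OF y(1), of c] scale_D[OF y(1), of "-c"] c by (cases "c > 0") auto
  next
    assume "v \<in> D \<or> - v \<in> D"
    then show "proj v \<in> ?S"
      using that proj_minus[of v] by (metis DiffI image_eqI neg_equal_0_iff_equal singletonD)
  qed
  have "{v. v \<noteq> 0 \<and> proj v \<in> - ?S} = - {0} \<inter> - D \<inter> - uminus ` D"
    (is "?L = ?R")
  proof (rule Set.set_eqI)
    fix v :: 'a
    have "v \<in> uminus ` D \<longleftrightarrow> - v \<in> D" by (auto intro: rev_image_eqI[of "- v"])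
    then show "v \<in> ?L \<longleftrightarrow> v \<in> ?R" using S[of v] by auto
  qed
  also have "open \<dots>" by (intro open_Int open_Compl closed_negations) auto
  finally have "closed ?S" by (simp add: open_projective_def closed_def)
  moreover have "\<Omega> \<subseteq> ?S"
  proof
    fix p assume "p \<in> \<Omega>"
    then obtain v where "v \<noteq> 0" "p = proj v" "v \<in> C \<or> - v \<in> C"
      using exists_proj proj_in_domain by metis
    then show "p \<in> ?S" using S C_sub_D by blast
  qed
  ultimately have "closure \<Omega> \<subseteq> ?S" by (simp add: closure_minimal)
  then show "proj v \<in> closure \<Omega> \<Longrightarrow> v \<in> D \<or> - v \<in> D" using S[OF assms] by blast
next
  have *: "proj v \<in> closure \<Omega>" if v: "v \<in> D" "v \<noteq> 0" for v
  proof -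
    obtain x where x: "\<And>n. x n \<in> C" "x \<longlonglongrightarrow> v"
      using v unfolding closure_sequential by blast
    have "(\<lambda>n. proj (x n)) \<longlonglongrightarrow> proj v" using x(2) v(2) by (rule tendsto_proj)
    moreover have "proj (x n) \<in> closure \<Omega>" for n
      using x(1) nonzero_C proj_in_domain closure_subset by blast
    ultimately show ?thesis
      using Lim_in_closed_set[of "closure \<Omega>" "\<lambda>n. proj (x n)" sequentially] by auto
  qed
  show "v \<in> D \<or> - v \<in> D \<Longrightarrow> proj v \<in> closure \<Omega>"
    using *[of v] *[of "- v"] assms by (auto simp: proj_minus)
qed

lemma proj_in_frontier:
  assumes "v \<noteq> 0"
  shows "proj v \<in> frontier \<Omega> \<longleftrightarrow> v \<in> bd \<or> - v \<in> bd"
proof -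
  have "proj v \<in> frontier \<Omega> \<longleftrightarrow> (v \<in> D \<or> - v \<in> D) \<and> \<not> (v \<in> C \<or> - v \<in> C)"
    unfolding frontier_def interior_open[OF open_domain]
    using assms proj_in_closure proj_in_domain by auto
  also have "\<dots> \<longleftrightarrow> v \<in> bd \<or> - v \<in> bd"
    using assms pointed[of v] C_sub_D[of v] C_sub_D[of "- v"] by (auto simp: bd_def)
  finally show ?thesis .
qed

lemma bd_frontier: "v \<in> bd \<Longrightarrow> proj v \<in> frontier \<Omega>"
  using proj_in_frontier[of v] by (auto simp: bd_def)

lemma frontier_obtain:
  assumes "p \<in> frontier \<Omega>" obtains v where "v \<in> bd" "p = proj v"
  using assms exists_proj[of p] proj_in_frontier proj_minus by metis

lemma domain_obtain:
  assumes "p \<in> \<Omega>" obtains v where "v \<in> C" "p = proj v"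
  using assms exists_proj[of p] proj_in_domain proj_minus by metis

lemma proj_C: "v \<in> C \<Longrightarrow> proj v \<in> \<Omega>"
  using proj_in_domain nonzero_C by blast

lemma proj_D_in_domain: assumes "v \<in> D" "v \<noteq> 0" shows "proj v \<in> \<Omega> \<longleftrightarrow> v \<in> C"
  using proj_in_domain[OF assms(2)] pointed[OF assms(1)] C_sub_D[of "- v"] assms(2) by blast

lemma chart_contains_w: "chart_contains w (closure \<Omega>)"
  unfolding chart_contains_def
proof (intro conjI subsetI)
  fix p assume p: "p \<in> closure \<Omega>"
  obtain v where v: "v \<noteq> 0" "p = proj v" using exists_proj by blast
  then have "v \<in> D \<or> - v \<in> D" using p proj_in_closure by blast
  then have "w \<bullet> v \<noteq> 0" using pos_D[of v] pos_D[of "- v"] v by auto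
  then show "p \<in> affine_chart w" using v affine_chart_proj by blast
qed (rule w_nonzero)

text \<open>The reason why nothing depends on the chart. If \<open>w'\<close> had opposite signs at
  two vectors of \<open>D\<close>, the combination with weights \<open>?s\<close> and
  \<open>?t\<close> would lie in the kernel of \<open>w'\<close>; but it is in \<open>D\<close>, and
  nonzero because \<open>w\<close> is positive on it.\<close>

lemma chart_sign:
  assumes "chart_contains w' (closure \<Omega>)"
  obtains e :: real where "\<And>v. v \<in> D \<Longrightarrow> v \<noteq> 0 \<Longrightarrow> e * (w' \<bullet> v) > 0"
proof -
  have nz: "w' \<bullet> v \<noteq> 0" if "v \<in> D" "v \<noteq> 0" for v
    using assms proj_in_closure[of v] affine_chart_proj[of v w'] that
    by (auto simp: chart_contains_def)
  obtain v0 where v0: "v0 \<in> D" "v0 \<noteq> 0" using nonempty_C nonzero_C C_sub_D by blast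
  show thesis
  proof (rule that[of "w' \<bullet> v0"])
    fix v assume v: "v \<in> D" "v \<noteq> 0"
    show "(w' \<bullet> v0) * (w' \<bullet> v) > 0"
    proof (rule ccontr)
      assume "\<not> ?thesis"
      then have neg: "(w' \<bullet> v0) * (w' \<bullet> v) < 0" using nz[OF v] nz[OF v0]
        by (meson linorder_neqE_linordered_idom mult_eq_0_iff)
      let ?s = "\<bar>w' \<bullet> v\<bar>" and ?t = "\<bar>w' \<bullet> v0\<bar>"
      have zD: "?s *\<^sub>R v0 + ?t *\<^sub>R v \<in> D" using v v0 by (intro combo_D) auto
      have "w \<bullet> (?s *\<^sub>R v0 + ?t *\<^sub>R v) > 0"
        using pos_D[OF v] pos_D[OF v0] nz[OF v] nz[OF v0]
        by (simp add: inner_add_right add_pos_pos)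
      then have "?s *\<^sub>R v0 + ?t *\<^sub>R v \<noteq> 0" by auto
      with zD have "w' \<bullet> (?s *\<^sub>R v0 + ?t *\<^sub>R v) \<noteq> 0" by (rule nz)
      moreover have "w' \<bullet> (?s *\<^sub>R v0 + ?t *\<^sub>R v) = 0"
        using neg by (auto simp: inner_add_right abs_if mult_less_0_iff)
      ultimately show False by simp
    qed
  qed
qed

text \<open>Eliminates charts: up to the sign from \<open>chart_sign\<close>, affine and nonnegative
  linear combinations differ by positive denominators. For the converse the chart of
  \<open>w\<close> suffices.\<close>

lemma proj_seg_iff:
  assumes u: "u \<in> D" "u \<noteq> 0" and v: "v \<in> D" "v \<noteq> 0"
  shows "z \<in> proj_seg \<Omega> (proj u) (proj v) \<longleftrightarrow>
    (\<exists>s t. s \<ge> 0 \<and> t \<ge> 0 \<and> s *\<^sub>R u + t *\<^sub>R v \<noteq> 0 \<and> z = proj (s *\<^sub>R u + t *\<^sub>R v))"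
proof
  assume "z \<in> proj_seg \<Omega> (proj u) (proj v)"
  then obtain w' where w': "chart_contains w' (closure \<Omega>)" "z \<in> affine_chart w'"
      "chart w' z \<in> closed_segment (chart w' (proj u)) (chart w' (proj v))"
    unfolding proj_seg_def by blast
  obtain e where e: "\<And>v. v \<in> D \<Longrightarrow> v \<noteq> 0 \<Longrightarrow> e * (w' \<bullet> v) > 0" using chart_sign[OF w'(1)] by blast
  have eu: "e * (w' \<bullet> u) > 0" and ev: "e * (w' \<bullet> v) > 0" using e u v by auto
  then have nz: "w' \<bullet> u \<noteq> 0" "w' \<bullet> v \<noteq> 0" "e \<noteq> 0" by auto
  obtain y where y: "y \<noteq> 0" "z = proj y" using exists_proj by blast
  then have wy: "w' \<bullet> y \<noteq> 0" using w'(2) affine_chart_proj by blast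
  obtain r where r: "0 \<le> r" "r \<le> 1"
    "(1 / (w' \<bullet> y)) *\<^sub>R y = (1 - r) *\<^sub>R (1 / (w' \<bullet> u)) *\<^sub>R u + r *\<^sub>R (1 / (w' \<bullet> v)) *\<^sub>R v"
    using w'(3) nz wy y(2) by (auto simp: chart_proj in_segment)
  let ?s = "(1 - r) / (e * (w' \<bullet> u))" and ?t = "r / (e * (w' \<bullet> v))"
  have "(1/e) *\<^sub>R ((1 / (w' \<bullet> y)) *\<^sub>R y) = ?s *\<^sub>R u + ?t *\<^sub>R v"
    unfolding r(3) by (simp add: scaleR_add_right field_simps)
  then have eq: "(1 / (e * (w' \<bullet> y))) *\<^sub>R y = ?s *\<^sub>R u + ?t *\<^sub>R v" by simp
  have c: "1 / (e * (w' \<bullet> y)) \<noteq> 0" using nz wy by simp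
  show "\<exists>s t. s \<ge> 0 \<and> t \<ge> 0 \<and> s *\<^sub>R u + t *\<^sub>R v \<noteq> 0 \<and> z = proj (s *\<^sub>R u + t *\<^sub>R v)"
  proof (intro exI conjI)
    show "?s \<ge> 0" "?t \<ge> 0" using r eu ev by (auto intro!: divide_nonneg_pos)
    show "?s *\<^sub>R u + ?t *\<^sub>R v \<noteq> 0" unfolding eq[symmetric] using c y by simp
    show "z = proj (?s *\<^sub>R u + ?t *\<^sub>R v)" unfolding eq[symmetric] using c y proj_scale by metis
  qed
next
  assume "\<exists>s t. s \<ge> 0 \<and> t \<ge> 0 \<and> s *\<^sub>R u + t *\<^sub>R v \<noteq> 0 \<and> z = proj (s *\<^sub>R u + t *\<^sub>R v)"
  then obtain s t where st: "s \<ge> 0" "t \<ge> 0" "s *\<^sub>R u + t *\<^sub>R v \<noteq> 0" "z = proj (s *\<^sub>R u + t *\<^sub>R v)"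
    by blast
  let ?y = "s *\<^sub>R u + t *\<^sub>R v"
  have wu: "w \<bullet> u > 0" and wv: "w \<bullet> v > 0" using u v pos_D by auto
  have wy: "w \<bullet> ?y > 0" using st u v by (intro pos_D combo_D) auto
  have eqy: "w \<bullet> ?y = s * (w \<bullet> u) + t * (w \<bullet> v)" by (simp add: inner_add_right)
  define r where "r = t * (w \<bullet> v) / (w \<bullet> ?y)"
  have r1: "1 - r = s * (w \<bullet> u) / (w \<bullet> ?y)"
    unfolding r_def using wy eqy by (simp add: field_simps)
  have "0 \<le> r" "0 \<le> 1 - r" using r1 r_def st wu wv wy by simp_all
  moreover have "(1 / (w \<bullet> ?y)) *\<^sub>R ?y = (1 - r) *\<^sub>R (1 / (w \<bullet> u)) *\<^sub>R u + r *\<^sub>R (1 / (w \<bullet> v)) *\<^sub>R v"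
    unfolding r1 using wu wv by (simp add: r_def scaleR_add_right)
  ultimately have "chart w z \<in> closed_segment (chart w (proj u)) (chart w (proj v))"
    using wu wv wy by (simp only: st(4) chart_proj less_imp_neq[symmetric] not_False_eq_True in_segment)
      (intro exI[of _ r], simp)
  moreover have "z \<in> affine_chart w" using st wy affine_chart_proj by (metis less_irrefl)
  ultimately show "z \<in> proj_seg \<Omega> (proj u) (proj v)"
    unfolding proj_seg_def using chart_contains_w by blast
qed

lemma open_proj_seg_eq:
  assumes u: "u \<in> D" "u \<noteq> 0" and v: "v \<in> D" "v \<noteq> 0" and ind: "\<And>c. u \<noteq> c *\<^sub>R v"
  shows "open_proj_seg \<Omega> (proj u) (proj v) = {proj (s *\<^sub>R u + t *\<^sub>R v) | s t. s > 0 \<and> t > 0}"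
proof (intro equalityI subsetI)
  fix z assume "z \<in> open_proj_seg \<Omega> (proj u) (proj v)"
  then obtain s t where st: "s \<ge> 0" "t \<ge> 0" "s *\<^sub>R u + t *\<^sub>R v \<noteq> 0" "z = proj (s *\<^sub>R u + t *\<^sub>R v)"
    "z \<noteq> proj u" "z \<noteq> proj v"
    unfolding open_proj_seg_def using proj_seg_iff[OF u v] by auto
  have "s \<noteq> 0" using st proj_scale[of t v] by (cases "t = 0") auto
  moreover have "t \<noteq> 0" using st proj_scale[of s u] by (cases "s = 0") auto
  ultimately show "z \<in> {proj (s *\<^sub>R u + t *\<^sub>R v) | s t. s > 0 \<and> t > 0}" using st by force
next
  fix z assume "z \<in> {proj (s *\<^sub>R u + t *\<^sub>R v) | s t. s > 0 \<and> t > 0}"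
  then obtain s t where st: "s > 0" "t > 0" "z = proj (s *\<^sub>R u + t *\<^sub>R v)" by auto
  have nz: "s *\<^sub>R u + t *\<^sub>R v \<noteq> 0" using independent_combo_nonzero[OF ind v(2)] st by blast
  have "z \<in> proj_seg \<Omega> (proj u) (proj v)"
    unfolding proj_seg_iff[OF u v] using st nz by (intro exI[of _ s] exI[of _ t]) auto
  moreover have "z \<noteq> proj u"
  proof
    assume "z = proj u"
    then obtain c where "s *\<^sub>R u + t *\<^sub>R v = c *\<^sub>R u" using st(3) nz u(2) by (metis proj_eqE)
    then have "(s - c) *\<^sub>R u + t *\<^sub>R v = 0" by (simp add: algebra_simps)
    then show False using independent_combo_nonzero[OF ind v(2)] st by (metis less_irrefl)
  qed
  moreover have "z \<noteq> proj v"
  proof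
    assume "z = proj v"
    then obtain c where "s *\<^sub>R u + t *\<^sub>R v = c *\<^sub>R v" using st(3) nz v(2) by (metis proj_eqE)
    then have "s *\<^sub>R u + (t - c) *\<^sub>R v = 0" by (simp add: algebra_simps)
    then show False using independent_combo_nonzero[OF ind v(2)] st by (metis less_irrefl)
  qed
  ultimately show "z \<in> open_proj_seg \<Omega> (proj u) (proj v)" by (simp add: open_proj_seg_def)
qed

lemma open_proj_seg_self:
  assumes u: "u \<in> D" "u \<noteq> 0" shows "open_proj_seg \<Omega> (proj u) (proj u) = {}"
proof -
  have "z = proj u" if z: "z \<in> proj_seg \<Omega> (proj u) (proj u)" for z
  proof -
    obtain s t where "s *\<^sub>R u + t *\<^sub>R u \<noteq> 0" "z = proj (s *\<^sub>R u + t *\<^sub>R u)"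
      using z[unfolded proj_seg_iff[OF u u]] by blast
    moreover have "s *\<^sub>R u + t *\<^sub>R u = (s + t) *\<^sub>R u" by (simp add: scaleR_add_left)
    ultimately show ?thesis using proj_scale by (metis scaleR_zero_left)
  qed
  then show ?thesis by (auto simp: open_proj_seg_def)
qed

section \<open>Segments and half triangles in terms of sums of boundary vectors\<close>

lemma bd_dependent:
  assumes "u \<in> bd" "v \<in> bd" "u = c *\<^sub>R v"
  shows "c > 0" "proj u = proj v" "u + v \<notin> C"
proof -
  have "w \<bullet> u > 0" "w \<bullet> v > 0" using assms(1,2) pos_D[of u] pos_D[of v] by (auto simp: bd_def)
  then show c: "c > 0" using assms by (simp add: zero_less_mult_iff)
  show "proj u = proj v" using assms(3) c by (simp add: proj_scale)
  have "u + v = (c + 1) *\<^sub>R v" using assms by (simp add: algebra_simps)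
  then show "u + v \<notin> C" using c assms by (simp add: scale_C_iff bd_def)
qed

lemma open_proj_seg_subset:
  assumes u: "u \<in> bd" and v: "v \<in> bd" and ne: "proj u \<noteq> proj v"
  shows "open_proj_seg \<Omega> (proj u) (proj v) \<subseteq> \<Omega> \<longleftrightarrow> u + v \<in> C"
proof -
  have ind: "\<And>c. u \<noteq> c *\<^sub>R v" using bd_dependent[OF u v] ne by blast
  have D: "u \<in> D" "u \<noteq> 0" "v \<in> D" "v \<noteq> 0" using u v by (auto simp: bd_def)
  have *: "proj (s *\<^sub>R u + t *\<^sub>R v) \<in> \<Omega> \<longleftrightarrow> s *\<^sub>R u + t *\<^sub>R v \<in> C" if "s > 0" "t > 0" for s t
    using that D independent_combo_nonzero[OF ind D(4), of s t]
    by (intro proj_D_in_domain combo_D) auto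
  show ?thesis unfolding open_proj_seg_eq[OF D ind]
  proof
    assume "{proj (s *\<^sub>R u + t *\<^sub>R v) |s t. 0 < s \<and> 0 < t} \<subseteq> \<Omega>"
    moreover have "proj (1 *\<^sub>R u + 1 *\<^sub>R v) \<in> {proj (s *\<^sub>R u + t *\<^sub>R v) |s t. 0 < s \<and> 0 < t}"
      using zero_less_one by blast
    ultimately show "u + v \<in> C" using *[of 1 1] by auto
  qed (use * combo_C[OF D(1) D(3)] in auto)
qed

text \<open>Degenerate triangles need care: if \<open>z\<close> is one of the ends, the open segment
  to it is empty, hence inside the domain, and the sum with the other end is in \<open>C\<close>
  because \<open>u + v\<close> is.\<close>

lemma half_triangle_open_seg_iff:
  assumes u: "u \<in> bd" and v: "v \<in> bd" and C: "u + v \<in> C" and z: "z \<in> bd"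
  shows "open_proj_seg \<Omega> (proj u) (proj z) \<subseteq> \<Omega> \<or> open_proj_seg \<Omega> (proj z) (proj v) \<subseteq> \<Omega> \<longleftrightarrow>
    u + z \<in> C \<or> z + v \<in> C"
proof -
  have D: "u \<in> D" "u \<noteq> 0" "v \<in> D" "v \<noteq> 0" "z \<in> D" "z \<noteq> 0" using u v z by (auto simp: bd_def)
  consider "proj z = proj u" | "proj z = proj v" | "proj z \<noteq> proj u" "proj z \<noteq> proj v" by blast
  then show ?thesis
  proof cases
    case 1
    then obtain c where "z = c *\<^sub>R u" using D by (metis proj_eqE)
    then have "z + v \<in> C"
      using bd_dependent(1)[OF z u] combo_C[OF D(1) D(3) C, of c 1] by auto
    then show ?thesis using 1 open_proj_seg_self[OF D(1,2)] by simp
  next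
    case 2
    then obtain c where "z = c *\<^sub>R v" using D by (metis proj_eqE)
    then have "u + z \<in> C"
      using bd_dependent(1)[OF z v] combo_C[OF D(1) D(3) C, of 1 c] by auto
    then show ?thesis using 2 open_proj_seg_self[OF D(3,4)] by simp
  next
    case 3
    then show ?thesis using open_proj_seg_subset[OF u z] open_proj_seg_subset[OF z v] by auto
  qed
qed

lemma interior_bd_pair:
  assumes u: "u \<in> bd" and v: "v \<in> bd" and C: "u + v \<in> C"
    and half: "\<And>z. z \<in> bd \<Longrightarrow> u + z \<in> C \<or> z + v \<in> C"
  shows "open_proj_seg \<Omega> (proj u) (proj v) \<subseteq> \<Omega>" "proj u \<noteq> proj v"
    "z \<in> frontier \<Omega> \<Longrightarrow> open_proj_seg \<Omega> (proj u) z \<subseteq> \<Omega> \<or> open_proj_seg \<Omega> z (proj v) \<subseteq> \<Omega>"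
proof -
  show ne: "proj u \<noteq> proj v"
  proof
    assume "proj u = proj v"
    moreover have "u \<noteq> 0" "v \<noteq> 0" using u v by (auto simp: bd_def)
    ultimately obtain c where "u = c *\<^sub>R v" by (metis proj_eqE)
    then show False using bd_dependent(3)[OF u v] C by blast
  qed
  show "open_proj_seg \<Omega> (proj u) (proj v) \<subseteq> \<Omega>" using open_proj_seg_subset[OF u v ne] C by blast
  assume "z \<in> frontier \<Omega>"
  then obtain y where "y \<in> bd" "z = proj y" by (rule frontier_obtain)
  then show "open_proj_seg \<Omega> (proj u) z \<subseteq> \<Omega> \<or> open_proj_seg \<Omega> z (proj v) \<subseteq> \<Omega>"
    using half_triangle_open_seg_iff[OF u v C] half by blast
qed

text \<open>If any point of the segment were interior, raising both weights to
  \<open>max s t\<close> would give an interior multiple of \<open>u + v\<close>.\<close>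

lemma proj_seg_frontier_iff:
  assumes u: "u \<in> bd" and v: "v \<in> bd"
  shows "proj_seg \<Omega> (proj u) (proj v) \<subseteq> frontier \<Omega> \<longleftrightarrow> u + v \<notin> C"
proof -
  have D: "u \<in> D" "u \<noteq> 0" "v \<in> D" "v \<noteq> 0" using u v by (auto simp: bd_def)
  show ?thesis
  proof
    assume sub: "proj_seg \<Omega> (proj u) (proj v) \<subseteq> frontier \<Omega>"
    show "u + v \<notin> C"
    proof
      assume C: "u + v \<in> C"
      then have "proj (u + v) \<in> proj_seg \<Omega> (proj u) (proj v)"
        unfolding proj_seg_iff[OF D] by (intro exI[of _ 1]) (use nonzero_C in auto)
      then have "proj (u + v) \<in> frontier \<Omega>" using sub by blast
      then show False using proj_C[OF C] open_domain by (simp add: frontier_def interior_open)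
    qed
  next
    assume nC: "u + v \<notin> C"
    show "proj_seg \<Omega> (proj u) (proj v) \<subseteq> frontier \<Omega>"
    proof
      fix z assume "z \<in> proj_seg \<Omega> (proj u) (proj v)"
      then obtain s t where st: "s \<ge> 0" "t \<ge> 0" "s *\<^sub>R u + t *\<^sub>R v \<noteq> 0" "z = proj (s *\<^sub>R u + t *\<^sub>R v)"
        using proj_seg_iff[OF D] by auto
      have "s *\<^sub>R u + t *\<^sub>R v \<notin> C"
      proof
        assume *: "s *\<^sub>R u + t *\<^sub>R v \<in> C"
        define m where "m = max s t"
        have m: "m > 0" using st by (cases "s = 0 \<and> t = 0") (auto simp: m_def)
        have "s *\<^sub>R u + t *\<^sub>R v + ((m - s) *\<^sub>R u + (m - t) *\<^sub>R v) \<in> C"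
          using D by (intro add_CD[OF *] combo_D) (auto simp: m_def)
        moreover have "s *\<^sub>R u + t *\<^sub>R v + ((m - s) *\<^sub>R u + (m - t) *\<^sub>R v) = m *\<^sub>R (u + v)"
          by (simp add: algebra_simps)
        ultimately show False using nC m by (simp add: scale_C_iff)
      qed
      then have "s *\<^sub>R u + t *\<^sub>R v \<in> bd" using st D combo_D by (auto simp: bd_def)
      then show "z \<in> frontier \<Omega>" using st bd_frontier by blast
    qed
  qed
qed

end

locale vec_domain = cone_domain C w M \<Omega>
  for C :: "(real^'n) set" and w M \<Omega>
begin

lemma rank_one_geodesic_proj_iff:
  assumes u: "u \<in> bd" and v: "v \<in> bd"
  shows "rank_one_geodesic \<Omega> (proj u) (proj v) \<longleftrightarrow>
    u + v \<in> C \<and> (\<forall>z\<in>bd. u + z \<in> C \<or> z + v \<in> C)"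
proof
  assume r: "rank_one_geodesic \<Omega> (proj u) (proj v)"
  then have C: "u + v \<in> C" using open_proj_seg_subset[OF u v] by (auto simp: rank_one_geodesic_def)
  show "u + v \<in> C \<and> (\<forall>z\<in>bd. u + z \<in> C \<or> z + v \<in> C)"
    using C r half_triangle_open_seg_iff[OF u v C] bd_frontier by (auto simp: rank_one_geodesic_def)
next
  assume "u + v \<in> C \<and> (\<forall>z\<in>bd. u + z \<in> C \<or> z + v \<in> C)"
  then show "rank_one_geodesic \<Omega> (proj u) (proj v)"
    using interior_bd_pair[OF u v] bd_frontier u v unfolding rank_one_geodesic_def by blast
qed

text \<open>One notion uses open segments inside the domain, the other closed segments in the
  frontier. Together with \<open>rank_one_geodesic_proj_iff\<close> this reduces both to the same
  condition on sums.\<close>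

lemma in_half_triangle_iff:
  assumes u: "u \<in> bd" and v: "v \<in> bd"
  shows "in_half_triangle \<Omega> (proj u) (proj v) \<longleftrightarrow> (\<exists>z\<in>bd. u + z \<notin> C \<and> z + v \<notin> C)"
proof
  assume "in_half_triangle \<Omega> (proj u) (proj v)"
  then obtain y where "y \<in> frontier \<Omega>" "proj_seg \<Omega> (proj u) y \<subseteq> frontier \<Omega>"
      "proj_seg \<Omega> y (proj v) \<subseteq> frontier \<Omega>"
    unfolding in_half_triangle_def by blast
  then show "\<exists>z\<in>bd. u + z \<notin> C \<and> z + v \<notin> C"
    using proj_seg_frontier_iff u v by (metis frontier_obtain)
next
  assume "\<exists>z\<in>bd. u + z \<notin> C \<and> z + v \<notin> C"
  then obtain z where z: "z \<in> bd" "u + z \<notin> C" "z + v \<notin> C" by blast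
  then show "in_half_triangle \<Omega> (proj u) (proj v)"
    unfolding in_half_triangle_def using proj_seg_frontier_iff[OF u z(1)] proj_seg_frontier_iff[OF z(1) v]
      bd_frontier[OF z(1)] by blast
qed

end

section \<open>The Hilbert metric\<close>

lemma properly_convex_domain_cone:
  fixes \<Omega> :: "'a::euclidean_space projective set"
  assumes "properly_convex_domain \<Omega>"
  obtains C w M where "cone_domain C w M \<Omega>"
proof -
  from assms obtain w where open_Om: "open \<Omega>" and ne: "\<Omega> \<noteq> {}"
    and w: "chart_contains w (closure \<Omega>)" "bounded (chart w ` \<Omega>)" "convex (chart w ` \<Omega>)"
    unfolding properly_convex_domain_def by blast
  obtain M where M: "\<And>p. p \<in> \<Omega> \<Longrightarrow> norm (chart w p) \<le> M"
    using w(2) unfolding bounded_iff by blast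
  define C where "C = {v. v \<noteq> 0 \<and> proj v \<in> \<Omega>} \<inter> {v. 0 < w \<bullet> v}"
  have nz: "w \<bullet> v \<noteq> 0" if v: "v \<noteq> 0" "proj v \<in> \<Omega>" for v
  proof -
    have "proj v \<in> affine_chart w"
      using w(1) v closure_subset unfolding chart_contains_def by blast
    then obtain u where "u \<in> line_of (proj v)" "w \<bullet> u \<noteq> 0" unfolding affine_chart_def by blast
    then show ?thesis unfolding line_of_proj[OF v(1)] span_singleton by auto
  qed
  have inC: "v \<in> C \<longleftrightarrow> 0 < w \<bullet> v \<and> (1 / (w \<bullet> v)) *\<^sub>R v \<in> chart w ` \<Omega>" for v
  proof
    assume "v \<in> C"
    then show "0 < w \<bullet> v \<and> (1 / (w \<bullet> v)) *\<^sub>R v \<in> chart w ` \<Omega>"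
      using chart_proj[of w v] by (auto simp: C_def intro: rev_image_eqI[of "proj v"])
  next
    assume *: "0 < w \<bullet> v \<and> (1 / (w \<bullet> v)) *\<^sub>R v \<in> chart w ` \<Omega>"
    then obtain p where p: "p \<in> \<Omega>" "(1 / (w \<bullet> v)) *\<^sub>R v = chart w p" by blast
    obtain y where y: "y \<noteq> 0" "p = proj y" using exists_proj by blast
    have wy: "w \<bullet> y \<noteq> 0" using nz y p by blast
    have eq: "(1 / (w \<bullet> v)) *\<^sub>R v = (1 / (w \<bullet> y)) *\<^sub>R y" using p(2) y(2) chart_proj[OF wy] by simp
    have "proj v = proj ((1 / (w \<bullet> v)) *\<^sub>R v)" using * by (simp add: proj_scale)
    also have "\<dots> = proj y" unfolding eq using wy by (simp add: proj_scale)
    finally show "v \<in> C" using * p(1) y(2) by (auto simp: C_def)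
  qed
  have "cone_domain C w M \<Omega>"
  proof unfold_locales
    show "open C" unfolding C_def using open_Om
      by (intro open_Int open_Collect_less continuous_intros) (simp add: open_projective_def)
    show "convex C"
    proof (rule convexI)
      fix x y and a b :: real
      assume x: "x \<in> C" and y: "y \<in> C" and ab: "0 \<le> a" "0 \<le> b" "a + b = 1"
      have wx: "w \<bullet> x > 0" and wy: "w \<bullet> y > 0" using x y by (auto simp: C_def)
      let ?z = "a *\<^sub>R x + b *\<^sub>R y"
      have wz: "w \<bullet> ?z = a * (w \<bullet> x) + b * (w \<bullet> y)" by (simp add: inner_add_right)
      have wz0: "w \<bullet> ?z > 0"
        unfolding wz using ab wx wy by (cases "a = 0") (auto simp: add_pos_nonneg)
      \<comment> \<open>The chart divides by \<open>w\<close>, so the weights change in proportion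
        to \<open>w \<bullet> x\<close> and \<open>w \<bullet> y\<close>.\<close>
      let ?s = "a * (w \<bullet> x) / (w \<bullet> ?z)" and ?t = "b * (w \<bullet> y) / (w \<bullet> ?z)"
      have "?s + ?t = 1" using wz wz0 by (simp add: add_divide_distrib[symmetric])
      moreover have "?s \<ge> 0" "?t \<ge> 0" using ab wx wy wz0 by (auto intro!: divide_nonneg_pos)
      ultimately have "?s *\<^sub>R ((1 / (w \<bullet> x)) *\<^sub>R x) + ?t *\<^sub>R ((1 / (w \<bullet> y)) *\<^sub>R y) \<in> chart w ` \<Omega>"
        using x y inC by (intro convexD[OF w(3)]) blast+
      also have "?s *\<^sub>R ((1 / (w \<bullet> x)) *\<^sub>R x) + ?t *\<^sub>R ((1 / (w \<bullet> y)) *\<^sub>R y) = (1 / (w \<bullet> ?z)) *\<^sub>R ?z"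
        using wx wy by (simp add: scaleR_add_right)
      finally show "?z \<in> C" using wz0 inC by blast
    qed
    show "C \<noteq> {}"
    proof -
      obtain p where p: "p \<in> \<Omega>" using ne by blast
      obtain y where y: "y \<noteq> 0" "p = proj y" using exists_proj by blast
      have "w \<bullet> y \<noteq> 0" using nz y p by blast
      then have "y \<in> C \<or> - y \<in> C" using p y by (auto simp: C_def proj_minus)
      then show ?thesis by blast
    qed
    show "c *\<^sub>R v \<in> C" if "v \<in> C" "c > 0" for v c
      using that by (auto simp: C_def proj_scale)
    show "w \<bullet> v > 0" if "v \<in> C" for v using that by (simp add: C_def)
    show "norm v \<le> M * (w \<bullet> v)" if "v \<in> C" for v
    proof -
      have wv: "w \<bullet> v > 0" "proj v \<in> \<Omega>" using that by (auto simp: C_def)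
      then have "norm ((1 / (w \<bullet> v)) *\<^sub>R v) \<le> M" using M[of "proj v"] chart_proj[of w v] by simp
      then show ?thesis using wv by (simp add: field_simps)
    qed
    show "proj v \<in> \<Omega> \<longleftrightarrow> v \<in> C \<or> - v \<in> C" if "v \<noteq> 0" for v
      using nz[of v] that by (auto simp: C_def proj_minus)
  qed
  then show thesis by (rule that)
qed

context cone_domain
begin

lemma proj_closure_obtain:
  assumes "z \<in> closure \<Omega>" obtains y where "y \<in> D" "y \<noteq> 0" "z = proj y"
  using assms exists_proj[of z] proj_in_closure proj_minus by (metis neg_equal_0_iff_equal)

lemma D_proj_eqE:
  assumes "proj u = proj v" "u \<in> D" "u \<noteq> 0" "v \<in> D" "v \<noteq> 0"
  obtains c where "c > 0" "u = c *\<^sub>R v"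
proof -
  obtain c where c: "c \<noteq> 0" "u = c *\<^sub>R v" using assms by (metis proj_eqE)
  have "w \<bullet> u > 0" "w \<bullet> v > 0" using assms pos_D by auto
  then have "c > 0" using c by (simp add: zero_less_mult_iff)
  then show thesis using c that by blast
qed

text \<open>The projective line through \<open>[X]\<close> and \<open>[Y]\<close> leaves the domain at \<open>[b X - Y]\<close> on the side of
  \<open>[X]\<close> and at \<open>[c Y - X]\<close> on the side of \<open>[Y]\<close>; the cross ratio is then \<open>b c\<close>.\<close>

lemma boundary_ratio_obtain:
  assumes X: "X \<in> C" and Y: "Y \<in> C" and ind: "\<And>t. Y \<noteq> t *\<^sub>R X"
    and p: "p \<in> bd" and seg: "proj X \<in> proj_seg \<Omega> (proj p) (proj Y)"
  obtains k b where "k > 0" "b > 0" "k *\<^sub>R p = b *\<^sub>R X - Y"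
proof -
  have D: "p \<in> D" "p \<noteq> 0" "Y \<in> D" "Y \<noteq> 0" "X \<in> D" "X \<noteq> 0"
    using p X Y C_sub_D nonzero_C by (auto simp: bd_def)
  obtain s t where st: "s \<ge> 0" "t \<ge> 0" "s *\<^sub>R p + t *\<^sub>R Y \<noteq> 0" "proj X = proj (s *\<^sub>R p + t *\<^sub>R Y)"
    using seg unfolding proj_seg_iff[OF D(1-4)] by blast
  obtain c where c: "c > 0" "X = c *\<^sub>R (s *\<^sub>R p + t *\<^sub>R Y)"
    using D_proj_eqE[OF st(4) D(5,6) combo_D[OF D(1,3) st(1,2)] st(3)] by blast
  then have X_eq: "X = (c * s) *\<^sub>R p + (c * t) *\<^sub>R Y" by (simp add: scaleR_add_right)
  have t: "t \<noteq> 0"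
  proof
    assume "t = 0"
    then have eq: "X = (c * s) *\<^sub>R p" using X_eq by simp
    then have "c * s \<noteq> 0" using D by auto
    then have "c * s > 0" using c st by (simp add: zero_less_mult_iff)
    then show False using eq X p by (simp add: scale_C_iff bd_def)
  qed
  have s: "s \<noteq> 0"
  proof
    assume "s = 0"
    then have "X = (c * t) *\<^sub>R Y" using X_eq by simp
    then have "Y = (1 / (c * t)) *\<^sub>R X" using c t by simp
    then show False using ind by blast
  qed
  show thesis
  proof (rule that)
    show "s / t > 0" "1 / (c * t) > 0" using s t st c by auto
    show "(s / t) *\<^sub>R p = (1 / (c * t)) *\<^sub>R X - Y"
      unfolding X_eq using c t by (simp add: scaleR_add_right)
  qed
qed

text \<open>All four differences of chart points are multiples of the single vector
  \<open>Z\<close>. Its norm cancels, as do the chart values \<open>x\<close>, \<open>y\<close>,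
  \<open>P\<close> and \<open>Q\<close>, and only the boundary ratios remain.\<close>

lemma hilbert_ratio:
  assumes w': "chart_contains w' (closure \<Omega>)"
    and X: "X \<in> C" and Y: "Y \<in> C" and ind: "\<And>t. Y \<noteq> t *\<^sub>R X"
    and p: "p = b *\<^sub>R X - Y" "p \<in> bd" and q: "q = c *\<^sub>R Y - X" "q \<in> bd"
  shows "(norm (chart w' (proj q) - chart w' (proj X)) * norm (chart w' (proj Y) - chart w' (proj p))) /
         (norm (chart w' (proj q) - chart w' (proj Y)) * norm (chart w' (proj X) - chart w' (proj p)))
       = \<bar>b * c\<bar>"
proof -
  obtain e where e: "\<And>v. v \<in> D \<Longrightarrow> v \<noteq> 0 \<Longrightarrow> e * (w' \<bullet> v) > 0" using chart_sign[OF w'] by blast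
  have D: "p \<in> D" "p \<noteq> 0" "q \<in> D" "q \<noteq> 0" "Y \<in> D" "Y \<noteq> 0" "X \<in> D" "X \<noteq> 0"
    using p(2) q(2) X Y C_sub_D nonzero_C by (auto simp: bd_def)
  define x y P Q where "x = w' \<bullet> X" and "y = w' \<bullet> Y" and "P = w' \<bullet> p" and "Q = w' \<bullet> q"
  have nz: "x \<noteq> 0" "y \<noteq> 0" "P \<noteq> 0" "Q \<noteq> 0"
    using e[OF D(7,8)] e[OF D(5,6)] e[OF D(1,2)] e[OF D(3,4)] by (auto simp: x_def y_def P_def Q_def)
  have PQ: "P = b * x - y" "Q = c * y - x"
    unfolding P_def Q_def x_def y_def p(1) q(1) by (simp_all add: inner_diff_right)
  define Z where "Z = x *\<^sub>R Y - y *\<^sub>R X"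
  have Z: "norm Z > 0"
  proof (rule ccontr)
    assume "\<not> ?thesis"
    then have "x *\<^sub>R Y = y *\<^sub>R X" by (simp add: Z_def)
    then have "Y = (y / x) *\<^sub>R X" using nz
      by (metis divide_inverse left_inverse mult.commute scaleR_one scaleR_scaleR)
    then show False using ind by blast
  qed
  have diff: "(1 / \<beta>) *\<^sub>R u - (1 / \<alpha>) *\<^sub>R v = (1 / (\<beta> * \<alpha>)) *\<^sub>R (\<alpha> *\<^sub>R u - \<beta> *\<^sub>R v)"
    if "\<alpha> \<noteq> 0" "\<beta> \<noteq> 0" for \<alpha> \<beta> :: real and u v :: 'a
    using that by (simp add: scaleR_diff_right)
  have ch: "chart w' (proj X) = (1 / x) *\<^sub>R X" "chart w' (proj Y) = (1 / y) *\<^sub>R Y"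
    "chart w' (proj p) = (1 / P) *\<^sub>R p" "chart w' (proj q) = (1 / Q) *\<^sub>R q"
    using nz by (auto simp: chart_proj x_def y_def P_def Q_def)
  have "x *\<^sub>R q - Q *\<^sub>R X = c *\<^sub>R Z" "P *\<^sub>R Y - y *\<^sub>R p = b *\<^sub>R Z"
    "y *\<^sub>R q - Q *\<^sub>R Y = Z" "P *\<^sub>R X - x *\<^sub>R p = Z"
    unfolding Z_def PQ p(1) q(1) by (simp_all add: algebra_simps)
  then have *: "norm (chart w' (proj q) - chart w' (proj X)) = \<bar>1 / (Q * x)\<bar> * (\<bar>c\<bar> * norm Z)"
    "norm (chart w' (proj Y) - chart w' (proj p)) = \<bar>1 / (y * P)\<bar> * (\<bar>b\<bar> * norm Z)"
    "norm (chart w' (proj q) - chart w' (proj Y)) = \<bar>1 / (Q * y)\<bar> * norm Z"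
    "norm (chart w' (proj X) - chart w' (proj p)) = \<bar>1 / (x * P)\<bar> * norm Z"
    unfolding ch using diff[of x Q q X] diff[of P y Y p] diff[of y Q q Y] diff[of P x X p] nz
    by simp_all
  show ?thesis unfolding * using nz Z by (simp add: abs_mult field_simps)
qed

text \<open>Solves \<open>eqX\<close> and \<open>eqY\<close> for \<open>X\<close> and
  \<open>Y\<close>. Applying \<open>w\<close> to \<open>eqX\<close>, whose left side is positive,
  gives \<open>b * c > 1\<close>.\<close>

lemma boundary_ratio_plane:
  assumes X: "X \<in> C" and Y: "Y \<in> C" and p: "b *\<^sub>R X - Y \<in> bd" and q: "c *\<^sub>R Y - X \<in> bd"
    and b: "b > 0" and c: "c > 0"
  shows "b * c > 1" "(b *\<^sub>R X - Y) + (c *\<^sub>R Y - X) \<in> C"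
    "X = (c / (b * c - 1)) *\<^sub>R (b *\<^sub>R X - Y) + (1 / (b * c - 1)) *\<^sub>R (c *\<^sub>R Y - X)"
    "Y = (1 / (b * c - 1)) *\<^sub>R (b *\<^sub>R X - Y) + (b / (b * c - 1)) *\<^sub>R (c *\<^sub>R Y - X)"
proof -
  let ?p = "b *\<^sub>R X - Y" and ?q = "c *\<^sub>R Y - X"
  have eqX: "c *\<^sub>R ?p + ?q = (b * c - 1) *\<^sub>R X" and eqY: "?p + b *\<^sub>R ?q = (b * c - 1) *\<^sub>R Y"
    by (simp_all add: algebra_simps)
  have pos: "w \<bullet> ?p > 0" "w \<bullet> ?q > 0" "w \<bullet> X > 0"
    using p q X by (auto simp: bd_def pos_C intro!: pos_D)
  have "w \<bullet> (c *\<^sub>R ?p + ?q) > 0" using pos c by (simp only: inner_add_right inner_scaleR_right) (simp add: add_pos_pos)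
  then have "(b * c - 1) * (w \<bullet> X) > 0" unfolding eqX by simp
  then show bc: "b * c > 1" using pos by (simp add: zero_less_mult_iff)
  have "c *\<^sub>R ?p + ?q \<in> C" unfolding eqX using bc X by (intro scale_C) auto
  then have "(1/c) *\<^sub>R (c *\<^sub>R ?p) + 1 *\<^sub>R ?q \<in> C"
    using p q c by (intro combo_C scale_D) (auto simp: bd_def)
  then show "?p + ?q \<in> C" using c by simp
  have "X = (1 / (b * c - 1)) *\<^sub>R (c *\<^sub>R ?p + ?q)" unfolding eqX using bc by simp
  then show "X = (c / (b * c - 1)) *\<^sub>R ?p + (1 / (b * c - 1)) *\<^sub>R ?q"
    by (simp only: scaleR_add_right scaleR_scaleR) simp
  have "Y = (1 / (b * c - 1)) *\<^sub>R (?p + b *\<^sub>R ?q)" unfolding eqY using bc by simp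
  then show "Y = (1 / (b * c - 1)) *\<^sub>R ?p + (b / (b * c - 1)) *\<^sub>R ?q"
    by (simp only: scaleR_add_right scaleR_scaleR) simp
qed

text \<open>The order conditions in the definition put \<open>a\<close> beyond \<open>X\<close> and
  \<open>b\<close> beyond \<open>Y\<close>, so uniqueness of the boundary ratios determines both
  points; \<open>hilbert_ratio\<close> then gives the same value in every chart.\<close>

lemma hilbert_dist_eq:
  assumes X: "X \<in> C" and Y: "Y \<in> C" and ind: "\<And>t. Y \<noteq> t *\<^sub>R X"
    and p: "b *\<^sub>R X - Y \<in> bd" and q: "c *\<^sub>R Y - X \<in> bd" and b: "b > 0" and c: "c > 0"
  shows "hilbert_dist \<Omega> (proj X) (proj Y) = 1/2 * ln (b * c)"
proof -
  define p' q' where "p' = b *\<^sub>R X - Y" and "q' = c *\<^sub>R Y - X"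
  note pq = boundary_ratio_plane[OF X Y p q b c, folded p'_def q'_def]
  have bd: "p' \<in> bd" "q' \<in> bd" using p q by (auto simp: p'_def q'_def)
  have D: "p' \<in> D" "p' \<noteq> 0" "q' \<in> D" "q' \<noteq> 0" "Y \<in> D" "Y \<noteq> 0" "X \<in> D" "X \<noteq> 0"
    using bd X Y C_sub_D nonzero_C by (auto simp: bd_def)
  have ind': "X \<noteq> t *\<^sub>R Y" for t
  proof
    assume "X = t *\<^sub>R Y"
    then have "t \<noteq> 0" "Y = (1/t) *\<^sub>R X" using D by auto
    then show False using ind by blast
  qed
  have ne: "proj X \<noteq> proj Y" using D ind' by (metis proj_eqE)
  have line: "closure \<Omega> \<inter> proj_line (proj X) (proj Y) = proj_seg \<Omega> (proj p') (proj q')"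
  proof (intro equalityI subsetI)
    fix z assume z: "z \<in> closure \<Omega> \<inter> proj_line (proj X) (proj Y)"
    then obtain y where y: "y \<in> D" "y \<noteq> 0" "z = proj y" by (auto elim: proj_closure_obtain)
    have "y \<in> span (span {X} \<union> span {Y})"
      using z y unfolding proj_line_def
      by (simp add: proj_in_proj_space line_of_proj D)
    moreover have "span {X} \<subseteq> span {X, Y}" "span {Y} \<subseteq> span {X, Y}"
      by (intro span_mono; blast)+
    then have "span (span {X} \<union> span {Y}) \<subseteq> span {X, Y}"
      by (simp add: span_minimal)
    ultimately have "y \<in> span {X, Y}" by blast
    then obtain s t where "y = s *\<^sub>R X + t *\<^sub>R Y"
      by (auto simp: span_insert span_singleton) (metis add.commute diff_add_cancel)
    then have "y = s *\<^sub>R ((c / (b * c - 1)) *\<^sub>R p' + (1 / (b * c - 1)) *\<^sub>R q')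
        + t *\<^sub>R ((1 / (b * c - 1)) *\<^sub>R p' + (b / (b * c - 1)) *\<^sub>R q')"
      using pq(3,4) by simp
    then have "y = (s * (c / (b * c - 1)) + t * (1 / (b * c - 1))) *\<^sub>R p'
        + (s * (1 / (b * c - 1)) + t * (b / (b * c - 1))) *\<^sub>R q'"
      by (simp only: scaleR_add_right scaleR_add_left scaleR_scaleR add.assoc add.left_commute)
    then show "z \<in> proj_seg \<Omega> (proj p') (proj q')"
      unfolding proj_seg_iff[OF D(1-4)] using y bd_plane_D_iff[OF bd pq(2)] by metis
  next
    fix z assume "z \<in> proj_seg \<Omega> (proj p') (proj q')"
    then obtain s t where st: "s \<ge> 0" "t \<ge> 0" "s *\<^sub>R p' + t *\<^sub>R q' \<noteq> 0" "z = proj (s *\<^sub>R p' + t *\<^sub>R q')"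
      unfolding proj_seg_iff[OF D(1-4)] by blast
    have XY: "X \<in> span (span {X} \<union> span {Y})" "Y \<in> span (span {X} \<union> span {Y})"
      by (auto intro!: span_base)
    then have "s *\<^sub>R p' + t *\<^sub>R q' \<in> span (span {X} \<union> span {Y})"
      unfolding p'_def q'_def by (intro span_add span_scale span_diff)
    then have "z \<in> proj_line (proj X) (proj Y)"
      unfolding proj_line_def st(4) using st(3) by (simp add: proj_in_proj_space line_of_proj D)
    moreover have "z \<in> closure \<Omega>" using st D combo_D proj_in_closure by blast
    ultimately show "z \<in> closure \<Omega> \<inter> proj_line (proj X) (proj Y)" by blast
  qed
  have xseg: "proj X \<in> proj_seg \<Omega> (proj p') (proj Y)"
    unfolding proj_seg_iff[OF D(1,2,5,6)]
    using b D by (intro exI[of _ 1]) (simp add: p'_def proj_scale)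
  have yseg: "proj Y \<in> proj_seg \<Omega> (proj X) (proj q')"
    unfolding proj_seg_iff[OF D(7,8,3,4)]
    using c D by (intro exI[of _ 1]) (simp add: q'_def proj_scale)
  have bc: "\<bar>b * c\<bar> = b * c" using b c by simp
  show ?thesis
    unfolding hilbert_dist_def if_not_P[OF ne]
  proof (rule the_equality)
    show "\<exists>w a ba. chart_contains w (closure \<Omega>) \<and> a \<in> frontier \<Omega> \<and> ba \<in> frontier \<Omega> \<and>
      closure \<Omega> \<inter> proj_line (proj X) (proj Y) = proj_seg \<Omega> a ba \<and>
      proj X \<in> proj_seg \<Omega> a (proj Y) \<and> proj Y \<in> proj_seg \<Omega> (proj X) ba \<and>
      1 / 2 * ln (b * c) = 1 / 2 * ln (norm (chart w ba - chart w (proj X)) * norm (chart w (proj Y) - chart w a) /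
        (norm (chart w ba - chart w (proj Y)) * norm (chart w (proj X) - chart w a)))"
    proof (intro exI conjI)
      show "1 / 2 * ln (b * c) = 1 / 2 * ln (norm (chart w (proj q') - chart w (proj X)) * norm (chart w (proj Y) - chart w (proj p')) /
        (norm (chart w (proj q') - chart w (proj Y)) * norm (chart w (proj X) - chart w (proj p'))))"
        unfolding hilbert_ratio[OF chart_contains_w X Y ind p'_def bd(1) q'_def bd(2)] bc ..
    qed (use line xseg yseg bd bd_frontier chart_contains_w in blast)+
  next
    fix r assume "\<exists>w a ba. chart_contains w (closure \<Omega>) \<and> a \<in> frontier \<Omega> \<and> ba \<in> frontier \<Omega> \<and>
      closure \<Omega> \<inter> proj_line (proj X) (proj Y) = proj_seg \<Omega> a ba \<and>
      proj X \<in> proj_seg \<Omega> a (proj Y) \<and> proj Y \<in> proj_seg \<Omega> (proj X) ba \<and>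
      r = 1 / 2 * ln (norm (chart w ba - chart w (proj X)) * norm (chart w (proj Y) - chart w a) /
        (norm (chart w ba - chart w (proj Y)) * norm (chart w (proj X) - chart w a)))"
    then obtain w' a' b' where w': "chart_contains w' (closure \<Omega>)" "a' \<in> frontier \<Omega>" "b' \<in> frontier \<Omega>"
      "proj X \<in> proj_seg \<Omega> a' (proj Y)" "proj Y \<in> proj_seg \<Omega> (proj X) b'"
      and r: "r = 1 / 2 * ln (norm (chart w' b' - chart w' (proj X)) * norm (chart w' (proj Y) - chart w' a') /
        (norm (chart w' b' - chart w' (proj Y)) * norm (chart w' (proj X) - chart w' a')))"
      by blast
    obtain u where u: "u \<in> bd" "a' = proj u" using w'(2) by (rule frontier_obtain)
    obtain k b2 where k: "k > 0" "k *\<^sub>R u = b2 *\<^sub>R X - Y"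
      using boundary_ratio_obtain[OF X Y ind u(1)] w'(4) u(2) by metis
    then have "b2 *\<^sub>R X - Y \<in> bd" using scale_bd u(1) by metis
    then have "b2 = b" using boundary_ratio_unique[OF X _ p] by blast
    then have a': "a' = proj p'" using k u(2) proj_scale[of k u] by (simp add: p'_def)
    obtain v where v: "v \<in> bd" "b' = proj v" using w'(3) by (rule frontier_obtain)
    have "proj Y \<in> proj_seg \<Omega> (proj v) (proj X)"
      using w'(5) v bd_def D unfolding v(2)
      by (subst (asm) proj_seg_iff, simp_all add: proj_seg_iff) (metis add.commute)
    then obtain k' c2 where k': "k' > 0" "k' *\<^sub>R v = c2 *\<^sub>R Y - X"
      using boundary_ratio_obtain[OF Y X ind' v(1)] by metis
    then have "c2 *\<^sub>R Y - X \<in> bd" using scale_bd v(1) by metis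
    then have "c2 = c" using boundary_ratio_unique[OF Y _ q] by blast
    then have b': "b' = proj q'" using k' v(2) proj_scale[of k' v] by (simp add: q'_def)
    show "r = 1 / 2 * ln (b * c)"
      unfolding r a' b' hilbert_ratio[OF w'(1) X Y ind p'_def bd(1) q'_def bd(2)] bc ..
  qed
qed

lemma hilbert_dist_ratios:
  assumes X: "X \<in> C" and Y: "Y \<in> C" and ind: "\<And>t. Y \<noteq> t *\<^sub>R X"
  obtains b c where "b > 0" "c > 0" "b * c > 1" "b *\<^sub>R X - Y \<in> bd" "c *\<^sub>R Y - X \<in> bd"
    "hilbert_dist \<Omega> (proj X) (proj Y) = 1/2 * ln (b * c)"
proof -
  have ind': "X \<noteq> t *\<^sub>R Y" for t
  proof
    assume *: "X = t *\<^sub>R Y"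
    then have "t \<noteq> 0" using nonzero_C[OF X] by auto
    then have "Y = (1/t) *\<^sub>R X" using * by auto
    then show False using ind by blast
  qed
  obtain b where b: "b > 0" "b *\<^sub>R X - Y \<in> bd" using exists_boundary_ratio[OF X Y ind] by blast
  obtain c where c: "c > 0" "c *\<^sub>R Y - X \<in> bd" using exists_boundary_ratio[OF Y X ind'] by blast
  show thesis
    using that[OF b(1) c(1) boundary_ratio_plane(1)[OF X Y b(2) c(2) b(1) c(1)] b(2) c(2)]
      hilbert_dist_eq[OF X Y ind b(2) c(2) b(1) c(1)] by blast
qed

lemma hilbert_dist_nonneg:
  assumes "x \<in> \<Omega>" "y \<in> \<Omega>" shows "hilbert_dist \<Omega> x y \<ge> 0"
proof -
  obtain X where X: "X \<in> C" "x = proj X" using assms(1) by (rule domain_obtain)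
  obtain Y where Y: "Y \<in> C" "y = proj Y" using assms(2) by (rule domain_obtain)
  show ?thesis
  proof (cases "\<exists>t. Y = t *\<^sub>R X")
    case True
    then have "x = y" using X Y nonzero_C proj_scale by (metis scaleR_zero_left)
    then show ?thesis by (simp add: hilbert_dist_def)
  next
    case False
    then have ind: "\<And>t. Y \<noteq> t *\<^sub>R X" by blast
    then obtain b c where "b * c > 1" "hilbert_dist \<Omega> (proj X) (proj Y) = 1/2 * ln (b * c)"
      using hilbert_dist_ratios[OF X(1) Y(1)] by metis
    moreover from this(1) have "ln (b * c) > 0" by (rule ln_gt_zero)
    ultimately have "hilbert_dist \<Omega> (proj X) (proj Y) > 0" by linarith
    then show ?thesis using X Y by simp
  qed
qed

end

section \<open>Automorphisms of the cone and their axes\<close>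

lemma matrix_vector_scaleR_left: "(c *\<^sub>R A) *v v = c *\<^sub>R (A *v v)" for A :: "real^'n^'m"
  by (rule scaleR_matrix_vector_assoc[symmetric])

lemma span_pair: "y \<in> span {u, v} \<longleftrightarrow> (\<exists>s t. y = s *\<^sub>R u + t *\<^sub>R v)" for u v :: "'a::real_vector"
  by (auto simp: span_insert span_singleton) (metis add.commute diff_add_cancel add_diff_cancel_left')+

context vec_domain
begin

text \<open>The inverse is carried along, which makes the notion symmetric in \<open>A\<close> and \<open>B\<close>.\<close>

definition cone_aut :: "real^'n^'n \<Rightarrow> real^'n^'n \<Rightarrow> bool" where
  "cone_aut A B \<longleftrightarrow> A ** B = mat 1 \<and> B ** A = mat 1 \<and> (\<forall>v\<in>C. A *v v \<in> C) \<and> (\<forall>v\<in>C. B *v v \<in> C)"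

lemma cone_aut_sym: "cone_aut A B \<Longrightarrow> cone_aut B A"
  by (auto simp: cone_aut_def)

lemma cone_aut_inverse: "cone_aut A B \<Longrightarrow> A *v (B *v v) = v"
  by (simp add: cone_aut_def matrix_vector_mul_assoc)

lemma cone_aut_C: "cone_aut A B \<Longrightarrow> v \<in> C \<Longrightarrow> A *v v \<in> C"
  by (simp add: cone_aut_def)

lemma cone_aut_mult: "cone_aut A B \<Longrightarrow> cone_aut A' B' \<Longrightarrow> cone_aut (A ** A') (B' ** B)"
  unfolding cone_aut_def
  by (auto simp: matrix_vector_mul_assoc[symmetric])
    (metis matrix_mul_assoc matrix_mul_rid)+

lemma cone_aut_D: assumes "cone_aut A B" "v \<in> D" shows "A *v v \<in> D"
proof -
  obtain x where x: "\<And>n. x n \<in> C" "x \<longlonglongrightarrow> v"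
    using assms(2) unfolding closure_sequential by blast
  have "(\<lambda>n. A *v x n) \<longlonglongrightarrow> A *v v"
    using x(2) by (intro linear_continuous_on isCont_tendsto_compose[of v "(*v) A"]
      linear_continuous_at matrix_vector_mul_bounded_linear)
  then show ?thesis
    unfolding closure_sequential using cone_aut_C[OF assms(1) x(1)]
    by (intro exI[of _ "\<lambda>n. A *v x n"]) auto
qed

lemma cone_aut_nonzero: assumes "cone_aut A B" "v \<noteq> 0" shows "A *v v \<noteq> 0"
  using cone_aut_inverse[OF cone_aut_sym[OF assms(1)], of v] assms(2) by auto

lemma cone_aut_bd: assumes "cone_aut A B" "v \<in> bd" shows "A *v v \<in> bd"
proof -
  have "A *v v \<notin> C"
    using cone_aut_C[OF cone_aut_sym[OF assms(1)], of "A *v v"]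
      cone_aut_inverse[OF cone_aut_sym[OF assms(1)], of v] assms(2) by (auto simp: bd_def)
  then show ?thesis using cone_aut_D[OF assms(1)] cone_aut_nonzero[OF assms(1)] assms(2)
    by (auto simp: bd_def)
qed

text \<open>A comparison of Collatz-Wielandt type. In the cone order, the bound of
  \<open>A *v X\<close> by \<open>b *\<^sub>R X\<close> iterates, and so does the bound of
  \<open>d *\<^sub>R x\<close> by \<open>X\<close>; hence \<open>(l / b) ^ k\<close> times
  \<open>d *\<^sub>R x\<close> stays below \<open>X\<close> for every \<open>k\<close>.\<close>

lemma eigenvalue_le:
  assumes aut: "cone_aut A B" and X: "X \<in> C" and x: "x \<in> D" "x \<noteq> 0" "A *v x = l *\<^sub>R x"
    and b: "b > 0" "b *\<^sub>R X - A *v X \<in> D"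
  shows "l \<le> b"
proof -
  obtain d where d: "d > 0" "X - d *\<^sub>R x \<in> C" using dominates[OF X] by blast
  have iter: "b ^ k *\<^sub>R X - (d * l ^ k) *\<^sub>R x \<in> D \<and> b ^ k *\<^sub>R X - (((*v) A) ^^ k) X \<in> D
      \<and> (((*v) A) ^^ k) X - (d * l ^ k) *\<^sub>R x \<in> D" for k
  proof (induction k)
    case 0
    then show ?case using d C_sub_D zero_D by simp
  next
    case (Suc k)
    let ?Y = "(((*v) A) ^^ k) X"
    have "A *v (b ^ k *\<^sub>R X - ?Y) + b ^ k *\<^sub>R (b *\<^sub>R X - A *v X) \<in> D"
      using Suc b by (intro add_D scale_D cone_aut_D[OF aut]) auto
    then have 1: "b ^ Suc k *\<^sub>R X - A *v ?Y \<in> D"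
      by (simp add: matrix_vector_mult_diff_distrib matrix_vector_mult_scaleR algebra_simps)
    have "A *v (?Y - (d * l ^ k) *\<^sub>R x) \<in> D" using Suc cone_aut_D[OF aut] by blast
    then have 2: "A *v ?Y - (d * l ^ Suc k) *\<^sub>R x \<in> D"
      by (simp add: matrix_vector_mult_diff_distrib matrix_vector_mult_scaleR x mult_ac)
    show ?case using add_D[OF 1 2] 1 2 by simp
  qed
  have "X - (l / b) ^ k *\<^sub>R (d *\<^sub>R x) \<in> D" for k
  proof -
    have "(1 / b ^ k) *\<^sub>R (b ^ k *\<^sub>R X - (d * l ^ k) *\<^sub>R x) \<in> D"
      using iter[of k] b by (intro scale_D) auto
    then show ?thesis using b by (simp add: scaleR_diff_right power_divide mult.commute)
  qed
  then have "l / b \<le> 1" using d x by (intro growth_le_1[of "d *\<^sub>R x"] scale_D) auto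
  then show ?thesis using b by simp
qed

text \<open>An interior eigenvector with eigenvalue \<open>t\<close> is a test vector for
  \<open>A\<close> and for \<open>B\<close>, so \<open>l \<le> t\<close> and
  \<open>k \<le> 1/t\<close>, against \<open>l * k > 1\<close>.\<close>

lemma no_interior_eigenvector:
  assumes aut: "cone_aut A B" and x: "x \<in> D" "x \<noteq> 0" "A *v x = l *\<^sub>R x"
    and y: "y \<in> D" "y \<noteq> 0" "B *v y = k *\<^sub>R y" and lk: "l * k > 1" and k: "k > 0"
    and X: "X \<in> C"
  shows "A *v X \<noteq> t *\<^sub>R X"
proof
  assume *: "A *v X = t *\<^sub>R X"
  have wX: "w \<bullet> X > 0" using X pos_C by blast
  have "w \<bullet> (A *v X) > 0" using cone_aut_C[OF aut X] pos_C by blast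
  then have t: "t > 0" using * wX by (simp add: zero_less_mult_iff)
  have BX: "B *v X = (1/t) *\<^sub>R X"
  proof -
    have "B *v (A *v X) = X" using cone_aut_inverse[OF cone_aut_sym[OF aut]] .
    then have "t *\<^sub>R (B *v X) = X" by (simp add: * matrix_vector_mult_scaleR)
    then show ?thesis using t by (metis divide_inverse left_inverse less_irrefl mult_1 scaleR_one scaleR_scaleR)
  qed
  have "l \<le> t" using eigenvalue_le[OF aut X x t] * zero_D by simp
  moreover have "k \<le> 1/t" using eigenvalue_le[OF cone_aut_sym[OF aut] X y, of "1/t"] BX t zero_D by simp
  ultimately have "l * k \<le> t * (1/t)" using k t by (intro mult_mono) auto
  then show False using lk t by simp
qed

text \<open>By \<open>eigenvalue_le\<close> the two boundary ratios are at least \<open>l\<close>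
  and \<open>k\<close>; for the second one, \<open>B\<close> is first applied to the boundary
  vector.\<close>

lemma displacement_ge:
  assumes aut: "cone_aut A B" and x: "x \<in> D" "x \<noteq> 0" "A *v x = l *\<^sub>R x"
    and y: "y \<in> D" "y \<noteq> 0" "B *v y = k *\<^sub>R y" and lk: "l * k > 1" and k: "k > 0"
    and X: "X \<in> C"
  shows "hilbert_dist \<Omega> (proj X) (proj (A *v X)) \<ge> 1/2 * ln (l * k)"
proof -
  have AX: "A *v X \<in> C" using cone_aut_C[OF aut X] .
  have ind: "\<And>t. A *v X \<noteq> t *\<^sub>R X" using no_interior_eigenvector[OF assms] .
  obtain b c where bc: "b > 0" "c > 0" "b *\<^sub>R X - A *v X \<in> bd" "c *\<^sub>R (A *v X) - X \<in> bd"
    "hilbert_dist \<Omega> (proj X) (proj (A *v X)) = 1/2 * ln (b * c)"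
    using hilbert_dist_ratios[OF X AX ind] by metis
  have l: "l \<le> b" using eigenvalue_le[OF aut X x bc(1)] bc(3) bd_D by blast
  have "B *v (c *\<^sub>R (A *v X) - X) \<in> D"
    using bc(4) bd_D cone_aut_D[OF cone_aut_sym[OF aut]] by blast
  then have "c *\<^sub>R X - B *v X \<in> D"
    by (simp add: matrix_vector_mult_diff_distrib matrix_vector_mult_scaleR
        cone_aut_inverse[OF cone_aut_sym[OF aut]])
  then have "k \<le> c" using eigenvalue_le[OF cone_aut_sym[OF aut] X y bc(2)] by blast
  then have "l * k \<le> b * c" using l k bc by (intro mult_mono) auto
  then show ?thesis using bc(5) lk by (simp add: ln_mono)
qed

text \<open>Each vector of \<open>C\<close> goes to \<open>C\<close> or to its negative. The sign
  cannot vary: from two vectors with different signs one could form a positive combination whose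
  image is in the kernel of \<open>w\<close>, which misses both.\<close>

lemma Aut_cone_aut:
  assumes "g \<in> Aut \<Omega>"
  obtains e :: real and B where "e = 1 \<or> e = -1" "cone_aut (e *\<^sub>R g) B"
proof -
  from assms have inv: "invertible g" and img: "proj_act g ` \<Omega> = \<Omega>" by (auto simp: Aut_def)
  obtain h where h: "g ** h = mat 1" "h ** g = mat 1" using inv by (auto simp: invertible_def)
  have gv: "g *v v \<noteq> 0" if "v \<noteq> 0" for v
    using that h by (metis matrix_vector_mul_assoc matrix_vector_mul_lid matrix_vector_mult_0_right)
  have gC: "g *v v \<in> C \<or> - (g *v v) \<in> C" if "v \<in> C" for v
  proof -
    have "proj_act g (proj v) \<in> \<Omega>" using img proj_C[OF that] by blast
    then show ?thesis
      using proj_act_proj[of v g] gv nonzero_C[OF that] proj_in_domain by auto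
  qed
  obtain v0 where v0: "v0 \<in> C" using nonempty_C by blast
  define e :: real where "e = (if g *v v0 \<in> C then 1 else -1)"
  have e: "e = 1 \<or> e = -1" by (simp add: e_def)
  have nz: "w \<bullet> (g *v v) \<noteq> 0" if "v \<in> C" for v
    using gC[OF that] pos_C[of "g *v v"] pos_C[of "- (g *v v)"] by auto
  have ev0: "e * (w \<bullet> (g *v v0)) > 0"
    using gC[OF v0] pos_C[of "g *v v0"] pos_C[of "- (g *v v0)"] by (auto simp: e_def)
  have epos: "e * (w \<bullet> (g *v v)) > 0" if v: "v \<in> C" for v
  proof (rule ccontr)
    assume "\<not> ?thesis"
    then have neg: "e * (w \<bullet> (g *v v)) < 0" using nz[OF v] e by auto
    let ?s = "- (e * (w \<bullet> (g *v v)))" and ?t = "e * (w \<bullet> (g *v v0))"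
    have "?s *\<^sub>R v0 + ?t *\<^sub>R v \<in> C" using neg ev0 v v0 by (intro add_C scale_C) auto
    then have "w \<bullet> (g *v (?s *\<^sub>R v0 + ?t *\<^sub>R v)) \<noteq> 0" by (rule nz)
    moreover have "w \<bullet> (g *v (?s *\<^sub>R v0 + ?t *\<^sub>R v)) = 0"
      by (simp only: matrix_vector_right_distrib matrix_vector_mult_scaleR inner_add_right inner_scaleR_right) simp
    ultimately show False by simp
  qed
  have eC: "e *\<^sub>R (g *v v) \<in> C" if v: "v \<in> C" for v
  proof -
    have "e *\<^sub>R (g *v v) \<in> C \<or> - (e *\<^sub>R (g *v v)) \<in> C" using gC[OF v] e by auto
    moreover have "- (e *\<^sub>R (g *v v)) \<notin> C" using epos[OF v] pos_C[of "- (e *\<^sub>R (g *v v))"] by auto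
    ultimately show ?thesis by blast
  qed
  \<comment> \<open>The inverse is handled by surjectivity on the domain: \<open>v\<close> is a
    positive multiple of the signed image of some \<open>u\<close> in \<open>C\<close>.\<close>
  have eC': "e *\<^sub>R (h *v v) \<in> C" if v: "v \<in> C" for v
  proof -
    obtain p where p: "p \<in> \<Omega>" "proj v = proj_act g p" using img proj_C[OF v] by blast
    obtain u where u: "u \<in> C" "p = proj u" using p(1) by (rule domain_obtain)
    then have "proj v = proj (g *v u)" using p(2) proj_act_proj[of u g] gv nonzero_C by auto
    then obtain c where c: "c \<noteq> 0" "v = c *\<^sub>R (g *v u)"
      using nonzero_C u(1) v gv by (metis proj_eqE)
    have ee: "e * e = 1" using e by auto
    have vc: "v = (c * e) *\<^sub>R (e *\<^sub>R (g *v u))" using c(2) ee by (simp add: mult.assoc)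
    have "w \<bullet> v > 0" using pos_C[OF v] .
    then have "(c * e) * (w \<bullet> (e *\<^sub>R (g *v u))) > 0" by (subst (asm) vc) (simp only: inner_scaleR_right)
    moreover have "w \<bullet> (e *\<^sub>R (g *v u)) > 0" using eC[OF u(1)] pos_C by blast
    ultimately have ce: "c * e > 0" by (rule zero_less_mult_pos2)
    have "h *v v = c *\<^sub>R u" using c(2) h(2)
      by (simp add: matrix_vector_mult_scaleR matrix_vector_mul_assoc)
    then have "e *\<^sub>R (h *v v) = (c * e) *\<^sub>R u" by (simp add: mult.commute)
    then show ?thesis using ce u(1) scale_C by simp
  qed
  have "cone_aut (e *\<^sub>R g) (e *\<^sub>R h)"
    unfolding cone_aut_def
    using eC eC' h e by (auto simp: matrix_vector_scaleR_left scalar_matrix_assoc matrix_scalar_ac)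
  then show thesis using e that by blast
qed

lemma proj_act_scale:
  assumes "cone_aut (e *\<^sub>R g) B" "v \<noteq> 0"
  shows "proj_act g (proj v) = proj ((e *\<^sub>R g) *v v)"
proof -
  have "(e *\<^sub>R g) *v v \<noteq> 0" using cone_aut_nonzero[OF assms] .
  then have "e \<noteq> 0" "g *v v \<noteq> 0" by (auto simp: matrix_vector_scaleR_left)
  then show ?thesis using assms(2) by (simp add: proj_act_proj matrix_vector_scaleR_left proj_scale)
qed

text \<open>An interior eigenvector is a fixed point, of displacement 0. Nonnegative distances make
  the set of displacements bounded below, so the infimum really is a lower bound.\<close>

lemma translation_length_pos_no_fixed:
  assumes g: "g \<in> Aut \<Omega>" and tl: "translation_length \<Omega> g > 0"
    and aut: "cone_aut (e *\<^sub>R g) B" and X: "X \<in> C"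
  shows "(e *\<^sub>R g) *v X \<noteq> t *\<^sub>R X"
proof
  assume *: "(e *\<^sub>R g) *v X = t *\<^sub>R X"
  have "t \<noteq> 0" using * cone_aut_nonzero[OF aut nonzero_C[OF X]] by auto
  then have fix': "proj_act g (proj X) = proj X"
    using proj_act_scale[OF aut nonzero_C[OF X]] * by (simp add: proj_scale)
  have "bdd_below ((\<lambda>x. hilbert_dist \<Omega> x (proj_act g x)) ` \<Omega>)"
    using g by (intro bdd_belowI2[of _ 0] hilbert_dist_nonneg) (auto simp: Aut_def)
  then have "translation_length \<Omega> g \<le> hilbert_dist \<Omega> (proj X) (proj_act g (proj X))"
    unfolding translation_length_def using proj_C[OF X] by (rule cINF_lower)
  then show False using tl by (simp add: fix' hilbert_dist_def)
qed

section \<open>Axes and the eigenvectors at their ends\<close>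

lemma axis_end_points:
  assumes "isometry_axis \<Omega> g (open_proj_seg \<Omega> a b)" "a \<in> frontier \<Omega>" "b \<in> frontier \<Omega>"
  obtains p q where "p \<in> bd" "q \<in> bd" "a = proj p" "b = proj q" "p + q \<in> C"
    "g *v p \<in> span {p, q}" "g *v q \<in> span {p, q}"
proof -
  obtain p where p: "p \<in> bd" "a = proj p" using assms(2) by (rule frontier_obtain)
  obtain q where q: "q \<in> bd" "b = proj q" using assms(3) by (rule frontier_obtain)
  have D: "p \<in> D" "p \<noteq> 0" "q \<in> D" "q \<noteq> 0" using p q by (auto simp: bd_def)
  from assms(1) obtain V where V: "subspace V" "dim V = 2" "(*v) g ` V \<subseteq> V"
    "open_proj_seg \<Omega> a b = proj_space V \<inter> \<Omega>" and ne: "open_proj_seg \<Omega> a b \<noteq> {}"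
    unfolding isometry_axis_def by blast
  have neq: "proj p \<noteq> proj q" using ne open_proj_seg_self[OF D(1,2)] p q by auto
  then have C: "p + q \<in> C" using open_proj_seg_subset[OF p(1) q(1)] V(4) p q by auto
  have ind: "\<And>c. p \<noteq> c *\<^sub>R q" using bd_dependent[OF p(1) q(1)] neq by blast
  have inV: "s *\<^sub>R p + t *\<^sub>R q \<in> V" if "s > 0" "t > 0" for s t
  proof -
    have nz: "s *\<^sub>R p + t *\<^sub>R q \<noteq> 0" using bd_pair_independent[OF p(1) q(1) C] that by blast
    have "proj (s *\<^sub>R p + t *\<^sub>R q) \<in> proj_space V"
      using V(4) open_proj_seg_eq[OF D ind] p q that by blast
    then show ?thesis using proj_in_proj_space[OF nz V(1)] by blast
  qed
  \<comment> \<open>The axis is open, so its end points are recovered from two vectors over its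
    interior.\<close>
  have 1: "p + q \<in> V" using inV[of 1 1] by simp
  have 2: "p + 2 *\<^sub>R q \<in> V" using inV[of 1 2] by simp
  have qV: "q \<in> V" using subspace_diff[OF V(1) 2 1] by (simp add: scaleR_2)
  then have pV: "p \<in> V" using subspace_diff[OF V(1) 1 qV] by simp
  have "independent {p, q}"
    using ind D by (auto simp: independent_insert span_singleton)
  moreover have "p \<noteq> q" using neq by auto
  ultimately have "dim (span {p, q}) = 2" by (simp add: dim_eq_card_independent)
  moreover have "span {p, q} \<subseteq> V" using V(1) pV qV by (intro span_minimal) auto
  ultimately have "span {p, q} = V" using V by (intro subspace_dim_equal) auto
  then have "g *v p \<in> span {p, q}" "g *v q \<in> span {p, q}" using V(3) pV qV by auto
  then show thesis using that p q C by blast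
qed

text \<open>The ends are the boundary vectors from the two ratios of any independent pair of
  interior vectors in \<open>V\<close>.\<close>

lemma axis_is_open_seg:
  assumes "isometry_axis \<Omega> g L"
  obtains a b where "a \<in> frontier \<Omega>" "b \<in> frontier \<Omega>" "L = open_proj_seg \<Omega> a b"
proof -
  from assms obtain V where V: "subspace V" "dim V = 2" "L = proj_space V \<inter> \<Omega>" and ne: "L \<noteq> {}"
    unfolding isometry_axis_def by blast
  obtain x where x: "x \<in> \<Omega>" "x \<in> proj_space V" using V ne by blast
  obtain X where X: "X \<in> C" "x = proj X" using x(1) by (rule domain_obtain)
  have XV: "X \<in> V" using x X nonzero_C proj_in_proj_space[OF _ V(1)] by blast
  obtain Y where Y: "Y \<in> C" "Y \<in> V" "\<And>t. Y \<noteq> t *\<^sub>R X"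
    using exists_independent[OF X(1) XV V(1,2)] by blast
  obtain b c where bc: "b > 0" "c > 0" "b *\<^sub>R X - Y \<in> bd" "c *\<^sub>R Y - X \<in> bd"
    using hilbert_dist_ratios[OF X(1) Y(1,3)] by metis
  let ?p = "b *\<^sub>R X - Y" and ?q = "c *\<^sub>R Y - X"
  have C: "?p + ?q \<in> C" using boundary_ratio_plane(2)[OF X(1) Y(1) bc(3,4,1,2)] .
  have pqV: "?p \<in> V" "?q \<in> V" using XV Y V(1) by (auto intro: subspace_diff subspace_scale)
  have D: "?p \<in> D" "?p \<noteq> 0" "?q \<in> D" "?q \<noteq> 0" using bc by (auto simp: bd_def)
  have ind: "?p \<noteq> t *\<^sub>R ?q" for t using bd_dependent(3)[OF bc(3,4)] C by blast
  have "independent {?p, ?q}"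
    using ind D by (auto simp: independent_insert span_singleton)
  moreover have "?p \<noteq> ?q" using ind[of 1] by simp
  ultimately have "dim (span {?p, ?q}) = 2" by (simp add: dim_eq_card_independent)
  moreover have "span {?p, ?q} \<subseteq> V" using V(1) pqV by (intro span_minimal) auto
  ultimately have span: "span {?p, ?q} = V" using V by (intro subspace_dim_equal) auto
  have "L = open_proj_seg \<Omega> (proj ?p) (proj ?q)"
    unfolding open_proj_seg_eq[OF D ind]
  proof (intro equalityI subsetI)
    fix z assume z: "z \<in> L"
    then obtain Z where Z: "Z \<in> C" "z = proj Z" using V(3) domain_obtain by blast
    then have "Z \<in> V" using z V(3) nonzero_C proj_in_proj_space[OF _ V(1)] by blast
    then obtain s t where st: "Z = s *\<^sub>R ?p + t *\<^sub>R ?q" using span span_pair by blast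
    then have "s > 0 \<and> t > 0" using bd_plane_C_iff[OF bc(3,4) C] Z(1) by blast
    then show "z \<in> {proj (s *\<^sub>R ?p + t *\<^sub>R ?q) |s t. 0 < s \<and> 0 < t}" using Z(2) st by blast
  next
    fix z assume "z \<in> {proj (s *\<^sub>R ?p + t *\<^sub>R ?q) |s t. 0 < s \<and> 0 < t}"
    then obtain s t where st: "s > 0" "t > 0" "z = proj (s *\<^sub>R ?p + t *\<^sub>R ?q)" by blast
    then have Z: "s *\<^sub>R ?p + t *\<^sub>R ?q \<in> C" using bd_plane_C_iff[OF bc(3,4) C] by blast
    have "s *\<^sub>R ?p + t *\<^sub>R ?q \<in> V" using pqV V(1) by (intro subspace_add subspace_scale)
    then show "z \<in> L" unfolding V(3) st(3)
      using proj_C[OF Z] proj_in_proj_space[OF nonzero_C[OF Z] V(1)] by blast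
  qed
  then show thesis using that bd_frontier bc by blast
qed

text \<open>\<open>A\<close> preserves the boundary, so it permutes the two edges of the quadrant
  spanned by \<open>p\<close> and \<open>q\<close>. Exchanging them, or having equal eigenvalues on
  them, would produce an interior eigenvector.\<close>

lemma axis_eigenvectors:
  assumes aut: "cone_aut A B" and p: "p \<in> bd" and q: "q \<in> bd" and C: "p + q \<in> C"
    and span: "A *v p \<in> span {p, q}" "A *v q \<in> span {p, q}"
    and nofix: "\<And>X t. X \<in> C \<Longrightarrow> A *v X \<noteq> t *\<^sub>R X"
  obtains l m where "l > 0" "m > 0" "l \<noteq> m" "A *v p = l *\<^sub>R p" "A *v q = m *\<^sub>R q"
proof -
  have ends: "(\<exists>l>0. A *v x = l *\<^sub>R p) \<or> (\<exists>m>0. A *v x = m *\<^sub>R q)"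
    if x: "x \<in> bd" and Ax: "A *v x \<in> span {p, q}" for x
  proof -
    obtain s t where st: "A *v x = s *\<^sub>R p + t *\<^sub>R q" using Ax span_pair by blast
    have Axbd: "A *v x \<in> bd" using cone_aut_bd[OF aut x] .
    have ge: "s \<ge> 0" "t \<ge> 0"
      using Axbd bd_plane_D_iff[OF p q C, of s t] by (auto simp: st bd_def)
    have "\<not> (s > 0 \<and> t > 0)" using Axbd bd_plane_C_iff[OF p q C, of s t] by (auto simp: st bd_def)
    moreover have "\<not> (s = 0 \<and> t = 0)" using Axbd by (auto simp: st bd_def)
    ultimately consider "s > 0" "t = 0" | "t > 0" "s = 0" using ge by linarith
    then show ?thesis using st by cases auto
  qed
  have nz: "\<not> (\<exists>v l m. v \<noteq> 0 \<and> l > 0 \<and> m > 0 \<and> A *v p = l *\<^sub>R v \<and> A *v q = m *\<^sub>R v)"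
  proof
    assume "\<exists>v l m. v \<noteq> 0 \<and> l > 0 \<and> m > 0 \<and> A *v p = l *\<^sub>R v \<and> A *v q = m *\<^sub>R v"
    then obtain v l m where *: "l > 0" "m > 0" "A *v p = l *\<^sub>R v" "A *v q = m *\<^sub>R v" by blast
    have "A *v (m *\<^sub>R p + (-l) *\<^sub>R q) = m *\<^sub>R (A *v p) + (-l) *\<^sub>R (A *v q)"
      by (simp only: matrix_vector_right_distrib matrix_vector_mult_scaleR)
    then have "A *v (m *\<^sub>R p + (-l) *\<^sub>R q) = 0" by (simp add: * mult.commute)
    then have "m *\<^sub>R p + (-l) *\<^sub>R q = 0" using cone_aut_nonzero[OF aut] by blast
    then show False using bd_pair_independent[OF p q C, of m "-l"] * by auto
  qed
  have pq0: "p \<noteq> 0" "q \<noteq> 0" using p q by (auto simp: bd_def)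
  consider (fix') "\<exists>l>0. A *v p = l *\<^sub>R p" "\<exists>m>0. A *v q = m *\<^sub>R q"
    | (swap) "\<exists>l>0. A *v p = l *\<^sub>R q" "\<exists>m>0. A *v q = m *\<^sub>R p"
    using ends[OF p span(1)] ends[OF q span(2)] nz pq0 by blast
  then show thesis
  proof cases
    case fix'
    then obtain l m where lm: "l > 0" "m > 0" "A *v p = l *\<^sub>R p" "A *v q = m *\<^sub>R q" by blast
    have "l \<noteq> m"
    proof
      assume "l = m"
      then have "A *v (p + q) = l *\<^sub>R (p + q)" using lm
        by (simp add: matrix_vector_right_distrib scaleR_add_right)
      then show False using nofix[OF C] by blast
    qed
    then show ?thesis using that lm by blast
  next
    case swap
    then obtain l m where lm: "l > 0" "m > 0" "A *v p = l *\<^sub>R q" "A *v q = m *\<^sub>R p" by blast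
    \<comment> \<open>The eigenvector of the swap for the eigenvalue \<open>sqrt l * sqrt m\<close>;
      its coefficients are positive, so it is interior.\<close>
    let ?z = "sqrt m *\<^sub>R p + sqrt l *\<^sub>R q"
    have "?z \<in> C" using lm C bd_plane_C_iff[OF p q C] by auto
    moreover have "A *v ?z = (sqrt l * sqrt m) *\<^sub>R ?z"
    proof -
      have "A *v ?z = (sqrt m * l) *\<^sub>R q + (sqrt l * m) *\<^sub>R p"
        by (simp add: matrix_vector_right_distrib matrix_vector_mult_scaleR lm)
      moreover have "sqrt m * l = sqrt l * sqrt m * sqrt l" "sqrt l * m = sqrt l * sqrt m * sqrt m"
        using lm by (simp_all add: mult_ac)
      ultimately show ?thesis by (simp add: scaleR_add_right add.commute)
    qed
    ultimately show ?thesis using nofix by blast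
  qed
qed

lemma rank_one_isometry_end_points:
  assumes g: "rank_one_isometry \<Omega> g" and aut: "cone_aut (e *\<^sub>R g) B" and e: "e \<noteq> 0"
  obtains p q l m where "p \<in> bd" "q \<in> bd" "p + q \<in> C" "\<And>z. z \<in> bd \<Longrightarrow> p + z \<in> C \<or> z + q \<in> C"
    "l > 0" "m > 0" "l \<noteq> m" "(e *\<^sub>R g) *v p = l *\<^sub>R p" "(e *\<^sub>R g) *v q = m *\<^sub>R q"
proof -
  from g have gA: "g \<in> Aut \<Omega>" and tl: "translation_length \<Omega> g > 0"
    and half: "\<And>a b. a \<in> frontier \<Omega> \<Longrightarrow> b \<in> frontier \<Omega> \<Longrightarrow>
        isometry_axis \<Omega> g (open_proj_seg \<Omega> a b) \<Longrightarrow> \<not> in_half_triangle \<Omega> a b"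
    and axis: "\<exists>L. isometry_axis \<Omega> g L"
    unfolding rank_one_isometry_def by auto
  obtain L where L: "isometry_axis \<Omega> g L" using axis by blast
  obtain a b where ab: "a \<in> frontier \<Omega>" "b \<in> frontier \<Omega>" "L = open_proj_seg \<Omega> a b"
    using L by (rule axis_is_open_seg)
  obtain p q where pq: "p \<in> bd" "q \<in> bd" "a = proj p" "b = proj q" "p + q \<in> C"
    "g *v p \<in> span {p, q}" "g *v q \<in> span {p, q}"
    using axis_end_points[OF L[unfolded ab(3)] ab(1,2)] by metis
  have sp: "(e *\<^sub>R g) *v p \<in> span {p, q}" "(e *\<^sub>R g) *v q \<in> span {p, q}"
    using pq(6,7) by (simp_all add: matrix_vector_scaleR_left span_scale)
  obtain l m where lm: "l > 0" "m > 0" "l \<noteq> m" "(e *\<^sub>R g) *v p = l *\<^sub>R p" "(e *\<^sub>R g) *v q = m *\<^sub>R q"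
    using axis_eigenvectors[OF aut pq(1,2,5) sp translation_length_pos_no_fixed[OF gA tl aut]] by metis
  have "p + z \<in> C \<or> z + q \<in> C" if "z \<in> bd" for z
    using half[OF ab(1,2)] L ab(3) pq(3,4) in_half_triangle_iff[OF pq(1,2)] that by blast
  then show thesis using that pq lm by blast
qed

text \<open>\<open>x\<close> and \<open>y\<close> may be any eigenvectors in the closed cone. They
  give an axis and a positive displacement, and they reduce the search for half triangles to pairs
  of ends whose eigenvalues are at least \<open>l\<close> and \<open>k\<close>.\<close>

lemma rank_one_isometryI:
  assumes g: "g \<in> Aut \<Omega>" and aut: "cone_aut (e *\<^sub>R g) B" and e: "e \<noteq> 0"
    and x: "x \<in> D" "x \<noteq> 0" "(e *\<^sub>R g) *v x = l *\<^sub>R x"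
    and y: "y \<in> D" "y \<noteq> 0" "B *v y = k *\<^sub>R y"
    and lk: "l * k > 1" "k > 0" and xy: "x + y \<in> C"
    and half: "\<And>p q a b z. \<lbrakk>p \<in> bd; q \<in> bd; p + q \<in> C; (e *\<^sub>R g) *v p = a *\<^sub>R p; B *v q = b *\<^sub>R q;
      l \<le> a; k \<le> b; z \<in> bd\<rbrakk> \<Longrightarrow> p + z \<in> C \<or> z + q \<in> C"
  shows "rank_one_isometry \<Omega> g"
  unfolding rank_one_isometry_def
proof (intro conjI ballI impI)
  let ?A = "e *\<^sub>R g"
  show "g \<in> Aut \<Omega>" by fact
  have "1/2 * ln (l * k) \<le> translation_length \<Omega> g"
    unfolding translation_length_def
  proof (rule cINF_greatest)
    show "\<Omega> \<noteq> {}" using nonempty_C proj_C by blast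
    fix p assume "p \<in> \<Omega>"
    then obtain X where X: "X \<in> C" "p = proj X" by (rule domain_obtain)
    then show "1/2 * ln (l * k) \<le> hilbert_dist \<Omega> p (proj_act g p)"
      using displacement_ge[OF aut x y lk] proj_act_scale[OF aut nonzero_C] by simp
  qed
  moreover have "ln (l * k) > 0" using lk(1) by (rule ln_gt_zero)
  ultimately show "translation_length \<Omega> g > 0" by linarith
  have Ay: "y = k *\<^sub>R (?A *v y)"
    using cone_aut_inverse[OF aut, of y] by (simp add: y matrix_vector_mult_scaleR)
  show "\<exists>L. isometry_axis \<Omega> g L"
  proof -
    let ?V = "span {x, y}"
    have ind: "x \<noteq> c *\<^sub>R y" for c
    proof
      assume "x = c *\<^sub>R y"
      then have "k *\<^sub>R (?A *v x) = x" using Ay by (metis matrix_vector_mult_scaleR scaleR_left_commute)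
      then have "(l * k) *\<^sub>R x = 1 *\<^sub>R x" using x(3) by (simp add: mult.commute)
      then have "l * k = 1" using x(2) by (metis scaleR_right_imp_eq)
      then show False using lk by simp
    qed
    have "independent {x, y}" using ind y(2) by (auto simp: independent_insert span_singleton)
    moreover have "x \<noteq> y" using ind[of 1] by simp
    ultimately have dim: "dim ?V = 2" by (simp add: dim_eq_card_independent)
    have gx: "g *v x = (l / e) *\<^sub>R x"
    proof -
      have "e *\<^sub>R (g *v x) = l *\<^sub>R x" using x(3) by (simp add: matrix_vector_scaleR_left)
      then have "(1/e) *\<^sub>R (e *\<^sub>R (g *v x)) = (1/e) *\<^sub>R (l *\<^sub>R x)" by simp
      then show ?thesis using e by simp
    qed
    have gy: "g *v y = (1 / (k * e)) *\<^sub>R y"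
    proof -
      have "y = (k * e) *\<^sub>R (g *v y)" using Ay by (simp add: matrix_vector_scaleR_left)
      then have "(1 / (k * e)) *\<^sub>R y = (1 / (k * e)) *\<^sub>R ((k * e) *\<^sub>R (g *v y))" by simp
      then show ?thesis using e lk by simp
    qed
    have "g *v v \<in> ?V" if v: "v \<in> ?V" for v
    proof -
      obtain s t where "v = s *\<^sub>R x + t *\<^sub>R y" using v unfolding span_pair by blast
      then have "g *v v = (s * (l / e)) *\<^sub>R x + (t * (1 / (k * e))) *\<^sub>R y"
        by (simp only: matrix_vector_right_distrib matrix_vector_mult_scaleR gx gy scaleR_scaleR)
      then show ?thesis using span_pair by blast
    qed
    moreover have "proj (x + y) \<in> proj_space ?V \<inter> \<Omega>"
      using proj_C[OF xy] proj_in_proj_space[OF nonzero_C[OF xy], of ?V] by (simp add: span_add span_base)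
    ultimately have "isometry_axis \<Omega> g (proj_space ?V \<inter> \<Omega>)"
      unfolding isometry_axis_def using dim by (intro conjI exI[of _ ?V]) auto
    then show ?thesis by blast
  qed
  fix a b assume ab: "a \<in> frontier \<Omega>" "b \<in> frontier \<Omega>" "isometry_axis \<Omega> g (open_proj_seg \<Omega> a b)"
  obtain p q where pq: "p \<in> bd" "q \<in> bd" "a = proj p" "b = proj q" "p + q \<in> C"
    "g *v p \<in> span {p, q}" "g *v q \<in> span {p, q}"
    using axis_end_points[OF ab(3,1,2)] by metis
  have sp: "?A *v p \<in> span {p, q}" "?A *v q \<in> span {p, q}"
    using pq(6,7) by (simp_all add: matrix_vector_scaleR_left span_scale)
  obtain c d where cd: "c > 0" "d > 0" "c \<noteq> d" "?A *v p = c *\<^sub>R p" "?A *v q = d *\<^sub>R q"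
    using axis_eigenvectors[OF aut pq(1,2,5) sp no_interior_eigenvector[OF aut x y lk]] by metis
  \<comment> \<open>Stated for arbitrary \<open>p\<close> and \<open>q\<close> so that it applies to
    both orders of the ends. The interior vector \<open>p + q\<close> is the test vector in both
    comparisons, with bound \<open>c\<close> for \<open>A\<close> and \<open>1/d\<close> for
    \<open>B\<close>.\<close>
  have main: "p + z \<in> C \<or> z + q \<in> C"
    if pq: "p \<in> bd" "q \<in> bd" "p + q \<in> C" and cd: "d > 0" "d < c" "?A *v p = c *\<^sub>R p" "?A *v q = d *\<^sub>R q"
      and z: "z \<in> bd" for p q z c d
  proof -
    have Bv: "B *v v = (1 / t) *\<^sub>R v" if "t > 0" "?A *v v = t *\<^sub>R v" for v t
    proof -
      have "t *\<^sub>R (B *v v) = v"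
        using cone_aut_inverse[OF cone_aut_sym[OF aut], of v] that by (simp add: matrix_vector_mult_scaleR)
      then have "(1/t) *\<^sub>R (t *\<^sub>R (B *v v)) = (1/t) *\<^sub>R v" by simp
      then show ?thesis using that by simp
    qed
    have Bq: "B *v q = (1 / d) *\<^sub>R q" and Bp: "B *v p = (1 / c) *\<^sub>R p" using Bv cd by auto
    have "c *\<^sub>R (p + q) - ?A *v (p + q) = (c - d) *\<^sub>R q"
      by (simp add: matrix_vector_right_distrib cd algebra_simps)
    also have "\<dots> \<in> D" using cd pq by (intro scale_D bd_D) auto
    finally have l: "l \<le> c" using eigenvalue_le[OF aut pq(3) x] cd by auto
    have "(1/d) *\<^sub>R (p + q) - B *v (p + q) = (1/d - 1/c) *\<^sub>R p"
      by (simp add: matrix_vector_right_distrib Bp Bq algebra_simps)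
    also have "\<dots> \<in> D" using cd pq by (intro scale_D bd_D) (auto simp: field_simps)
    finally have "k \<le> 1/d" using eigenvalue_le[OF cone_aut_sym[OF aut] pq(3) y] cd by auto
    then show ?thesis using half[OF pq cd(3) Bq l _ z] by blast
  qed
  show "\<not> in_half_triangle \<Omega> a b"
  proof (cases "d < c")
    case True
    then show ?thesis
      using main[OF pq(1,2,5) cd(2) _ cd(4,5)] pq in_half_triangle_iff by blast
  next
    case False
    then have "q + z \<in> C \<or> z + p \<in> C" if "z \<in> bd" for z
      using main[OF pq(2,1) _ cd(1) _ cd(5,4) that] pq(5) cd(3) by (simp add: add.commute)
    then show ?thesis using pq in_half_triangle_iff by (metis add.commute)
  qed
qed

end

section \<open>The Cartan decomposition\<close>

lemma tendsto_matrix_matrix_mult: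
  fixes A :: "'b \<Rightarrow> real^'n^'m" and B :: "'b \<Rightarrow> real^'p^'n"
  assumes "(A \<longlongrightarrow> a) F" "(B \<longlongrightarrow> b) F"
  shows "((\<lambda>x. A x ** B x) \<longlongrightarrow> a ** b) F"
  unfolding matrix_matrix_mult_def
  by (intro vec_tendstoI) (simp, intro tendsto_intros tendsto_vec_nth assms)

lemma tendsto_matrix_vector_mult:
  fixes A :: "'b \<Rightarrow> real^'n^'m" and v :: "'b \<Rightarrow> real^'n"
  assumes "(A \<longlongrightarrow> a) F" "(v \<longlongrightarrow> b) F"
  shows "((\<lambda>x. A x *v v x) \<longlongrightarrow> a *v b) F"
  unfolding matrix_vector_mult_def
  by (intro vec_tendstoI) (simp, intro tendsto_intros tendsto_vec_nth assms)

lemma tendsto_transpose: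
  fixes A :: "'b \<Rightarrow> real^'n^'m"
  assumes "(A \<longlongrightarrow> a) F" shows "((\<lambda>x. transpose (A x)) \<longlongrightarrow> transpose a) F"
  unfolding transpose_def by (intro vec_tendstoI) (simp, intro tendsto_vec_nth assms)

lemma tendsto_det:
  fixes A :: "'b \<Rightarrow> real^'n^'n"
  assumes "(A \<longlongrightarrow> a) F" shows "((\<lambda>x. det (A x)) \<longlongrightarrow> det a) F"
  unfolding det_def by (intro tendsto_intros tendsto_vec_nth assms)

lemma compact_rotation_matrices: "compact {k :: real^'n^'n. rotation_matrix k}"
proof -
  have "closed {k :: real^'n^'n. rotation_matrix k}"
    unfolding closed_sequential_limits
  proof (intro allI impI)
    fix x :: "nat \<Rightarrow> real^'n^'n" and l
    assume "(\<forall>n. x n \<in> {k. rotation_matrix k}) \<and> x \<longlonglongrightarrow> l"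
    then have x: "\<And>n. transpose (x n) ** x n = mat 1" "\<And>n. det (x n) = 1" and lim: "x \<longlonglongrightarrow> l"
      by (auto simp: rotation_matrix_def orthogonal_matrix)
    have "(\<lambda>n. transpose (x n) ** x n) \<longlonglongrightarrow> transpose l ** l"
      by (intro tendsto_matrix_matrix_mult tendsto_transpose lim)
    then have "transpose l ** l = mat 1" using x(1) LIMSEQ_unique[OF _ tendsto_const] by simp
    moreover have "det l = 1" using tendsto_det[OF lim] x(2) LIMSEQ_unique[OF _ tendsto_const] by simp
    ultimately show "l \<in> {k. rotation_matrix k}" by (simp add: rotation_matrix_def orthogonal_matrix)
  qed
  moreover have "bounded {k :: real^'n^'n. rotation_matrix k}"
    unfolding bounded_iff
  proof (intro exI ballI)
    fix k :: "real^'n^'n" assume "k \<in> {k. rotation_matrix k}"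
    then have "k ** transpose k = mat 1"
      by (simp add: rotation_matrix_def orthogonal_matrix_def)
    then have "norm (k $ i) = 1" for i
    proof -
      have "(k ** transpose k) $ i $ i = (k $ i) \<bullet> (k $ i)"
        by (simp add: matrix_matrix_mult_def transpose_def inner_vec_def)
      then show ?thesis using \<open>k ** transpose k = mat 1\<close> by (simp add: mat_def norm_eq_1)
    qed
    moreover have "norm k \<le> (\<Sum>i\<in>UNIV. norm (k $ i))"
      unfolding norm_vec_def by (rule L2_set_le_sum) auto
    ultimately show "norm k \<le> of_nat (CARD('n))" by simp
  qed
  ultimately show ?thesis using compact_eq_bounded_closed by blast
qed

lemma rotation_matrix_mult:
  "rotation_matrix k \<Longrightarrow> rotation_matrix l \<Longrightarrow> rotation_matrix (k ** l)" for k l :: "real^'n^'n"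
  by (simp add: rotation_matrix_def orthogonal_matrix_mul det_mul)

lemma rotation_matrix_transpose: "rotation_matrix k \<Longrightarrow> rotation_matrix (transpose k)" for k :: "real^'n^'n"
  by (simp add: rotation_matrix_def orthogonal_matrix_transpose)

lemma rotation_matrix_inverse:
  fixes k :: "real^'n^'n"
  assumes "rotation_matrix k"
  shows "k ** transpose k = mat 1" "transpose k ** k = mat 1"
  using assms by (simp_all add: rotation_matrix_def orthogonal_matrix_def)

section \<open>Plane rotations and existence of the decomposition\<close>

definition givens :: "'n \<Rightarrow> 'n \<Rightarrow> real \<Rightarrow> real \<Rightarrow> real^'n^'n" where
  "givens i j c s = (\<chi> p q. if p = i then (if q = i then c else if q = j then - s else 0)
     else if p = j then (if q = i then s else if q = j then c else 0) else if p = q then 1 else 0)"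

lemma sum_two_points:
  fixes f :: "'n::finite \<Rightarrow> 'b::comm_monoid_add"
  assumes "i \<noteq> j" "\<And>p. p \<noteq> i \<Longrightarrow> p \<noteq> j \<Longrightarrow> f p = 0"
  shows "(\<Sum>p\<in>UNIV. f p) = f i + f j"
proof -
  have "(\<Sum>p\<in>UNIV. f p) = (\<Sum>p\<in>{i, j}. f p)" using assms(2) by (intro sum.mono_neutral_right) auto
  then show ?thesis using assms(1) by simp
qed

lemma givens_mult:
  fixes M :: "real^'n^'n"
  assumes "i \<noteq> j"
  shows "(givens i j c s ** M) $ p $ k = (if p = i then c * M $ i $ k - s * M $ j $ k
    else if p = j then s * M $ i $ k + c * M $ j $ k else M $ p $ k)"
proof -
  have *: "(givens i j c s ** M) $ p $ k = (\<Sum>q\<in>UNIV. givens i j c s $ p $ q * M $ q $ k)"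
    by (simp add: matrix_matrix_mult_def)
  consider "p = i" | "p = j" | "p \<noteq> i" "p \<noteq> j" by blast
  then show ?thesis
  proof cases
    case 3
    have "(\<Sum>q\<in>UNIV. givens i j c s $ p $ q * M $ q $ k) = (\<Sum>q\<in>UNIV. if p = q then M $ q $ k else 0)"
      using 3 by (intro sum.cong) (auto simp: givens_def)
    then show ?thesis unfolding * using 3 by simp
  next
    case 1
    then show ?thesis
      unfolding * by (subst sum_two_points[OF assms]) (use assms in \<open>auto simp: givens_def\<close>)
  next
    case 2
    then show ?thesis
      unfolding * by (subst sum_two_points[OF assms]) (use assms in \<open>auto simp: givens_def\<close>)
  qed
qed

lemma mult_givens:
  fixes M :: "real^'n^'n"
  assumes "i \<noteq> j"
  shows "(M ** givens i j c s) $ k $ p = (if p = i then c * M $ k $ i + s * M $ k $ j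
    else if p = j then c * M $ k $ j - s * M $ k $ i else M $ k $ p)"
proof -
  have *: "(M ** givens i j c s) $ k $ p = (\<Sum>q\<in>UNIV. M $ k $ q * givens i j c s $ q $ p)"
    by (simp add: matrix_matrix_mult_def)
  consider "p = i" | "p = j" | "p \<noteq> i" "p \<noteq> j" by blast
  then show ?thesis
  proof cases
    case 3
    have "(\<Sum>q\<in>UNIV. M $ k $ q * givens i j c s $ q $ p) = (\<Sum>q\<in>UNIV. if q = p then M $ k $ q else 0)"
      using 3 by (intro sum.cong) (auto simp: givens_def)
    then show ?thesis unfolding * using 3 by simp
  next
    case 1
    then show ?thesis
      unfolding * by (subst sum_two_points[OF assms]) (use assms in \<open>auto simp: givens_def\<close>)
  next
    case 2
    then show ?thesis
      unfolding * by (subst sum_two_points[OF assms]) (use assms in \<open>auto simp: givens_def\<close>)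
  qed
qed

lemma givens_compose:
  assumes "i \<noteq> j"
  shows "givens i j c s ** givens i j c' s' = (givens i j (c * c' - s * s') (s * c' + c * s') :: real^'n^'n)"
  unfolding vec_eq_iff givens_mult[OF assms] using assms by (auto simp: givens_def)

text \<open>The determinant is 1 rather than -1 because the rotation is the square of the one by
  half the angle.\<close>

lemma rotation_givens:
  assumes ij: "i \<noteq> j" and cs: "c\<^sup>2 + s\<^sup>2 = 1"
  shows "rotation_matrix (givens i j c s :: real^'n^'n)"
proof -
  have orth: "orthogonal_matrix (givens i j x y :: real^'n^'n)" if "x\<^sup>2 + y\<^sup>2 = 1" for x y
  proof -
    have "transpose (givens i j x y :: real^'n^'n) = givens i j x (- y)"
      using ij by (auto simp: givens_def transpose_def vec_eq_iff)
    moreover have "givens i j 1 0 = (mat 1 :: real^'n^'n)"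
      using ij by (auto simp: givens_def mat_def vec_eq_iff)
    ultimately show ?thesis
      using that by (simp add: orthogonal_matrix givens_compose[OF ij] power2_eq_square)
  qed
  obtain t where t: "c = cos t" "s = sin t" using sincos_total_2pi[OF cs] by metis
  let ?H = "givens i j (cos (t/2)) (sin (t/2)) :: real^'n^'n"
  have "givens i j c s = ?H ** ?H"
    unfolding givens_compose[OF ij] t using cos_add[of "t/2" "t/2"] sin_add[of "t/2" "t/2"] by simp
  then have "det (givens i j c s :: real^'n^'n) = (det ?H)\<^sup>2"
    by (simp add: det_mul power2_eq_square)
  moreover have "(det ?H)\<^sup>2 = 1"
    using det_orthogonal_matrix[OF orth[of "cos (t/2)" "sin (t/2)"]] by auto
  ultimately show ?thesis using orth[OF cs] by (simp add: rotation_matrix_def)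
qed

text \<open>The first order condition for a maximum on the circle at (1,0), obtained by testing the
  direction of (A,B), where the linear form attains \<open>r\<close>.\<close>

lemma circle_max_imp_zero:
  fixes A B :: real
  assumes "\<And>c s. c\<^sup>2 + s\<^sup>2 = 1 \<Longrightarrow> A * c + B * s \<le> A"
  shows "B = 0"
proof (rule ccontr)
  assume B: "B \<noteq> 0"
  define r where "r = sqrt (A\<^sup>2 + B\<^sup>2)"
  have r2: "r\<^sup>2 = A\<^sup>2 + B\<^sup>2" by (simp add: r_def)
  have r: "r > 0" using B by (simp add: r_def sum_power2_gt_zero_iff)
  have "(A / r)\<^sup>2 + (B / r)\<^sup>2 = (A\<^sup>2 + B\<^sup>2) / r\<^sup>2" by (simp add: power_divide add_divide_distrib)
  also have "\<dots> = 1" unfolding r2[symmetric] using r by simp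
  finally have "(A / r)\<^sup>2 + (B / r)\<^sup>2 = 1" .
  then have "A * (A / r) + B * (B / r) \<le> A" by (rule assms)
  then have "A\<^sup>2 + B\<^sup>2 \<le> A * r" using r by (simp add: field_simps power2_eq_square)
  then have "r * r \<le> A * r" unfolding r2[symmetric] by (simp add: power2_eq_square)
  then have "r \<le> A" using r by simp
  then have "r\<^sup>2 \<le> A\<^sup>2" using r by (intro power_mono) auto
  then show False using r2 B by simp
qed

text \<open>Maximising a weighted trace with strictly decreasing weights over both rotations diagonalises
  the matrix: plane rotations on the left and on the right give two linear equations for each pair
  of opposite off-diagonal entries, and these only have the zero solution.\<close>

lemma cartan_decomposition_exists:
  fixes g :: "('n::{finite,linorder}) sq_matrix"
  assumes "det g = 1"
  obtains k1 a k2 where "cartan_decomposition g k1 a k2"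
proof -
  \<comment> \<open>Positive and strictly decreasing weights, obtained by counting the indices from
    \<open>i\<close> upwards.\<close>
  define c :: "'n \<Rightarrow> real" where "c i = real (card {j. i \<le> j})" for i
  have c_less: "c j < c i" if "i < j" for i j :: 'n
  proof -
    have "{l. j \<le> l} \<subset> {l. i \<le> l}" using that by (auto simp: less_le_not_le)
    then show ?thesis unfolding c_def by (simp add: psubset_card_mono)
  qed
  have c_pos: "c i > 0" for i by (auto simp: c_def card_gt_0_iff)
  have c_inj: "c i \<noteq> c j" if "i \<noteq> j" for i j :: 'n
    using that c_less neq_iff by (metis less_irrefl)
  define f where "f M = (\<Sum>i\<in>UNIV. c i * M $ i $ i)" for M :: "'n sq_matrix"
  let ?R = "{k :: 'n sq_matrix. rotation_matrix k}"
  have "continuous_on (?R \<times> ?R) (\<lambda>k. f (fst k ** g ** snd k))"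
    unfolding f_def continuous_on_def
  proof
    fix k assume "k \<in> ?R \<times> ?R"
    have "((\<lambda>k. fst k ** g ** snd k) \<longlongrightarrow> fst k ** g ** snd k) (at k within ?R \<times> ?R)"
      by (rule tendsto_matrix_matrix_mult[OF tendsto_matrix_matrix_mult[OF
            tendsto_fst[OF tendsto_ident_at] tendsto_const] tendsto_snd[OF tendsto_ident_at]])
    then show "((\<lambda>k. \<Sum>i\<in>UNIV. c i * (fst k ** g ** snd k) $ i $ i) \<longlongrightarrow>
        (\<Sum>i\<in>UNIV. c i * (fst k ** g ** snd k) $ i $ i)) (at k within ?R \<times> ?R)"
      by (intro tendsto_sum tendsto_mult_left tendsto_vec_nth)
  qed
  moreover have "compact (?R \<times> ?R)" by (intro compact_Times compact_rotation_matrices)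
  moreover have "(mat 1, mat 1) \<in> ?R \<times> ?R" by (simp add: rotation_matrix_def orthogonal_matrix_id)
  then have "?R \<times> ?R \<noteq> {}" by blast
  ultimately obtain k where k: "k \<in> ?R \<times> ?R"
    "\<And>l. l \<in> ?R \<times> ?R \<Longrightarrow> f (fst l ** g ** snd l) \<le> f (fst k ** g ** snd k)"
    using continuous_attains_sup[of "?R \<times> ?R"] by blast
  define k1 k2 where "k1 = fst k" and "k2 = snd k"
  have rot: "rotation_matrix k1" "rotation_matrix k2" using k by (auto simp: k1_def k2_def)
  define M where "M = k1 ** g ** k2"
  have fmax: "f (r ** M ** r') \<le> f M" if "rotation_matrix r" "rotation_matrix r'" for r r'
    using k(2)[of "(r ** k1, k2 ** r')"] that rot
    by (simp add: rotation_matrix_mult M_def k1_def[symmetric] k2_def[symmetric] matrix_mul_assoc)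
  have f_diff: "c i * N $ i $ i + c j * N $ j $ j \<le> c i * M $ i $ i + c j * M $ j $ j"
    if "i \<noteq> j" "f N \<le> f M" "\<And>p. p \<noteq> i \<Longrightarrow> p \<noteq> j \<Longrightarrow> N $ p $ p = M $ p $ p" for i j N
  proof -
    have "f N - f M = (\<Sum>p\<in>UNIV. c p * N $ p $ p - c p * M $ p $ p)" by (simp add: f_def sum_subtractf)
    also have "\<dots> = (c i * N $ i $ i - c i * M $ i $ i) + (c j * N $ j $ j - c j * M $ j $ j)"
      using that by (intro sum_two_points) auto
    finally show ?thesis using that(2) by simp
  qed
  have id: "rotation_matrix (mat 1 :: 'n sq_matrix)" by (simp add: rotation_matrix_def orthogonal_matrix_id)
  have left: "c i * (x * M $ i $ i - y * M $ j $ i) + c j * (y * M $ i $ j + x * M $ j $ j)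
      \<le> c i * M $ i $ i + c j * M $ j $ j" if "i \<noteq> j" "x\<^sup>2 + y\<^sup>2 = 1" for i j x y
    using f_diff[of i j "givens i j x y ** M"] fmax[OF rotation_givens[OF that] id] that(1)
    by (simp add: givens_mult)
  have right: "c i * (x * M $ i $ i + y * M $ i $ j) + c j * (x * M $ j $ j - y * M $ j $ i)
      \<le> c i * M $ i $ i + c j * M $ j $ j" if "i \<noteq> j" "x\<^sup>2 + y\<^sup>2 = 1" for i j x y
    using f_diff[of i j "M ** givens i j x y"] fmax[OF id rotation_givens[OF that]] that(1)
    by (simp add: mult_givens)
  have off: "M $ i $ j = 0" if ij: "i \<noteq> j" for i j
  proof -
    have "c j * M $ i $ j - c i * M $ j $ i = 0"
      by (rule circle_max_imp_zero[of "c i * M $ i $ i + c j * M $ j $ j"])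
        (use left[OF ij] in \<open>simp add: algebra_simps\<close>)
    moreover have "c i * M $ i $ j - c j * M $ j $ i = 0"
      by (rule circle_max_imp_zero[of "c i * M $ i $ i + c j * M $ j $ j"])
        (use right[OF ij] in \<open>simp add: algebra_simps\<close>)
    ultimately have "(c i * c i - c j * c j) * M $ i $ j = 0" by algebra
    moreover have "c i * c i - c j * c j = (c i - c j) * (c i + c j)" by (simp add: algebra_simps)
    moreover have "c i + c j > 0" using c_pos by (simp add: add_pos_pos)
    ultimately show ?thesis using c_inj[OF ij] by simp
  qed
  have M_diag: "M = diag_matrix (\<lambda>i. M $ i $ i)" using off by (auto simp: diag_matrix_def vec_eq_iff)
  have mono: "M $ j $ j \<le> M $ i $ i" if ij: "i < j" for i j
  proof -
    have ne: "i \<noteq> j" using ij by simp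
    \<comment> \<open>Conjugation by a quarter turn exchanges the two diagonal entries, so
      maximality orders them like the weights.\<close>
    let ?N = "givens i j 0 1 ** M ** givens i j 0 (-1)"
    have "f ?N \<le> f M" by (intro fmax rotation_givens ne) auto
    moreover have "?N $ p $ p = M $ p $ p" if "p \<noteq> i" "p \<noteq> j" for p
      using that by (simp add: mult_givens[OF ne] givens_mult[OF ne])
    ultimately have "c i * ?N $ i $ i + c j * ?N $ j $ j \<le> c i * M $ i $ i + c j * M $ j $ j"
      using f_diff[OF ne] by blast
    then have "c i * M $ j $ j + c j * M $ i $ i \<le> c i * M $ i $ i + c j * M $ j $ j"
      using ne by (simp add: mult_givens[OF ne] givens_mult[OF ne])
    then have "(c i - c j) * (M $ i $ i - M $ j $ j) \<ge> 0" by (simp add: algebra_simps)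
    then show ?thesis using c_less[OF ij] by (simp add: zero_le_mult_iff)
  qed
  have "det M = 1" using assms rot by (simp add: M_def det_mul rotation_matrix_def)
  then have prod: "(\<Prod>i\<in>UNIV. M $ i $ i) = 1" using det_diagonal[of M] off by simp
  \<comment> \<open>A half turn in the plane of \<open>i\<close> and \<open>j\<close> flips the
    signs of both diagonal entries, so by maximality their weighted sum is nonnegative. At most one
    entry is thus negative, which determinant 1 excludes.\<close>
  have pos: "M $ i $ i > 0" for i
  proof (rule ccontr)
    assume neg: "\<not> M $ i $ i > 0"
    have split: "M $ i $ i * (\<Prod>j\<in>UNIV - {i}. M $ j $ j) = 1" using prod by (simp add: prod.remove[of UNIV i])
    then have neg: "M $ i $ i < 0" using neg by (cases "M $ i $ i = 0") auto
    have "M $ j $ j \<ge> 0" if "j \<noteq> i" for j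
    proof -
      have "c i * M $ i $ i + c j * M $ j $ j \<ge> 0" using left[of i j "-1" 0] that by simp
      moreover have "c i * M $ i $ i < 0" using neg c_pos by (simp add: mult_pos_neg)
      ultimately have "c j * M $ j $ j > 0" by linarith
      then show ?thesis using c_pos[of j] by (simp add: zero_less_mult_iff)
    qed
    then have "(\<Prod>j\<in>UNIV - {i}. M $ j $ j) \<ge> 0" by (intro prod_nonneg) auto
    then have "M $ i $ i * (\<Prod>j\<in>UNIV - {i}. M $ j $ j) \<le> 0" using neg by (simp add: mult_nonpos_nonneg)
    then show False using split by simp
  qed
  have "transpose k1 ** M ** transpose k2 = (transpose k1 ** k1) ** g ** (k2 ** transpose k2)"
    by (simp add: M_def matrix_mul_assoc)
  also have "\<dots> = g" using rot by (simp add: rotation_matrix_inverse)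
  finally have "g = transpose k1 ** diag_matrix (\<lambda>i. M $ i $ i) ** transpose k2"
    using M_diag by simp
  moreover have "antimono (\<lambda>i. M $ i $ i)"
    by (rule antimonoI) (use mono in \<open>auto simp: le_less\<close>)
  ultimately have "cartan_decomposition g (transpose k1) (\<lambda>i. M $ i $ i) (transpose k2)"
    using rot pos by (simp add: cartan_decomposition_def rotation_matrix_transpose)
  then show thesis by (rule that)
qed

section \<open>Uniqueness of the singular values and of the attracting point\<close>

lemma diag_matrix_mult: "(diag_matrix a ** M) $ p $ q = a p * M $ p $ q" for M :: "real^'n^'n"
proof -
  have "(diag_matrix a ** M) $ p $ q = (\<Sum>k\<in>UNIV. if p = k then a k * M $ k $ q else 0)"
    unfolding matrix_matrix_mult_def diag_matrix_def by (simp add: if_distrib[of "\<lambda>x. x * _"] cong: if_cong)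
  then show ?thesis by simp
qed

lemma mult_diag_matrix: "(M ** diag_matrix a) $ p $ q = M $ p $ q * a q" for M :: "real^'n^'n"
proof -
  have "(M ** diag_matrix a) $ p $ q = (\<Sum>k\<in>UNIV. if k = q then M $ p $ k * a k else 0)"
    unfolding matrix_matrix_mult_def diag_matrix_def by (simp add: if_distrib[of "\<lambda>x. _ * x"] cong: if_cong)
  then show ?thesis by simp
qed

lemma transpose_diag_matrix: "transpose (diag_matrix a) = diag_matrix a"
  by (auto simp: transpose_def diag_matrix_def vec_eq_iff)

text \<open>Counting: otherwise every index up to \<open>i\<close> has a value of \<open>a\<close>
  above \<open>b i\<close>, while \<open>s\<close> sends all indices with such values injectively
  below \<open>i\<close>.\<close>

lemma antimono_permutation_le:
  fixes a b :: "'n::{finite,linorder} \<Rightarrow> real"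
  assumes "antimono a" "antimono b" "bij s" "\<And>p. a p = b (s p)"
  shows "a i \<le> b i"
proof (rule ccontr)
  assume "\<not> a i \<le> b i"
  then have less: "b i < a i" by simp
  have "{..i} \<subseteq> {p. a p > b i}" using less assms(1) by (auto dest: antimonoD intro: less_le_trans)
  then have "card {..i} \<le> card {p. a p > b i}" by (intro card_mono) auto
  also have "\<dots> = card (s ` {p. a p > b i})"
    using assms(3) by (intro card_image[symmetric]) (auto simp: bij_def inj_def inj_on_def)
  also have "\<dots> \<le> card {..<i}"
    using assms(2,4) by (intro card_mono) (auto simp: not_less dest: antimonoD leD intro!: not_le_imp_less)
  also have "\<dots> < card {..i}" by (intro psubset_card_mono) auto
  finally show False by simp
qed

text \<open>The decomposition gives one intertwining relation and its transpose the other. Together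
  they force \<open>a p * a p = b q * b q\<close> wherever an entry is nonzero, and positivity
  removes the squares.\<close>

lemma cartan_decomposition_intertwiners:
  assumes "cartan_decomposition g k1 a k2" "cartan_decomposition g l1 b l2"
  defines "U \<equiv> k2 ** transpose l2" and "K \<equiv> transpose k1 ** l1"
  shows "a p * U $ p $ q = K $ p $ q * b q" "a p * K $ p $ q = U $ p $ q * b q"
    "U $ p $ q \<noteq> 0 \<Longrightarrow> a p = b q" "K $ p $ q \<noteq> 0 \<Longrightarrow> a p = b q"
proof -
  have g: "k1 ** diag_matrix a ** k2 = l1 ** diag_matrix b ** l2"
    and rot: "rotation_matrix k1" "rotation_matrix k2" "rotation_matrix l1" "rotation_matrix l2"
    and pos: "\<And>i. a i > 0" "\<And>i. b i > 0"
    using assms by (auto simp: cartan_decomposition_def)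
  have "transpose k1 ** (k1 ** diag_matrix a ** k2) ** transpose l2
      = transpose k1 ** (l1 ** diag_matrix b ** l2) ** transpose l2" using g by simp
  then have "diag_matrix a ** U = K ** diag_matrix b ** (l2 ** transpose l2)"
    by (simp add: U_def K_def matrix_mul_assoc rotation_matrix_inverse[OF rot(1)])
  then have "diag_matrix a ** U = K ** diag_matrix b" by (simp add: rotation_matrix_inverse[OF rot(4)])
  then show 1: "a p * U $ p $ q = K $ p $ q * b q" for p q
    by (metis diag_matrix_mult mult_diag_matrix)
  have "transpose (k1 ** diag_matrix a ** k2) = transpose (l1 ** diag_matrix b ** l2)" using g by simp
  then have "transpose k2 ** diag_matrix a ** transpose k1 = transpose l2 ** diag_matrix b ** transpose l1"
    by (simp add: matrix_transpose_mul transpose_diag_matrix matrix_mul_assoc)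
  then have "k2 ** (transpose k2 ** diag_matrix a ** transpose k1) ** l1
      = k2 ** (transpose l2 ** diag_matrix b ** transpose l1) ** l1" by simp
  then have "diag_matrix a ** K = U ** diag_matrix b ** (transpose l1 ** l1)"
    by (simp add: U_def K_def matrix_mul_assoc rotation_matrix_inverse[OF rot(2)])
  then have "diag_matrix a ** K = U ** diag_matrix b" by (simp add: rotation_matrix_inverse[OF rot(3)])
  then show 2: "a p * K $ p $ q = U $ p $ q * b q" for p q
    by (metis diag_matrix_mult mult_diag_matrix)
  have "a p * a p * U $ p $ q = b q * b q * U $ p $ q" "a p * a p * K $ p $ q = b q * b q * K $ p $ q"
    using 1[of p q] 2[of p q] by algebra+
  moreover have "a p = b q" if "a p * a p = b q * b q"
    using that pos[of p] pos(2)[of q] by (metis abs_of_pos real_sqrt_mult_self real_sqrt_abs2)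
  ultimately show "U $ p $ q \<noteq> 0 \<Longrightarrow> a p = b q" "K $ p $ q \<noteq> 0 \<Longrightarrow> a p = b q" by auto
qed

text \<open>The rotation comparing the two right factors has determinant 1, so some permutation has
  a nonzero product in the Leibniz formula. Along it the two families agree, and ordered families
  that agree up to a permutation are equal.\<close>

lemma singular_values_unique:
  fixes g :: "('n::{finite,linorder}) sq_matrix"
  assumes A: "cartan_decomposition g k1 a k2" and B: "cartan_decomposition g l1 b l2"
  shows "a = b"
proof -
  have le: "a i \<le> b i" if A: "cartan_decomposition g k1 a k2" and B: "cartan_decomposition g l1 b l2"
    for a b k1 k2 l1 l2 and i :: 'n
  proof -
    let ?U = "k2 ** transpose l2"
    have "det ?U = 1" using A B by (simp add: cartan_decomposition_def rotation_matrix_def det_mul)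
    then have "det ?U \<noteq> 0" by simp
    then obtain s where s: "s \<in> {s. s permutes UNIV}" "of_int (sign s) * (\<Prod>p\<in>UNIV. ?U $ p $ s p) \<noteq> (0::real)"
      unfolding det_def by (rule sum.not_neutral_contains_not_neutral)
    have "(\<Prod>p\<in>UNIV. ?U $ p $ s p) \<noteq> 0" using s(2) unfolding mult_eq_0_iff by blast
    then have "?U $ p $ s p \<noteq> 0" for p unfolding prod_zero_iff[OF finite_class.finite_UNIV] by blast
    then have "a p = b (s p)" for p using cartan_decomposition_intertwiners(3)[OF A B] by blast
    moreover have "antimono a" "antimono b" using A B by (auto simp: cartan_decomposition_def)
    ultimately show ?thesis using s(1) by (intro antimono_permutation_le[of a b s]) (auto intro: permutes_bij)
  qed
  show ?thesis using le[OF A B] le[OF B A] by (intro ext antisym)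
qed

lemma singular_values_eq: "cartan_decomposition g k1 a k2 \<Longrightarrow> singular_values g = a"
  unfolding singular_values_def using singular_values_unique by (intro the_equality) blast+

lemma index1_le: "(index1 :: 'n::{finite,linorder}) \<le> i"
  by (simp add: index1_def)

lemma index2_le: "i \<noteq> index1 \<Longrightarrow> (index2 :: 'n::{finite,linorder}) \<le> i"
  by (auto simp: index2_def)

lemma index2_neq_index1: "(i :: 'n::{finite,linorder}) \<noteq> index1 \<Longrightarrow> (index2 :: 'n) \<noteq> index1"
  unfolding index2_def using Min_in[of "UNIV - {index1 :: 'n}"] by auto

text \<open>The gap confines the first column of the rotation comparing the left factors to its
  entry at \<open>index1\<close>, so their first columns are proportional.\<close>

lemma attracting_point_eq:
  fixes g :: "('n::{finite,linorder}) sq_matrix"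
  assumes A: "cartan_decomposition g k1 a k2" and gap: "a index2 < a index1"
  shows "attracting_point g = proj (k1 *v axis index1 1)"
  unfolding attracting_point_def
proof (rule the_equality)
  fix p assume "\<exists>l1 b l2. cartan_decomposition g l1 b l2 \<and> p = proj (l1 *v axis index1 1)"
  then obtain l1 b l2 where B: "cartan_decomposition g l1 b l2" and p: "p = proj (l1 *v axis index1 1)"
    by blast
  have B: "cartan_decomposition g l1 a l2" using B singular_values_unique[OF A B] by simp
  let ?K = "transpose k1 ** l1" and ?e = "axis index1 1 :: real^('n::{finite,linorder})"
  have rot: "rotation_matrix k1" "rotation_matrix l1" using A B by (auto simp: cartan_decomposition_def)
  have anti: "antimono a" using A by (simp add: cartan_decomposition_def)
  have "?K $ q $ index1 = 0" if "q \<noteq> index1" for q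
  proof (rule ccontr)
    assume "?K $ q $ index1 \<noteq> 0"
    then have "a q = a index1" using cartan_decomposition_intertwiners(4)[OF A B] by blast
    moreover have "a q \<le> a index2" using antimonoD[OF anti index2_le[OF that]] .
    ultimately show False using gap by simp
  qed
  then have "column index1 ?K = (?K $ index1 $ index1) *\<^sub>R ?e"
    by (auto simp: vec_eq_iff column_def axis_def)
  then have Ke: "?K *v ?e = (?K $ index1 $ index1) *\<^sub>R ?e" by (simp only: matrix_vector_mult_basis)
  have "l1 *v ?e = k1 *v (?K *v ?e)"
    using rotation_matrix_inverse[OF rot(1)] by (simp add: matrix_vector_mul_assoc matrix_mul_assoc)
  also have "\<dots> = (?K $ index1 $ index1) *\<^sub>R (k1 *v ?e)" by (simp only: Ke matrix_vector_mult_scaleR)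
  finally have eq: "l1 *v ?e = (?K $ index1 $ index1) *\<^sub>R (k1 *v ?e)" .
  have "l1 *v ?e \<noteq> 0"
  proof
    assume "l1 *v ?e = 0"
    then have "(transpose l1 ** l1) *v ?e = 0" by (simp add: matrix_vector_mul_assoc[symmetric])
    then show False using rotation_matrix_inverse[OF rot(2)] by (simp add: axis_eq_0_iff)
  qed
  then have "?K $ index1 $ index1 \<noteq> 0" using eq by auto
  then show "p = proj (k1 *v ?e)" unfolding p eq by (simp add: proj_scale)
qed (use A in blast)

section \<open>The proximal limit set\<close>

definition outer :: "real^'n \<Rightarrow> real^'n \<Rightarrow> real^'n^'n" where
  "outer u v = (\<chi> i j. u $ i * v $ j)"

lemma outer_vector: "outer u m *v x = (m \<bullet> x) *\<^sub>R u"
  by (simp add: outer_def matrix_vector_mult_def inner_vec_def vec_eq_iff sum_distrib_left algebra_simps)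

lemma matrix_mult_outer: "A ** outer u m = outer (A *v u) m"
  by (simp add: outer_def matrix_matrix_mult_def matrix_vector_mult_def vec_eq_iff sum_distrib_right mult.assoc)

lemma outer_mult_matrix: "outer u m ** A = outer u (transpose A *v m)"
  by (simp add: outer_def matrix_matrix_mult_def matrix_vector_mult_def transpose_def vec_eq_iff
      sum_distrib_left mult_ac)

lemma outer_scale_left: "outer (c *\<^sub>R u) m = outer u (c *\<^sub>R m)"
  by (simp add: outer_def vec_eq_iff)

lemma rotation_vector_nonzero:
  fixes k :: "real^'n^'n"
  assumes "rotation_matrix k" "v \<noteq> 0" shows "k *v v \<noteq> 0"
proof
  assume "k *v v = 0"
  then have "(transpose k ** k) *v v = 0" by (simp add: matrix_vector_mul_assoc[symmetric])
  then show False using rotation_matrix_inverse[OF assms(1)] assms(2) by simp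
qed

lemma cartan_subsequence:
  fixes \<gamma> :: "nat \<Rightarrow> ('n::{finite,linorder}) sq_matrix"
  assumes "\<And>n. \<gamma> n \<in> carrier SL"
  obtains r k1 a k2 K1 K2 where "strict_mono r" "\<And>n. cartan_decomposition (\<gamma> (r n)) (k1 n) (a n) (k2 n)"
    "k1 \<longlonglongrightarrow> K1" "k2 \<longlonglongrightarrow> K2" "rotation_matrix K1" "rotation_matrix K2"
proof -
  have "\<exists>k1 a k2. cartan_decomposition (\<gamma> n) k1 a k2" for n
  proof -
    have "det (\<gamma> n) = 1" using assms[of n] by (simp add: SL_def)
    then show ?thesis using cartan_decomposition_exists by blast
  qed
  then obtain k1 a k2 where k: "\<And>n. cartan_decomposition (\<gamma> n) (k1 n) (a n) (k2 n)" by metis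
  let ?R = "{k :: 'n sq_matrix. rotation_matrix k}"
  have "seq_compact (?R \<times> ?R)"
    by (intro compact_imp_seq_compact compact_Times compact_rotation_matrices)
  moreover have "\<forall>n. (k1 n, k2 n) \<in> ?R \<times> ?R" using k by (auto simp: cartan_decomposition_def)
  ultimately obtain K r where K: "K \<in> ?R \<times> ?R" "strict_mono r" "((\<lambda>n. (k1 n, k2 n)) \<circ> r) \<longlonglongrightarrow> K"
    using seq_compactE[of "?R \<times> ?R" "\<lambda>n. (k1 n, k2 n)"] by blast
  show thesis
  proof (rule that[OF K(2), of "k1 \<circ> r" "a \<circ> r" "k2 \<circ> r" "fst K" "snd K"])
    show "(k1 \<circ> r) \<longlonglongrightarrow> fst K" using tendsto_fst[OF K(3)] by (simp add: o_def)
    show "(k2 \<circ> r) \<longlonglongrightarrow> snd K" using tendsto_snd[OF K(3)] by (simp add: o_def)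
  qed (use K k in auto)
qed

text \<open>Once the rotations converge, undoing them turns the limit into a diagonal matrix of rank
  one with decreasing nonnegative entries, which must be supported on the first entry. This gives
  both the divergence of the ratio of singular values and the limit of the attracting
  points.\<close>

lemma rank_one_limit_proximal:
  fixes \<gamma> :: "nat \<Rightarrow> ('n::{finite,linorder}) sq_matrix"
  assumes dim: "(i0 :: 'n) \<noteq> index1"
    and \<gamma>: "\<And>n. \<gamma> n \<in> carrier SL" "\<And>n. \<gamma> n \<in> \<Gamma>" and s: "\<And>n. s n > 0"
    and lim: "(\<lambda>n. s n *\<^sub>R \<gamma> n) \<longlonglongrightarrow> outer u m" and um: "u \<noteq> 0" "m \<noteq> 0"
  shows "proj u \<in> proximal_limit_set \<Gamma>"
proof -
  obtain r k1 a k2 K1 K2 where r: "strict_mono r"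
    and cd: "\<And>n. cartan_decomposition (\<gamma> (r n)) (k1 n) (a n) (k2 n)"
    and K: "k1 \<longlonglongrightarrow> K1" "k2 \<longlonglongrightarrow> K2" "rotation_matrix K1" "rotation_matrix K2"
    using cartan_subsequence[of \<gamma>, OF \<gamma>(1)] by metis
  let ?i = "index1 :: 'n" and ?j = "index2 :: 'n"
  have ij: "?j \<noteq> ?i" using index2_neq_index1[OF dim] .
  define \<alpha> where "\<alpha> n i = s (r n) * a n i" for n and i :: 'n
  define p q where "p = transpose K1 *v u" and "q = K2 *v m"
  have pq0: "p \<noteq> 0" "q \<noteq> 0"
    unfolding p_def q_def
    using rotation_vector_nonzero[OF rotation_matrix_transpose[OF K(3)] um(1)]
      rotation_vector_nonzero[OF K(4) um(2)] .
  have rot: "rotation_matrix (k1 n)" "rotation_matrix (k2 n)" and anti: "antimono (a n)" and apos: "a n i > 0"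
    and dec: "\<gamma> (r n) = k1 n ** diag_matrix (a n) ** k2 n" for n i
    using cd[of n] by (auto simp: cartan_decomposition_def)
  have lim_r: "(\<lambda>n. s (r n) *\<^sub>R \<gamma> (r n)) \<longlonglongrightarrow> outer u m"
    using LIMSEQ_subseq_LIMSEQ[OF lim r] by (simp add: o_def)
  have "(\<lambda>n. transpose (k1 n) ** (s (r n) *\<^sub>R \<gamma> (r n)) ** transpose (k2 n)) \<longlonglongrightarrow>
      transpose K1 ** outer u m ** transpose K2"
    by (intro tendsto_matrix_matrix_mult tendsto_transpose K lim_r)
  moreover have "transpose (k1 n) ** (s (r n) *\<^sub>R \<gamma> (r n)) ** transpose (k2 n) = diag_matrix (\<alpha> n)" for n
  proof -
    have "transpose (k1 n) ** \<gamma> (r n) ** transpose (k2 n)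
        = (transpose (k1 n) ** k1 n) ** diag_matrix (a n) ** (k2 n ** transpose (k2 n))"
      by (simp add: dec matrix_mul_assoc)
    also have "\<dots> = diag_matrix (a n)" by (simp add: rotation_matrix_inverse rot)
    finally have "s (r n) *\<^sub>R (transpose (k1 n) ** \<gamma> (r n) ** transpose (k2 n)) = diag_matrix (\<alpha> n)"
      by (simp add: \<alpha>_def diag_matrix_def vec_eq_iff)
    then show ?thesis by (simp add: scalar_matrix_assoc matrix_scalar_ac)
  qed
  moreover have "transpose K1 ** outer u m ** transpose K2 = outer p q"
    by (simp add: matrix_mult_outer outer_mult_matrix p_def q_def)
  ultimately have lim_diag: "(\<lambda>n. diag_matrix (\<alpha> n)) \<longlonglongrightarrow> outer p q" by simp
  have entry: "(\<lambda>n. diag_matrix (\<alpha> n) $ i $ j) \<longlonglongrightarrow> p $ i * q $ j" for i j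
    using tendsto_vec_nth[OF tendsto_vec_nth[OF lim_diag, of i], of j] by (simp add: outer_def)
  have lim_\<alpha>: "(\<lambda>n. \<alpha> n i) \<longlonglongrightarrow> p $ i * q $ i" for i
    using entry[of i i] by (simp add: diag_matrix_def)
  have off: "p $ i * q $ j = 0" if "i \<noteq> j" for i j
    using entry[of i j] that by (auto simp: diag_matrix_def dest: LIMSEQ_unique[OF _ tendsto_const])
  have \<alpha>_mono: "\<alpha> n j \<le> \<alpha> n i" if "i \<le> j" for n i j
    using antimonoD[OF anti that] s[of "r n"] by (simp add: \<alpha>_def)
  have pq_mono: "p $ j * q $ j \<le> p $ i * q $ i" if "i \<le> j" for i j
    by (rule LIMSEQ_le[OF lim_\<alpha> lim_\<alpha>]) (use \<alpha>_mono that in auto)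
  have \<alpha>_pos: "\<alpha> n i > 0" for n i using s apos by (simp add: \<alpha>_def)
  have pq_nonneg: "p $ i * q $ i \<ge> 0" for i
    by (rule LIMSEQ_le_const[OF lim_\<alpha>]) (use \<alpha>_pos less_imp_le in blast)
  obtain i1 where i1: "p $ i1 \<noteq> 0" using pq0 by (auto simp: vec_eq_iff)
  obtain j1 where j1: "q $ j1 \<noteq> 0" using pq0 by (auto simp: vec_eq_iff)
  \<comment> \<open>The products off the diagonal vanish, so \<open>outer p q\<close> can only have
    a nonzero entry on it.\<close>
  have "i1 = j1" using off[of i1 j1] i1 j1 by auto
  then have "p $ i1 * q $ i1 > 0" using pq_nonneg[of i1] i1 j1 by (simp add: less_le)
  then have top: "p $ ?i * q $ ?i > 0" using pq_mono[OF index1_le] less_le_trans by blast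
  have p_zero: "p $ i = 0" if "i \<noteq> ?i" for i using off[OF that] top by auto
  have lim1: "(\<lambda>n. \<alpha> n ?i) \<longlonglongrightarrow> p $ ?i * q $ ?i" and lim2: "(\<lambda>n. \<alpha> n ?j) \<longlonglongrightarrow> 0"
    using lim_\<alpha>[of ?i] lim_\<alpha>[of ?j] p_zero[OF ij] by auto
  have "(\<lambda>n. \<alpha> n ?j / \<alpha> n ?i) \<longlonglongrightarrow> 0 / (p $ ?i * q $ ?i)"
    using top by (intro tendsto_divide lim1 lim2) auto
  moreover have "0 < \<alpha> n ?j / \<alpha> n ?i" for n using \<alpha>_pos by (intro divide_pos_pos)
  ultimately have "filterlim (\<lambda>n. \<alpha> n ?j / \<alpha> n ?i) (at_right 0) sequentially"
    unfolding filterlim_at by (auto intro!: always_eventually simp: less_imp_neq[symmetric] simp del: divide_eq_0_iff)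
  then have "filterlim (\<lambda>n. inverse (\<alpha> n ?j / \<alpha> n ?i)) at_top sequentially"
    by (rule filterlim_compose[OF filterlim_inverse_at_top_right])
  then have "filterlim (\<lambda>n. ln (inverse (\<alpha> n ?j / \<alpha> n ?i))) at_top sequentially"
    by (rule filterlim_compose[OF ln_at_top])
  moreover have "inverse (\<alpha> n ?j / \<alpha> n ?i) = singular_values (\<gamma> (r n)) ?i / singular_values (\<gamma> (r n)) ?j" for n
    using s[of "r n"] by (simp add: \<alpha>_def singular_values_eq[OF cd])
  ultimately have ratio: "filterlim (\<lambda>n. ln (singular_values (\<gamma> (r n)) ?i / singular_values (\<gamma> (r n)) ?j))
      at_top sequentially" by simp
  let ?e = "axis ?i 1 :: real^('n::{finite,linorder})"
  have "eventually (\<lambda>n. \<alpha> n ?j < \<alpha> n ?i) sequentially"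
  proof -
    have "(\<lambda>n. \<alpha> n ?i - \<alpha> n ?j) \<longlonglongrightarrow> p $ ?i * q $ ?i - 0" by (intro tendsto_diff lim1 lim2)
    then have "eventually (\<lambda>n. 0 < \<alpha> n ?i - \<alpha> n ?j) sequentially" using top by (intro order_tendstoD) auto
    then show ?thesis by (rule eventually_mono) simp
  qed
  then have ap: "eventually (\<lambda>n. proj (k1 n *v ?e) = attracting_point (\<gamma> (r n))) sequentially"
    by (rule eventually_mono) (use s in \<open>simp add: attracting_point_eq[OF cd] \<alpha>_def\<close>)
  have "p = (p $ ?i) *\<^sub>R ?e" using p_zero by (auto simp: vec_eq_iff axis_def)
  then have "K1 *v p = (p $ ?i) *\<^sub>R (K1 *v ?e)" by (metis matrix_vector_mult_scaleR)
  moreover have "K1 *v p = u"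
    unfolding p_def matrix_vector_mul_assoc rotation_matrix_inverse[OF K(3)] by simp
  moreover have "p $ ?i \<noteq> 0" using top by auto
  ultimately have pu: "proj (K1 *v ?e) = proj u" using proj_scale by metis
  have "(\<lambda>n. k1 n *v ?e) \<longlonglongrightarrow> K1 *v ?e" by (intro tendsto_matrix_vector_mult K tendsto_const)
  then have "(\<lambda>n. proj (k1 n *v ?e)) \<longlonglongrightarrow> proj (K1 *v ?e)"
    by (rule tendsto_proj) (rule rotation_vector_nonzero[OF K(3)], simp add: axis_eq_0_iff)
  then have "(\<lambda>n. attracting_point (\<gamma> (r n))) \<longlonglongrightarrow> proj u"
    unfolding pu using ap by (rule Lim_transform_eventually)
  then show ?thesis
    unfolding proximal_limit_set_def
    using ratio \<gamma>(2) by (intro CollectI exI[of _ "\<gamma> \<circ> r"] exI[of _ id]) (auto simp: o_def strict_mono_def)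
qed

text \<open>Division by the first singular value leaves a diagonal part tending to the first
  coordinate projection. The attracting points determine the image vector only up to a scalar, which
  is moved into \<open>m\<close>.\<close>

lemma proximal_rank_one_limit:
  fixes \<Gamma> :: "(('n::{finite,linorder}) sq_matrix) set"
  assumes p: "proj u \<in> proximal_limit_set \<Gamma>" and u: "u \<noteq> 0" and \<Gamma>: "\<Gamma> \<subseteq> carrier SL"
  obtains \<gamma> s m where "\<And>n. \<gamma> n \<in> \<Gamma>" "\<And>n. s n > 0" "(\<lambda>n. s n *\<^sub>R \<gamma> n) \<longlonglongrightarrow> outer u m" "m \<noteq> 0"
proof -
  from p obtain \<gamma> and r :: "nat \<Rightarrow> nat" where \<gamma>: "\<And>n. \<gamma> n \<in> \<Gamma>"
    and ratio: "filterlim (\<lambda>n. ln (singular_values (\<gamma> n) index1 / singular_values (\<gamma> n) index2)) at_top sequentially"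
    and r: "strict_mono r" and lim: "(\<lambda>n. attracting_point (\<gamma> (r n))) \<longlonglongrightarrow> proj u"
    unfolding proximal_limit_set_def by blast
  have "(\<gamma> \<circ> r) n \<in> carrier SL" for n using \<gamma> \<Gamma> by auto
  then obtain r' k1 a k2 K1 K2 where r': "strict_mono r'"
    and cd: "\<And>n. cartan_decomposition ((\<gamma> \<circ> r) (r' n)) (k1 n) (a n) (k2 n)"
    and K: "k1 \<longlonglongrightarrow> K1" "k2 \<longlonglongrightarrow> K2" "rotation_matrix K1" "rotation_matrix K2"
    using cartan_subsequence[of "\<gamma> \<circ> r"] by metis
  let ?i = "index1 :: 'n" and ?j = "index2 :: 'n"
  let ?e = "axis ?i 1 :: real^('n::{finite,linorder})"
  define R where "R = r \<circ> r'"
  have R: "strict_mono R" unfolding R_def using r r' by (rule strict_mono_o)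
  have cd: "cartan_decomposition (\<gamma> (R n)) (k1 n) (a n) (k2 n)" for n using cd[of n] by (simp add: R_def)
  have anti: "antimono (a n)" and apos: "a n i > 0"
    and dec: "\<gamma> (R n) = k1 n ** diag_matrix (a n) ** k2 n" for n i
    using cd[of n] by (auto simp: cartan_decomposition_def)
  have "filterlim (\<lambda>n. ln (a n ?i / a n ?j)) at_top sequentially"
    using filterlim_compose[OF ratio filterlim_subseq[OF R]] by (simp add: singular_values_eq[OF cd])
  then have "filterlim (\<lambda>n. exp (ln (a n ?i / a n ?j))) at_top sequentially"
    by (rule filterlim_compose[OF exp_at_top])
  then have at_top: "filterlim (\<lambda>n. a n ?i / a n ?j) at_top sequentially" using apos by simp
  then have "(\<lambda>n. inverse (a n ?i / a n ?j)) \<longlonglongrightarrow> 0" by (rule tendsto_inverse_0_at_top)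
  then have small: "(\<lambda>n. a n ?j / a n ?i) \<longlonglongrightarrow> 0" by simp
  define \<alpha> where "\<alpha> n i = (1 / a n ?i) * a n i" for n and i :: 'n
  have lim_\<alpha>: "(\<lambda>n. \<alpha> n i) \<longlonglongrightarrow> (if i = ?i then 1 else 0)" for i
  proof (cases "i = ?i")
    case True
    then show ?thesis using apos less_imp_neq[OF apos] by (simp add: \<alpha>_def)
  next
    case False
    have "\<alpha> n i \<le> a n ?j / a n ?i" for n
      using antimonoD[OF anti index2_le[OF False]] apos[of n ?i] by (simp add: \<alpha>_def divide_right_mono)
    moreover have "0 \<le> \<alpha> n i" for n using apos[of n i] apos[of n ?i] by (simp add: \<alpha>_def)
    ultimately have "(\<lambda>n. \<alpha> n i) \<longlonglongrightarrow> 0"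
      by (intro tendsto_sandwich[OF _ _ tendsto_const small]) auto
    then show ?thesis using False by simp
  qed
  have "(\<lambda>n. diag_matrix (\<alpha> n)) \<longlonglongrightarrow> outer ?e ?e"
  proof (intro vec_tendstoI)
    fix i j
    show "(\<lambda>n. diag_matrix (\<alpha> n) $ i $ j) \<longlonglongrightarrow> outer ?e ?e $ i $ j"
      using lim_\<alpha>[of i] by (cases "i = j") (auto simp: diag_matrix_def outer_def axis_def)
  qed
  then have "(\<lambda>n. k1 n ** diag_matrix (\<alpha> n) ** k2 n) \<longlonglongrightarrow> K1 ** outer ?e ?e ** K2"
    by (intro tendsto_matrix_matrix_mult K)
  moreover have "k1 n ** diag_matrix (\<alpha> n) ** k2 n = (1 / a n ?i) *\<^sub>R \<gamma> (R n)" for n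
  proof -
    have "diag_matrix (\<alpha> n) = (1 / a n ?i) *\<^sub>R diag_matrix (a n)"
      by (simp add: \<alpha>_def diag_matrix_def vec_eq_iff)
    then show ?thesis by (simp add: dec scalar_matrix_assoc matrix_scalar_ac)
  qed
  moreover have "K1 ** outer ?e ?e ** K2 = outer (K1 *v ?e) (transpose K2 *v ?e)"
    by (simp add: matrix_mult_outer outer_mult_matrix)
  ultimately have lim_\<gamma>: "(\<lambda>n. (1 / a n ?i) *\<^sub>R \<gamma> (R n)) \<longlonglongrightarrow> outer (K1 *v ?e) (transpose K2 *v ?e)" by simp
  have e0: "?e \<noteq> 0" by (simp add: axis_eq_0_iff)
  have "eventually (\<lambda>n. a n ?j < a n ?i) sequentially"
    using filterlim_at_top_dense[THEN iffD1, OF at_top, rule_format, of 1]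
    by (rule eventually_mono) (use apos in \<open>simp add: field_simps\<close>)
  then have ev: "eventually (\<lambda>n. attracting_point (\<gamma> (R n)) = proj (k1 n *v ?e)) sequentially"
    by (rule eventually_mono) (simp add: attracting_point_eq[OF cd])
  have "(\<lambda>n. attracting_point (\<gamma> (R n))) \<longlonglongrightarrow> proj u"
    using LIMSEQ_subseq_LIMSEQ[OF lim r'] by (simp add: o_def R_def)
  then have "(\<lambda>n. proj (k1 n *v ?e)) \<longlonglongrightarrow> proj u" using ev by (rule Lim_transform_eventually)
  moreover have "(\<lambda>n. k1 n *v ?e) \<longlonglongrightarrow> K1 *v ?e" by (intro tendsto_matrix_vector_mult K tendsto_const)
  ultimately have "proj (K1 *v ?e) = proj u"
    using rotation_vector_nonzero[OF K(3) e0] u by (intro proj_limit_unique)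
  then obtain c where c: "c \<noteq> 0" "K1 *v ?e = c *\<^sub>R u"
    using rotation_vector_nonzero[OF K(3) e0] u by (rule proj_eqE)
  show thesis
  proof (rule that[of "\<lambda>n. \<gamma> (R n)" "\<lambda>n. 1 / a n ?i" "c *\<^sub>R (transpose K2 *v ?e)"])
    show "(\<lambda>n. (1 / a n ?i) *\<^sub>R \<gamma> (R n)) \<longlonglongrightarrow> outer u (c *\<^sub>R (transpose K2 *v ?e))"
      using lim_\<gamma> by (simp add: c(2) outer_scale_left)
    show "c *\<^sub>R (transpose K2 *v ?e) \<noteq> 0"
      using c(1) rotation_vector_nonzero[OF rotation_matrix_transpose[OF K(4)] e0] by simp
  qed (use \<gamma> apos in auto)
qed

section \<open>Rank one isometries have proximal end points\<close>

lemma matrix_norm_le: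
  fixes A :: "real^'n^'m"
  assumes "\<And>j. norm (A *v axis j 1) \<le> K"
  shows "norm A \<le> real CARD('m) * (real CARD('n) * K)"
proof -
  have "norm A \<le> (\<Sum>i\<in>UNIV. norm (A $ i))" unfolding norm_vec_def by (rule L2_set_le_sum) auto
  also have "\<dots> \<le> (\<Sum>i\<in>(UNIV :: 'm set). real CARD('n) * K)"
  proof (rule sum_mono)
    fix i
    have "norm (A $ i) \<le> (\<Sum>j\<in>UNIV. \<bar>A $ i $ j\<bar>)" by (rule norm_le_l1_cart)
    also have "\<dots> \<le> (\<Sum>j\<in>(UNIV :: 'n set). K)"
    proof (rule sum_mono)
      fix j
      have "A $ i $ j = (A *v axis j 1) $ i" by (simp add: matrix_vector_mult_basis column_def)
      then show "\<bar>A $ i $ j\<bar> \<le> K" using component_le_norm_cart[of "A *v axis j 1" i] assms[of j] by simp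
    qed
    finally show "norm (A $ i) \<le> real CARD('n) * K" by simp
  qed
  finally show ?thesis by simp
qed

lemma eq_outer:
  fixes B :: "real^'n^'n"
  assumes "\<And>x. \<exists>c. B *v x = c *\<^sub>R p"
  obtains m where "B = outer p m"
proof -
  obtain c where c: "\<And>x. B *v x = c x *\<^sub>R p" using assms by metis
  have "B $ i $ j = p $ i * c (axis j 1)" for i j
  proof -
    have "B $ i $ j = (B *v axis j 1) $ i" by (simp add: matrix_vector_mult_basis column_def)
    then show ?thesis by (simp add: c)
  qed
  then have "B = outer p (\<chi> j. c (axis j 1))" by (simp add: outer_def vec_eq_iff)
  then show thesis by (rule that)
qed

lemma matrix_scaleR_mult:
  fixes A :: "real^'n^'m" and B :: "real^'p^'n"
  shows "(c *\<^sub>R A) ** (d *\<^sub>R B) = (c * d) *\<^sub>R (A ** B)"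
  by (simp add: matrix_matrix_mult_def vec_eq_iff sum_distrib_left algebra_simps)

definition mat_power :: "real^'n^'n \<Rightarrow> nat \<Rightarrow> real^'n^'n" where
  "mat_power A n = (((**) A) ^^ n) (mat 1)"

lemma mat_power_simps: "mat_power A 0 = mat 1" "mat_power A (Suc n) = A ** mat_power A n"
  by (simp_all add: mat_power_def)

lemma mat_power_add: "mat_power A (m + n) = mat_power A m ** mat_power A n"
  by (induction m) (simp_all add: mat_power_simps matrix_mul_assoc)

lemma mat_power_eigenvector:
  assumes "A *v p = l *\<^sub>R p" shows "mat_power A n *v p = l ^ n *\<^sub>R p"
  by (induction n)
    (simp_all add: mat_power_simps matrix_vector_mul_assoc[symmetric] matrix_vector_mult_scaleR assms mult.commute)

context vec_domain
begin

lemma mat_power_C: assumes "cone_aut A B" "v \<in> C" shows "mat_power A n *v v \<in> C"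
  using assms by (induction n) (simp_all add: mat_power_simps matrix_vector_mul_assoc[symmetric] cone_aut_C)

lemma limit_matrix_D:
  assumes lim: "T \<longlonglongrightarrow> B" and T: "\<And>n v. v \<in> C \<Longrightarrow> T n *v v \<in> C" and v: "v \<in> D"
  shows "B *v v \<in> D"
proof -
  have CD: "B *v x \<in> D" if "x \<in> C" for x
  proof -
    have "(\<lambda>n. T n *v x) \<longlonglongrightarrow> B *v x" by (intro tendsto_matrix_vector_mult lim tendsto_const)
    then show ?thesis unfolding closure_sequential using T[OF that] by (intro exI[of _ "\<lambda>n. T n *v x"]) auto
  qed
  obtain x where x: "\<And>n. x n \<in> C" "x \<longlonglongrightarrow> v"
    using v unfolding closure_sequential by blast
  have "(\<lambda>n. B *v x n) \<longlonglongrightarrow> B *v v" by (intro tendsto_matrix_vector_mult x tendsto_const)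
  moreover have "B *v x n \<in> D" for n using CD x(1) by blast
  ultimately show ?thesis by (rule closed_sequentially[OF closed_closure, rotated])
qed

text \<open>A cone-preserving family is bounded as soon as its values at one interior point are, because
  a neighbourhood of that point is squeezed between vectors of the cone.\<close>

lemma bounded_cone_maps:
  assumes X: "X \<in> C" and T: "\<And>n v. v \<in> C \<Longrightarrow> T n *v v \<in> C" and K: "\<And>n. w \<bullet> (T n *v X) \<le> K"
  shows "bounded (range T)"
proof -
  obtain e where e: "e > 0" "ball X e \<subseteq> C" using open_C X open_contains_ball by blast
  have *: "norm (T n *v v) \<le> 2 * M * K / e" if v: "norm v = 1" for n v
  proof -
    have pm: "X + (e/2) *\<^sub>R v \<in> C" "X - (e/2) *\<^sub>R v \<in> C"
      using e v by (auto simp: subset_eq dist_norm)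
    have "norm (T n *v (X + (e/2) *\<^sub>R v)) \<le> M * (w \<bullet> (T n *v (X + (e/2) *\<^sub>R v)))"
      "norm (T n *v (X - (e/2) *\<^sub>R v)) \<le> M * (w \<bullet> (T n *v (X - (e/2) *\<^sub>R v)))"
      using T pm bound_C by blast+
    then have "norm (T n *v (X + (e/2) *\<^sub>R v)) + norm (T n *v (X - (e/2) *\<^sub>R v)) \<le> 2 * M * (w \<bullet> (T n *v X))"
      by (simp add: matrix_vector_right_distrib matrix_vector_mult_diff_distrib algebra_simps)
    also have "\<dots> \<le> 2 * M * K" using K M_pos by (intro mult_left_mono) auto
    also have "norm (T n *v (X + (e/2) *\<^sub>R v)) + norm (T n *v (X - (e/2) *\<^sub>R v))
        \<ge> norm (T n *v (X + (e/2) *\<^sub>R v) - T n *v (X - (e/2) *\<^sub>R v))" by (rule norm_triangle_ineq4)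
    also have "T n *v (X + (e/2) *\<^sub>R v) - T n *v (X - (e/2) *\<^sub>R v) = e *\<^sub>R (T n *v v)"
      by (simp add: matrix_vector_right_distrib matrix_vector_mult_diff_distrib matrix_vector_mult_scaleR
          scaleR_add_left[symmetric])
    finally show ?thesis using e by (simp add: field_simps)
  qed
  show ?thesis unfolding bounded_iff
    using matrix_norm_le[OF *] by (intro exI ballI) (auto simp: norm_axis_1)
qed

text \<open>A limit of the rescaled powers fixes \<open>p\<close> and kills \<open>q\<close>. If its image were larger than the line of
  \<open>p\<close>, then moving from \<open>p\<close> inside the image up to the boundary of the cone would give the third
  vertex \<open>z\<close> of a half triangle.\<close>

lemma power_limit_rank_one:
  assumes aut: "cone_aut A A'" and p: "p \<in> bd" and q: "q \<in> bd" and C: "p + q \<in> C"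
    and half: "\<And>z. z \<in> bd \<Longrightarrow> p + z \<in> C \<or> z + q \<in> C"
    and ev: "A *v p = l *\<^sub>R p" "A *v q = m *\<^sub>R q" "0 < m" "m < l"
  obtains r :: "nat \<Rightarrow> nat" and \<mu> where "\<mu> \<noteq> 0" "(\<lambda>n. (1 / l ^ r n) *\<^sub>R mat_power A (r n)) \<longlonglongrightarrow> outer p \<mu>"
proof -
  have l: "l > 0" using ev by simp
  have pD: "p \<in> D" "p \<noteq> 0" "p \<notin> C" and qD: "q \<in> D" using p q by (auto simp: bd_def)
  have wp: "w \<bullet> p > 0" using pD pos_D by blast
  define T where "T n = (1 / l ^ n) *\<^sub>R mat_power A n" for n
  have T_add: "T (i + j) = T i ** T j" for i j
    by (simp add: T_def mat_power_add power_add matrix_scaleR_mult)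
  have TC: "T n *v v \<in> C" if "v \<in> C" for n v
    using mat_power_C[OF aut that, of n] l by (simp add: T_def matrix_vector_scaleR_left scale_C)
  have Tp: "T n *v p = p" for n
    using l by (simp add: T_def matrix_vector_scaleR_left mat_power_eigenvector[OF ev(1)])
  have Tq: "T n *v q = (m / l) ^ n *\<^sub>R q" for n
    by (simp add: T_def matrix_vector_scaleR_left mat_power_eigenvector[OF ev(2)] power_divide)
  have lim_q: "(\<lambda>n. T n *v q) \<longlonglongrightarrow> 0"
  proof -
    have "(\<lambda>n. (m / l) ^ n *\<^sub>R q) \<longlonglongrightarrow> 0 *\<^sub>R q"
      using ev by (intro tendsto_intros LIMSEQ_realpow_zero) auto
    then show ?thesis by (simp add: Tq)
  qed
  have bdd: "bounded (range T)"
  proof (rule bounded_cone_maps[OF C TC])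
    fix n
    have "(m / l) ^ n \<le> 1" using ev by (intro power_le_one) auto
    then have "(m / l) ^ n * (w \<bullet> q) \<le> 1 * (w \<bullet> q)" using nonneg_D[OF qD] by (intro mult_right_mono)
    then show "w \<bullet> (T n *v (p + q)) \<le> w \<bullet> p + w \<bullet> q"
      by (simp add: matrix_vector_right_distrib Tp Tq inner_add_right)
  qed
  obtain B r where r: "strict_mono r" and B: "(T \<circ> r) \<longlonglongrightarrow> B"
    using bounded_imp_convergent_subsequence[OF bdd] by blast
  \<comment> \<open>Chosen so that \<open>T (r (2 * j))\<close> factors as
    \<open>T (d j) ** T (r j)\<close>; in the limit \<open>P ** B = B\<close>, so \<open>P\<close>
    is the identity on the image of \<open>B\<close>. The differences also tend to infinity, so
    \<open>P\<close> kills \<open>q\<close> just as \<open>B\<close> does.\<close>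
  define d where "d j = r (2 * j) - r j" for j
  have d: "r (2 * j) = d j + r j" "j \<le> d j" for j
  proof -
    have "r j + k \<le> r (j + k)" for k
    proof (induction k)
      case (Suc k)
      then show ?case using strict_monoD[OF r, of "j + k" "j + Suc k"] by simp
    qed simp
    from this[of j] show "r (2 * j) = d j + r j" "j \<le> d j" by (simp_all add: d_def mult_2)
  qed
  have "bounded (range (T \<circ> d))" using bdd by (rule bounded_subset) auto
  then obtain P t where t: "strict_mono t" and P: "(T \<circ> d \<circ> t) \<longlonglongrightarrow> P"
    using bounded_imp_convergent_subsequence by blast
  have PB: "P ** B = B"
  proof -
    have "(\<lambda>n. T (d (t n)) ** T (r (t n))) \<longlonglongrightarrow> P ** B"
      using P LIMSEQ_subseq_LIMSEQ[OF B t] by (intro tendsto_matrix_matrix_mult) (simp_all add: o_def)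
    moreover have "(\<lambda>n. T (r (2 * t n))) \<longlonglongrightarrow> B"
    proof -
      have "strict_mono (\<lambda>n. 2 * t n)" using t by (simp add: strict_mono_def)
      from LIMSEQ_subseq_LIMSEQ[OF B this] show ?thesis by (simp add: o_def)
    qed
    ultimately show ?thesis using LIMSEQ_unique by (simp add: d(1) T_add)
  qed
  have BD: "B *v v \<in> D" if "v \<in> D" for v
    using limit_matrix_D[OF B _ that] TC by simp
  have PD: "P *v v \<in> D" if "v \<in> D" for v
    using limit_matrix_D[OF P _ that] TC by simp
  have Bp: "B *v p = p"
  proof -
    have "(\<lambda>n. (T \<circ> r) n *v p) \<longlonglongrightarrow> B *v p" by (intro tendsto_matrix_vector_mult B tendsto_const)
    then show ?thesis using LIMSEQ_unique[OF _ tendsto_const] by (simp add: Tp)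
  qed
  have Pp: "P *v p = p"
  proof -
    have "(\<lambda>n. (T \<circ> d \<circ> t) n *v p) \<longlonglongrightarrow> P *v p" by (intro tendsto_matrix_vector_mult P tendsto_const)
    then show ?thesis using LIMSEQ_unique[OF _ tendsto_const] by (simp add: Tp)
  qed
  have Bq: "B *v q = 0"
  proof -
    have "(\<lambda>n. (T \<circ> r) n *v q) \<longlonglongrightarrow> B *v q" by (intro tendsto_matrix_vector_mult B tendsto_const)
    moreover have "(\<lambda>n. (T \<circ> r) n *v q) \<longlonglongrightarrow> 0" using LIMSEQ_subseq_LIMSEQ[OF lim_q r] by (simp add: o_def)
    ultimately show ?thesis by (rule LIMSEQ_unique)
  qed
  have Pq: "P *v q = 0"
  proof -
    have dt: "filterlim (\<lambda>n. d (t n)) at_top sequentially"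
    proof (rule filterlim_at_top_mono[OF filterlim_ident])
      show "eventually (\<lambda>n. n \<le> d (t n)) sequentially"
        using d(2) seq_suble[OF t] le_trans by (intro always_eventually allI) blast
    qed
    have "(\<lambda>n. (T \<circ> d \<circ> t) n *v q) \<longlonglongrightarrow> P *v q" by (intro tendsto_matrix_vector_mult P tendsto_const)
    moreover have "(\<lambda>n. (T \<circ> d \<circ> t) n *v q) \<longlonglongrightarrow> 0" using filterlim_compose[OF lim_q dt] by simp
    ultimately show ?thesis by (rule LIMSEQ_unique)
  qed
  have im: "\<exists>c. B *v x = c *\<^sub>R p" for x
  proof (rule ccontr)
    assume no: "\<not> (\<exists>c. B *v x = c *\<^sub>R p)"
    \<comment> \<open>\<open>v\<close> will be a second direction in the image of \<open>B\<close>,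
      corrected by a multiple of \<open>p\<close> so that \<open>w\<close> vanishes on it. Then
      \<open>p + t *\<^sub>R v\<close> stays in one slice, and \<open>t\<close> is bounded as long
      as it is in \<open>D\<close>.\<close>
    define c where "c = (w \<bullet> (B *v x)) / (w \<bullet> p)"
    define y where "y = x - c *\<^sub>R p"
    define v where "v = B *v y"
    have v_eq: "v = B *v x - c *\<^sub>R p"
      by (simp add: v_def y_def matrix_vector_mult_diff_distrib matrix_vector_mult_scaleR Bp)
    have v0: "v \<noteq> 0" using no v_eq by auto
    have wv: "w \<bullet> v = 0" using wp by (simp add: v_eq c_def inner_diff_right)
    let ?S = "{t. p + t *\<^sub>R v \<in> D}"
    have "continuous_on UNIV (\<lambda>t. p + t *\<^sub>R v)" by (intro continuous_intros)
    then have "closed ?S" using closed_vimage[of D "\<lambda>t. p + t *\<^sub>R v"] by (simp add: vimage_def)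
    moreover have bdS: "t \<le> (M * (w \<bullet> p) + norm p) / norm v" if "t \<in> ?S" for t
    proof -
      have "norm (p + t *\<^sub>R v) \<le> M * (w \<bullet> p)" using bound_D[of "p + t *\<^sub>R v"] that wv by (simp add: inner_add_right)
      moreover have "norm (t *\<^sub>R v) \<le> norm (p + t *\<^sub>R v) + norm p"
        using norm_triangle_ineq4[of "p + t *\<^sub>R v" p] by simp
      ultimately have "\<bar>t\<bar> * norm v \<le> M * (w \<bullet> p) + norm p" by simp
      then have "t * norm v \<le> M * (w \<bullet> p) + norm p"
        by (smt (verit) mult_right_mono norm_ge_zero)
      then show ?thesis using v0 by (simp add: field_simps)
    qed
    then have bddS: "bdd_above ?S" by (rule bdd_aboveI)
    have "0 \<in> ?S" using pD by simp
    then have "?S \<noteq> {}" by blast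
    ultimately have t0S: "Sup ?S \<in> ?S" using bddS by (intro closed_contains_Sup)
    define t0 where "t0 = Sup ?S"
    have t0: "p + t0 *\<^sub>R v \<in> D" using t0S by (simp add: t0_def)
    have max: "t \<le> t0" if "p + t *\<^sub>R v \<in> D" for t
      unfolding t0_def using that bddS by (intro cSup_upper) auto
    \<comment> \<open>\<open>p + e *\<^sub>R v\<close> is the image under \<open>B\<close> of an
      interior vector, so the direction \<open>v\<close> can be followed for a positive
      time.\<close>
    obtain e where e: "e > 0" "(p + q) - e *\<^sub>R (- y) \<in> C" using dominates[OF C] by blast
    have "B *v ((p + q) - e *\<^sub>R (- y)) \<in> D" using BD e C_sub_D by blast
    also have "B *v ((p + q) - e *\<^sub>R (- y)) = p + e *\<^sub>R v"
      by (simp add: matrix_vector_right_distrib matrix_vector_mult_scaleR Bp Bq v_def)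
    finally have "t0 > 0" using max e(1) by fastforce
    define z where "z = p + t0 *\<^sub>R v"
    have zD: "z \<in> D" and wz: "w \<bullet> z > 0" using t0 wp wv by (auto simp: z_def inner_add_right)
    have zB: "z = B *v (p + t0 *\<^sub>R y)"
      by (simp add: z_def matrix_vector_right_distrib matrix_vector_mult_scaleR Bp v_def)
    have Pz: "P *v z = z" unfolding zB matrix_vector_mul_assoc PB ..
    \<comment> \<open>Comparing a preimage of \<open>z\<close> with the interior vector
      \<open>p + q\<close> bounds a multiple of \<open>z\<close> by \<open>p\<close> in the cone
      order. If \<open>z\<close> or \<open>p + z\<close> were interior, so would be
      \<open>p\<close>.\<close>
    obtain k where k: "k > 0" "(p + q) - k *\<^sub>R (p + t0 *\<^sub>R y) \<in> C" using dominates[OF C] by blast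
    have "B *v ((p + q) - k *\<^sub>R (p + t0 *\<^sub>R y)) \<in> D" using BD k C_sub_D by blast
    also have "B *v ((p + q) - k *\<^sub>R (p + t0 *\<^sub>R y)) = p - k *\<^sub>R z"
      by (simp only: matrix_vector_right_distrib matrix_vector_mult_diff_distrib matrix_vector_mult_scaleR Bp Bq zB)
        simp
    finally have pz: "p - k *\<^sub>R z \<in> D" .
    have "z \<notin> C"
    proof
      assume "z \<in> C"
      then have "(p - k *\<^sub>R z) + k *\<^sub>R z \<in> C" using pz k by (intro add_DC scale_C)
      then show False using pD by simp
    qed
    then have "z \<in> bd" using zD wz by (auto simp: bd_def)
    have "p + z \<notin> C"
    proof
      assume "p + z \<in> C"
      then have "(p - k *\<^sub>R z) + k *\<^sub>R (p + z) \<in> C" using add_DC[OF pz scale_C[OF _ k(1)]] by blast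
      then have "(1 + k) *\<^sub>R p \<in> C" by (simp add: algebra_simps)
      then show False using pD k by (simp add: scale_C_iff)
    qed
    then have "z + q \<in> C" using half[OF \<open>z \<in> bd\<close>] by blast
    \<comment> \<open>\<open>z + q\<close> dominates a small multiple of \<open>p + q\<close>.
      Applying \<open>P\<close>, which fixes \<open>z\<close> and \<open>p\<close> and kills
      \<open>q\<close>, leaves \<open>z - h *\<^sub>R p\<close> in \<open>D\<close>; rescaled by
      \<open>1 / (1 - h)\<close>, it lies beyond \<open>t0\<close> in the direction
      \<open>v\<close>.\<close>
    then obtain h0 where h0: "h0 > 0" "(z + q) - h0 *\<^sub>R (p + q) \<in> C" using dominates by blast
    define h where "h = min h0 (1/2)"
    have h: "h > 0" "h < 1" "h \<le> h0" using h0 by (auto simp: h_def)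
    have "(z + q) - h0 *\<^sub>R (p + q) + (h0 - h) *\<^sub>R (p + q) \<in> D"
      using h(3) by (intro add_D[OF C_sub_D[OF h0(2)] scale_D[OF C_sub_D[OF C]]]) simp
    then have "(z + q) - h *\<^sub>R (p + q) \<in> D" by (simp add: algebra_simps)
    then have "P *v ((z + q) - h *\<^sub>R (p + q)) \<in> D" by (rule PD)
    also have "P *v ((z + q) - h *\<^sub>R (p + q)) = z - h *\<^sub>R p"
      by (simp add: matrix_vector_right_distrib matrix_vector_mult_diff_distrib matrix_vector_mult_scaleR Pz Pp Pq)
    finally have "(1 / (1 - h)) *\<^sub>R (z - h *\<^sub>R p) \<in> D" using h by (intro scale_D) auto
    also have "z - h *\<^sub>R p = (1 - h) *\<^sub>R p + t0 *\<^sub>R v" by (simp add: z_def algebra_simps)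
    also have "(1 / (1 - h)) *\<^sub>R ((1 - h) *\<^sub>R p + t0 *\<^sub>R v) = p + (t0 / (1 - h)) *\<^sub>R v"
      using h by (simp add: scaleR_add_right)
    finally have "t0 / (1 - h) \<le> t0" by (rule max)
    then have "h * t0 \<le> 0" using h by (simp add: field_simps)
    then show False using mult_pos_pos[OF h(1) \<open>t0 > 0\<close>] by simp
  qed
  obtain \<mu> where \<mu>: "B = outer p \<mu>" using eq_outer[OF im] by blast
  have "\<mu> \<noteq> 0" using Bp pD by (auto simp: \<mu> outer_vector)
  then show thesis using B \<mu> by (intro that[of \<mu> r]) (simp_all add: o_def T_def)
qed

end

lemma subgroup_SL_closed:
  assumes "subgroup \<Gamma> SL"
  shows "\<Gamma> \<subseteq> carrier SL" "mat 1 \<in> \<Gamma>" "x \<in> \<Gamma> \<Longrightarrow> y \<in> \<Gamma> \<Longrightarrow> x ** y \<in> \<Gamma>"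
    "x \<in> \<Gamma> \<Longrightarrow> x ** y = mat 1 \<Longrightarrow> y \<in> \<Gamma>"
proof -
  show sub: "\<Gamma> \<subseteq> carrier SL" using subgroup.subset[OF assms] .
  show "mat 1 \<in> \<Gamma>" using subgroup.one_closed[OF assms] by (simp add: SL_def)
  show mult: "x ** y \<in> \<Gamma>" if "x \<in> \<Gamma>" "y \<in> \<Gamma>" for x y
    using subgroup.m_closed[OF assms that] by (simp add: SL_def)
  assume x: "x \<in> \<Gamma>" and xy: "x ** y = mat 1"
  let ?i = "inv\<^bsub>SL\<^esub> x"
  have i: "?i \<in> \<Gamma>" using subgroup.m_inv_closed[OF assms x] .
  have "?i ** x = mat 1" using group.l_inv[OF group_SL, of x] x sub by (auto simp: SL_def)
  then have "y = ?i ** (x ** y)" by (simp add: matrix_mul_assoc)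
  then show "y \<in> \<Gamma>" using i xy by simp
qed

lemma mat_power_closed:
  assumes "subgroup \<Gamma> SL" "A \<in> \<Gamma>" shows "mat_power A n \<in> \<Gamma>"
  by (induction n) (simp_all add: mat_power_simps subgroup_SL_closed[OF assms(1)] assms(2))

section \<open>From a rank one isometry to a rank one geodesic\<close>

locale ordered_vec_domain = vec_domain C w M \<Omega>
  for C :: "(real^('n::{finite,linorder})) set" and w M \<Omega>
begin

text \<open>With a single index \<open>index2\<close> would degenerate; the independence of a
  boundary pair rules this out.\<close>

lemma two_indices:
  assumes "p \<in> bd" "q \<in> bd" "p + q \<in> C"
  obtains i :: 'n where "i \<noteq> index1"
proof -
  have "\<exists>i :: 'n. i \<noteq> index1"
  proof (rule ccontr)
    assume "\<not> ?thesis"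
    then have eq: "i = index1" for i :: 'n by blast
    have "(q $ index1) *\<^sub>R p + (- (p $ index1)) *\<^sub>R q = 0"
      unfolding vec_eq_iff
    proof
      fix i :: 'n
      show "((q $ index1) *\<^sub>R p + (- (p $ index1)) *\<^sub>R q) $ i = 0 $ i" by (simp add: eq[of i])
    qed
    then have "q $ index1 = 0" using bd_pair_independent[OF assms] by blast
    then have "q $ i = 0" for i using eq[of i] by simp
    then have "q = 0" by (simp add: vec_eq_iff)
    then show False using assms by (simp add: bd_def)
  qed
  then show thesis using that by blast
qed

lemma attracting_eigenvector_proximal:
  assumes \<Gamma>: "subgroup \<Gamma> SL" and A: "A \<in> \<Gamma>"
    and aut: "cone_aut A A'" and p: "p \<in> bd" and q: "q \<in> bd" and C: "p + q \<in> C"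
    and half: "\<And>z. z \<in> bd \<Longrightarrow> p + z \<in> C \<or> z + q \<in> C"
    and ev: "A *v p = l *\<^sub>R p" "A *v q = m *\<^sub>R q" "0 < m" "m < l"
  shows "proj p \<in> proximal_limit_set \<Gamma>"
proof -
  obtain r :: "nat \<Rightarrow> nat" and \<mu> where r: "\<mu> \<noteq> 0"
      "(\<lambda>n. (1 / l ^ r n) *\<^sub>R mat_power A (r n)) \<longlonglongrightarrow> outer p \<mu>"
    using power_limit_rank_one[OF aut p q C half ev] by metis
  obtain i :: 'n where i: "i \<noteq> index1" using two_indices[OF p q C] by blast
  show ?thesis
  proof (rule rank_one_limit_proximal[OF i _ _ _ r(2) _ r(1)])
    show "mat_power A (r n) \<in> \<Gamma>" for n using mat_power_closed[OF \<Gamma> A] .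
    then show "mat_power A (r n) \<in> carrier SL" for n using subgroup_SL_closed(1)[OF \<Gamma>] by blast
    show "1 / l ^ r n > 0" for n using ev by simp
    show "p \<noteq> 0" using p by (simp add: bd_def)
  qed
qed

lemma rank_one_geometry_imp_geodesic:
  assumes \<Gamma>: "subgroup \<Gamma> SL" and Aut: "\<Gamma> \<subseteq> Aut \<Omega>" and rank: "rank_one_hilbert_geometry \<Omega> \<Gamma>"
  shows "\<exists>a b. rank_one_geodesic \<Omega> a b \<and> a \<in> proximal_limit_set \<Gamma> \<inter> frontier \<Omega> \<and>
           b \<in> proximal_limit_set \<Gamma> \<inter> frontier \<Omega>"
proof -
  obtain g where g: "g \<in> \<Gamma>" "rank_one_isometry \<Omega> g"
    using rank by (auto simp: rank_one_hilbert_geometry_def)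
  obtain e :: real and B where e: "e = 1 \<or> e = -1" "cone_aut (e *\<^sub>R g) B"
    using Aut_cone_aut[of g] g(1) Aut by blast
  have e0: "e \<noteq> 0" using e by auto
  obtain p q l m where pq: "p \<in> bd" "q \<in> bd" "p + q \<in> C" "\<And>z. z \<in> bd \<Longrightarrow> p + z \<in> C \<or> z + q \<in> C"
    and lm: "l > 0" "m > 0" "l \<noteq> m" "(e *\<^sub>R g) *v p = l *\<^sub>R p" "(e *\<^sub>R g) *v q = m *\<^sub>R q"
    using rank_one_isometry_end_points[OF g(2) e(2) e0] by blast
  \<comment> \<open>Squaring removes the sign \<open>e\<close>: the square preserves the cone and is
    itself an element of the group.\<close>
  let ?A = "(e *\<^sub>R g) ** (e *\<^sub>R g)" and ?B = "B ** B"
  have "?A = (e * e) *\<^sub>R (g ** g)" by (rule matrix_scaleR_mult)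
  also have "e * e = 1" using e by auto
  finally have "?A = g ** g" by simp
  then have A\<Gamma>: "?A \<in> \<Gamma>" using subgroup_SL_closed(3)[OF \<Gamma> g(1) g(1)] by simp
  have aut: "cone_aut ?A ?B" using cone_aut_mult[OF e(2) e(2)] .
  then have B\<Gamma>: "?B \<in> \<Gamma>" using subgroup_SL_closed(4)[OF \<Gamma> A\<Gamma>] by (simp add: cone_aut_def)
  have A_ev: "?A *v p = (l * l) *\<^sub>R p" "?A *v q = (m * m) *\<^sub>R q"
    using lm by (simp_all add: matrix_vector_mul_assoc[symmetric] matrix_vector_mult_scaleR)
  have B_ev: "?B *v v = (1 / t) *\<^sub>R v" if "?A *v v = t *\<^sub>R v" "t > 0" for v t
  proof -
    have "t *\<^sub>R (?B *v v) = v"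
      using cone_aut_inverse[OF cone_aut_sym[OF aut], of v] unfolding that(1) matrix_vector_mult_scaleR .
    then have "(1/t) *\<^sub>R (t *\<^sub>R (?B *v v)) = (1/t) *\<^sub>R v" by simp
    then show ?thesis using that(2) by simp
  qed
  have main: "proj p \<in> proximal_limit_set \<Gamma> \<and> proj q \<in> proximal_limit_set \<Gamma>"
    if pq: "p \<in> bd" "q \<in> bd" "p + q \<in> C" "\<And>z. z \<in> bd \<Longrightarrow> p + z \<in> C \<or> z + q \<in> C"
      and ev: "?A *v p = a *\<^sub>R p" "?A *v q = b *\<^sub>R q" "0 < b" "b < a" for p q a b
  proof
    show "proj p \<in> proximal_limit_set \<Gamma>"
      by (rule attracting_eigenvector_proximal[OF \<Gamma> A\<Gamma> aut pq ev])
    have C': "q + p \<in> C" and half': "q + z \<in> C \<or> z + p \<in> C" if "z \<in> bd" for z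
      using pq(3) pq(4)[OF that] by (auto simp: add.commute)
    show "proj q \<in> proximal_limit_set \<Gamma>"
    proof (rule attracting_eigenvector_proximal[OF \<Gamma> B\<Gamma> cone_aut_sym[OF aut] pq(2,1) _ half'])
      show "?B *v q = (1 / b) *\<^sub>R q" "?B *v p = (1 / a) *\<^sub>R p" using B_ev ev by auto
      show "0 < 1 / a" "1 / a < 1 / b" using ev by (auto intro: divide_strict_left_mono)
      show "q + p \<in> C" using pq(3) by (simp add: add.commute)
    qed
  qed
  have "proj p \<in> proximal_limit_set \<Gamma> \<and> proj q \<in> proximal_limit_set \<Gamma>"
  proof (cases "m < l")
    case True
    then have "m * m < l * l" using lm by (intro mult_strict_mono) auto
    then show ?thesis using main[OF pq A_ev] lm by simp
  next
    case False
    then have "l * l < m * m" using lm by (intro mult_strict_mono) auto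
    moreover have "q + p \<in> C" using pq(3) by (simp add: add.commute)
    moreover have "q + z \<in> C \<or> z + p \<in> C" if "z \<in> bd" for z using pq(4)[OF that] by (auto simp: add.commute)
    ultimately show ?thesis using main[OF pq(2,1) _ _ A_ev(2,1)] lm by simp
  qed
  moreover have "rank_one_geodesic \<Omega> (proj p) (proj q)" using rank_one_geodesic_proj_iff pq by blast
  ultimately show ?thesis using bd_frontier pq by blast
qed

end

section \<open>Generic elements of a Zariski dense subset\<close>

text \<open>Finitely many hyperplanes form a null set.\<close>

lemma exists_avoiding_hyperplanes:
  fixes A :: "'a::euclidean_space set"
  assumes "finite A" "0 \<notin> A"
  obtains w where "\<And>a. a \<in> A \<Longrightarrow> a \<bullet> w \<noteq> 0"
proof -
  have "negligible (\<Union>a\<in>A. {x. a \<bullet> x = 0})"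
    using assms by (intro negligible_Union) (auto intro!: negligible_hyperplane)
  then have "(\<Union>a\<in>A. {x. a \<bullet> x = 0}) \<noteq> UNIV" by (metis non_negligible_UNIV)
  then show thesis using that by blast
qed

text \<open>A transvection only if \<open>\<theta> \<bullet> w = 0\<close>. The same formula with
  \<open>\<theta> = w\<close> also gives the reflection used for the determinant.\<close>

definition transvection :: "real^'n \<Rightarrow> real^'n \<Rightarrow> real \<Rightarrow> real^'n^'n" where
  "transvection w \<theta> s = mat 1 + s *\<^sub>R outer w \<theta>"

lemma transvection_vector: "transvection w \<theta> s *v v = v + (s * (\<theta> \<bullet> v)) *\<^sub>R w"
  by (simp add: transvection_def matrix_vector_mult_add_rdistrib matrix_vector_scaleR_left outer_vector)

lemma transvection_compose:
  assumes "\<theta> \<bullet> w = 0"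
  shows "transvection w \<theta> s ** transvection w \<theta> t = transvection w \<theta> (s + t)"
  unfolding matrix_eq
  by (simp add: matrix_vector_mul_assoc[symmetric] transvection_vector assms inner_add_right algebra_simps)

lemma transvection_zero: "transvection w \<theta> 0 = mat 1"
  by (simp add: transvection_def)

text \<open>The reflection along \<open>w\<close> conjugates a transvection to its inverse, so its determinant is
  \<open>\<plusminus>1\<close>; it is also a square.\<close>

lemma det_transvection:
  fixes w \<theta> :: "real^'n"
  assumes orth: "\<theta> \<bullet> w = 0"
  shows "det (transvection w \<theta> s) = 1"
proof (cases "w = 0")
  case True
  then have "transvection w \<theta> s = mat 1" by (simp add: transvection_def outer_def vec_eq_iff)
  then show ?thesis by simp
next
  case False
  define R where "R = transvection w w (- 2 / (w \<bullet> w))"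
  have Rv: "R *v v = v - (2 * (w \<bullet> v) / (w \<bullet> w)) *\<^sub>R w" for v
    by (simp add: R_def transvection_vector)
  have wR: "w \<bullet> (R *v v) = - (w \<bullet> v)" for v using False by (simp add: Rv inner_diff_right)
  have "R *v (R *v v) = v" for v unfolding Rv[of "R *v v"] wR by (simp add: Rv[of v])
  then have "R ** R = mat 1" by (simp add: matrix_eq matrix_vector_mul_assoc[symmetric])
  then have detR: "det R \<noteq> 0" by (metis det_I det_mul mult_zero_left zero_neq_one)
  have Rw: "R *v w = - w"
  proof -
    have "R *v w = w - 2 *\<^sub>R w" using False by (simp add: Rv)
    then show ?thesis by (simp add: scaleR_2)
  qed
  have \<theta>R: "\<theta> \<bullet> (R *v v) = \<theta> \<bullet> v" for v using orth by (simp add: Rv inner_diff_right)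
  have "R *v (transvection w \<theta> s *v v) = transvection w \<theta> (- s) *v (R *v v)" for v
    by (simp add: transvection_vector matrix_vector_right_distrib matrix_vector_mult_scaleR Rw \<theta>R)
  then have "R ** transvection w \<theta> s = transvection w \<theta> (- s) ** R"
    by (simp add: matrix_eq matrix_vector_mul_assoc[symmetric])
  then have "det (transvection w \<theta> (- s)) = det (transvection w \<theta> s)"
    using detR by (metis det_mul mult.commute mult_cancel_left)
  moreover have "det (transvection w \<theta> s) * det (transvection w \<theta> (- s)) = 1"
    by (simp add: det_mul[symmetric] transvection_compose[OF orth] transvection_zero)
  ultimately have "(det (transvection w \<theta> s))\<^sup>2 = 1" by (simp add: power2_eq_square)
  moreover have "det (transvection w \<theta> s) = (det (transvection w \<theta> (s/2)))\<^sup>2"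
    by (simp add: power2_eq_square det_mul[symmetric] transvection_compose[OF orth])
  then have "det (transvection w \<theta> s) \<ge> 0" by simp
  ultimately show ?thesis by (auto simp: power2_eq_1_iff)
qed

lemma exists_orthogonal:
  fixes y :: "real^'n"
  assumes "(i :: 'n) \<noteq> j"
  obtains z :: "real^'n" where "z \<noteq> 0" "z \<bullet> y = 0"
proof (cases "y $ j = 0")
  case True
  then show thesis using that[of "axis j 1"] by (simp add: inner_axis' axis_eq_0_iff)
next
  case False
  let ?z = "(y $ j) *\<^sub>R axis i 1 - (y $ i) *\<^sub>R axis j 1 :: real^'n"
  have "?z $ i = y $ j" using assms by (simp add: axis_def)
  then have "?z \<noteq> 0" using False by (metis zero_index)
  moreover have "?z \<bullet> y = 0" by (simp add: inner_diff_left inner_axis')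
  ultimately show thesis by (rule that)
qed

text \<open>Along a one-parameter group of transvections both conditions are affine in
  \<open>s\<close>. The vectors \<open>w\<close> and \<open>\<theta>\<close> are chosen so that
  neither is constant, and then only the two values \<open>s1\<close> and \<open>s2\<close> must be
  avoided.\<close>

lemma transvection_witness:
  fixes \<phi> \<psi> y1 y2 :: "real^'n"
  assumes ij: "(i :: 'n) \<noteq> j" and nz: "\<phi> \<noteq> 0" "\<psi> \<noteq> 0" "y1 \<noteq> 0" "y2 \<noteq> 0"
  obtains g h where "det g = 1" "g ** h = mat 1" "\<phi> \<bullet> (g *v y2) \<noteq> 0" "\<psi> \<bullet> (h *v y1) \<noteq> 0"
proof -
  \<comment> \<open>A vector \<open>w\<close> not orthogonal to \<open>z1\<close> and
    \<open>z2\<close> cannot be parallel to \<open>y1\<close> or \<open>y2\<close>, so the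
    projections of these along \<open>w\<close> are nonzero.\<close>
  obtain z1 z2 where z: "z1 \<noteq> 0" "z1 \<bullet> y1 = 0" "z2 \<noteq> 0" "z2 \<bullet> y2 = 0"
    using exists_orthogonal[OF ij, of y1] exists_orthogonal[OF ij, of y2] by metis
  obtain w where w: "\<And>a. a \<in> {\<phi>, \<psi>, z1, z2} \<Longrightarrow> a \<bullet> w \<noteq> 0"
    using exists_avoiding_hyperplanes[of "{\<phi>, \<psi>, z1, z2}"] nz z by blast
  have w0: "w \<noteq> 0" using w[of \<phi>] by auto
  define r where "r y = y - ((y \<bullet> w) / (w \<bullet> w)) *\<^sub>R w" for y
  have r0: "r y \<noteq> 0" if "y \<noteq> 0" "z' \<bullet> y = 0" "z' \<bullet> w \<noteq> 0" for y z'
  proof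
    assume "r y = 0"
    then have y: "y = ((y \<bullet> w) / (w \<bullet> w)) *\<^sub>R w" by (simp add: r_def)
    then have "z' \<bullet> y = ((y \<bullet> w) / (w \<bullet> w)) * (z' \<bullet> w)" by (metis inner_scaleR_right)
    then have "(y \<bullet> w) / (w \<bullet> w) = 0" using that by simp
    then have "y = 0" using y by (metis scaleR_zero_left)
    then show False using that by simp
  qed
  have "r y1 \<noteq> 0" "r y2 \<noteq> 0" using r0[OF nz(3) z(2)] r0[OF nz(4) z(4)] w by auto
  then obtain \<xi> where \<xi>: "r y1 \<bullet> \<xi> \<noteq> 0" "r y2 \<bullet> \<xi> \<noteq> 0"
    using exists_avoiding_hyperplanes[of "{r y1, r y2}"] by (metis finite.emptyI finite_insert insert_iff empty_iff)
  \<comment> \<open>\<open>r\<close> is the orthogonal projection along \<open>w\<close> and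
    self-adjoint, so \<open>\<theta>\<close> is orthogonal to \<open>w\<close> and pairs with
    \<open>y1\<close> and \<open>y2\<close> as \<open>\<xi>\<close> does with their
    projections.\<close>
  define \<theta> where "\<theta> = r \<xi>"
  have \<theta>w: "\<theta> \<bullet> w = 0" using w0 by (simp add: \<theta>_def r_def inner_diff_left)
  have \<theta>y: "\<theta> \<bullet> y = r y \<bullet> \<xi>" for y
    by (simp add: \<theta>_def r_def inner_diff_left inner_commute[of y w] inner_commute[of y \<xi>] inner_commute[of w \<xi>])
  define s1 s2 where "s1 = - (\<phi> \<bullet> y2) / ((\<theta> \<bullet> y2) * (\<phi> \<bullet> w))" and "s2 = (\<psi> \<bullet> y1) / ((\<theta> \<bullet> y1) * (\<psi> \<bullet> w))"
  obtain s where s: "s \<noteq> s1" "s \<noteq> s2"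
    using ex_new_if_finite[OF infinite_UNIV_char_0, of "{s1, s2}"] by auto
  have 1: "\<phi> \<bullet> (transvection w \<theta> s *v y2) \<noteq> 0"
  proof
    have nzd: "(\<theta> \<bullet> y2) * (\<phi> \<bullet> w) \<noteq> 0" using w \<xi> \<theta>y by auto
    assume "\<phi> \<bullet> (transvection w \<theta> s *v y2) = 0"
    then have "s * ((\<theta> \<bullet> y2) * (\<phi> \<bullet> w)) = - (\<phi> \<bullet> y2)"
      by (simp add: transvection_vector inner_add_right algebra_simps)
    then have "s = s1" unfolding s1_def using nzd by (metis nonzero_mult_div_cancel_right)
    then show False using s by simp
  qed
  have 2: "\<psi> \<bullet> (transvection w \<theta> (- s) *v y1) \<noteq> 0"
  proof
    have nzd: "(\<theta> \<bullet> y1) * (\<psi> \<bullet> w) \<noteq> 0" using w \<xi> \<theta>y by auto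
    assume "\<psi> \<bullet> (transvection w \<theta> (- s) *v y1) = 0"
    then have "s * ((\<theta> \<bullet> y1) * (\<psi> \<bullet> w)) = \<psi> \<bullet> y1"
      by (simp add: transvection_vector inner_diff_right algebra_simps)
    then have "s = s2" unfolding s2_def using nzd by (metis nonzero_mult_div_cancel_right)
    then show False using s by simp
  qed
  show thesis
    using that[OF det_transvection[OF \<theta>w] _ 1 2] by (simp add: transvection_compose[OF \<theta>w] transvection_zero)
qed

lemma real_polynomial_function_entry: "real_polynomial_function (\<lambda>g :: real^'n^'m. g $ i $ j)"
  by (intro real_polynomial_function.intros(1) bounded_linear_compose[OF bounded_linear_vec_nth bounded_linear_vec_nth])

text \<open>The product of the two conditions is a single polynomial. By
  \<open>transvection_witness\<close> it does not vanish on all of \<open>SL\<close>, hence not on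
  all of the dense set.\<close>

lemma zariski_dense_generic:
  fixes \<phi> \<psi> y1 y2 :: "real^'n" and \<Gamma> :: "(real^'n^'n) set"
  assumes dense: "zariski_dense_in \<Gamma> (carrier SL)" and ij: "(i :: 'n) \<noteq> j"
    and nz: "\<phi> \<noteq> 0" "\<psi> \<noteq> 0" "y1 \<noteq> 0" "y2 \<noteq> 0"
  obtains g where "g \<in> \<Gamma>" "\<phi> \<bullet> (g *v y2) \<noteq> 0" "\<And>h. g ** h = mat 1 \<Longrightarrow> \<psi> \<bullet> (h *v y1) \<noteq> 0"
proof -
  define P where "P g = \<phi> \<bullet> (g *v y2)" for g :: "real^'n^'n"
  \<comment> \<open>Cramer's rule, so that \<open>Q g\<close> is \<open>\<psi> \<bullet> (g\<inverse> *v y1)\<close> on \<open>SL\<close>.\<close>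
  define Q where "Q g = (\<Sum>k\<in>UNIV. \<psi> $ k * det (\<chi> i j. if j = k then y1 $ i else g $ i $ j))" for g :: "real^'n^'n"
  have Q_eq: "Q g = \<psi> \<bullet> (h *v y1)" if "det g = 1" "g ** h = mat 1" for g h
  proof -
    have "g *v (h *v y1) = y1" using that by (simp add: matrix_vector_mul_assoc)
    then have "h *v y1 = (\<chi> k. det (\<chi> i j. if j = k then y1 $ i else g $ i $ j) / det g)"
      using cramer[of g "h *v y1" y1] that by simp
    then show ?thesis using that by (simp add: Q_def inner_vec_def)
  qed
  have "real_polynomial_function P"
    unfolding P_def inner_vec_def matrix_vector_mult_def
    by (auto intro!: real_polynomial_function_sum real_polynomial_function.intros(4) real_polynomial_function_entry
        real_polynomial_function.intros(2))
  moreover have "real_polynomial_function Q"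
  proof -
    have entry: "real_polynomial_function (\<lambda>g :: real^'n^'n. (\<chi> i j. if j = k then y1 $ i else g $ i $ j) $ a $ b)" for k a b
      by (cases "b = k") (auto intro: real_polynomial_function_entry real_polynomial_function.intros(2))
    show ?thesis
      unfolding Q_def det_def
      by (intro real_polynomial_function_sum real_polynomial_function_prod real_polynomial_function.intros(4)
          real_polynomial_function.intros(2) entry finite_class.finite_UNIV finite_permutations)
  qed
  ultimately have PQ: "real_polynomial_function (\<lambda>g. P g * Q g)" by (rule real_polynomial_function.intros(4))
  have "\<exists>g\<in>\<Gamma>. P g * Q g \<noteq> 0"
  proof (rule ccontr)
    assume "\<not> ?thesis"
    then have "\<Gamma> \<subseteq> {g. P g * Q g = 0}" by auto
    moreover have "zariski_closed {g. P g * Q g = 0}"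
      unfolding zariski_closed_def using PQ by (intro exI[of _ "{\<lambda>g. P g * Q g}"]) auto
    moreover have "\<And>Z. zariski_closed Z \<Longrightarrow> \<Gamma> \<subseteq> Z \<Longrightarrow> carrier SL \<subseteq> Z"
      using dense unfolding zariski_dense_in_def by auto
    ultimately have sub: "carrier SL \<subseteq> {g. P g * Q g = 0}" by simp
    obtain g h where g: "det g = 1" "g ** h = mat 1" "\<phi> \<bullet> (g *v y2) \<noteq> 0" "\<psi> \<bullet> (h *v y1) \<noteq> 0"
      using transvection_witness[OF ij nz] by metis
    then have "P g * Q g \<noteq> 0" using Q_eq[OF g(1,2)] by (simp add: P_def)
    moreover have "g \<in> carrier SL" using g by (simp add: SL_def)
    ultimately show False using sub by blast
  qed
  then obtain g where g: "g \<in> \<Gamma>" "P g \<noteq> 0" "Q g \<noteq> 0" by auto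
  moreover have "det g = 1" using g(1) dense by (auto simp: zariski_dense_in_def SL_def)
  ultimately have "\<phi> \<bullet> (g *v y2) \<noteq> 0" "\<psi> \<bullet> (h *v y1) \<noteq> 0" if "g ** h = mat 1" for h
    using Q_eq[of g h] that by (auto simp: P_def)
  then show thesis using that[of g] g by (simp add: P_def)
qed

section \<open>Rank one isometries near a rank one geodesic\<close>

lemma norm_matrix_vector_le:
  fixes A :: "real^'n^'m"
  shows "norm (A *v x) \<le> norm A * norm x"
proof -
  have "norm ((A *v x) $ i) \<le> norm (A $ i) * norm x" for i
    using Cauchy_Schwarz_ineq2[of "A $ i" x]
    by (simp add: matrix_vector_mult_def inner_vec_def)
  then have "norm (A *v x) \<le> L2_set (\<lambda>i. norm (A $ i) * norm x) UNIV"
    unfolding norm_vec_def[of "A *v x"] by (intro L2_set_mono) auto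
  then show ?thesis by (simp add: L2_set_left_distrib norm_vec_def[of A])
qed

context vec_domain
begin

text \<open>The error \<open>E n\<close> of the limit tends to 0 uniformly on the slice. Subtracting
  from \<open>E n *v x n\<close> the multiple of \<open>u\<close> with the same value of
  \<open>w\<close> eliminates the unknown coefficient \<open>\<mu> \<bullet> x n\<close> and leaves
  \<open>(s n * l n) *\<^sub>R (x n - u)\<close>; the lower bound on \<open>s n * l n\<close> allows
  division.\<close>

lemma eigenvector_limit:
  assumes lim: "(\<lambda>n. s n *\<^sub>R G n) \<longlonglongrightarrow> outer u \<mu>" and u: "w \<bullet> u = 1" and c: "c > 0"
    and x: "\<And>n. x n \<in> D" "\<And>n. w \<bullet> x n = 1" "\<And>n. G n *v x n = l n *\<^sub>R x n" "\<And>n. s n * l n \<ge> c"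
  shows "x \<longlonglongrightarrow> u"
proof -
  define E where "E n = s n *\<^sub>R G n - outer u \<mu>" for n
  have "E \<longlonglongrightarrow> outer u \<mu> - outer u \<mu>" unfolding E_def by (intro tendsto_diff lim tendsto_const)
  then have E0: "E \<longlonglongrightarrow> 0" by simp
  have Ex: "E n *v x n = (s n * l n) *\<^sub>R x n - (\<mu> \<bullet> x n) *\<^sub>R u" for n
    by (simp add: E_def matrix_vector_mult_diff_rdistrib matrix_vector_scaleR_left x outer_vector)
  have "(\<lambda>n. norm (E n) * M) \<longlonglongrightarrow> norm (0 :: real^'n^'n) * M" by (intro tendsto_intros E0)
  then have bound0: "(\<lambda>n. norm (E n) * M) \<longlonglongrightarrow> 0" by simp
  have "norm (E n *v x n) \<le> norm (E n) * M" for n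
  proof -
    have "norm (E n *v x n) \<le> norm (E n) * norm (x n)" by (rule norm_matrix_vector_le)
    also have "\<dots> \<le> norm (E n) * M" using bound_D[OF x(1), of n] x(2)[of n] by (intro mult_left_mono) auto
    finally show ?thesis .
  qed
  then have lim_Ex: "(\<lambda>n. E n *v x n) \<longlonglongrightarrow> 0"
    by (intro Lim_null_comparison[OF _ bound0] always_eventually allI)
  define y where "y n = E n *v x n - (w \<bullet> (E n *v x n)) *\<^sub>R u" for n
  have "y \<longlonglongrightarrow> 0 - (w \<bullet> 0) *\<^sub>R u" unfolding y_def by (intro tendsto_intros lim_Ex)
  then have y0: "y \<longlonglongrightarrow> 0" by simp
  have y: "y n = (s n * l n) *\<^sub>R (x n - u)" for n
    unfolding y_def Ex by (simp add: inner_diff_right x(2) u algebra_simps)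
  have "norm (x n - u) \<le> norm (y n) / c" for n
  proof -
    have "c * norm (x n - u) \<le> \<bar>s n * l n\<bar> * norm (x n - u)" using x(4)[of n] by (intro mult_right_mono) auto
    also have "\<dots> = norm (y n)" by (simp only: y norm_scaleR)
    finally show ?thesis using c by (simp add: field_simps)
  qed
  moreover have "(\<lambda>n. norm (y n) / c) \<longlonglongrightarrow> norm (0 :: real^'n) / c" using c by (intro tendsto_intros y0) auto
  ultimately have "(\<lambda>n. x n - u) \<longlonglongrightarrow> 0"
    by (intro Lim_null_comparison[of "\<lambda>n. x n - u" "\<lambda>n. norm (y n) / c"] always_eventually allI) auto
  then show ?thesis by (simp add: LIM_zero_iff)
qed

text \<open>After rescaling, \<open>G n\<close> is uniformly close to \<open>x \<mapsto> (\<mu> \<bullet> x) u\<close>, so its projective action maps the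
  slice \<open>\<mu> \<bullet> x \<ge> c\<close> into itself and Brouwer's theorem applies. The bound on \<open>s n * l\<close> is what makes
  these eigenvectors converge to \<open>u\<close>.\<close>

lemma eigenvector_exists:
  assumes aut: "\<And>n. cone_aut (G n) (G' n)" and s: "\<And>n. s n > 0"
    and lim: "(\<lambda>n. s n *\<^sub>R G n) \<longlonglongrightarrow> outer u \<mu>"
    and u: "u \<in> D" "w \<bullet> u = 1" "\<mu> \<bullet> u > 0"
  obtains c where "c > 0"
    "eventually (\<lambda>n. \<exists>x l. x \<in> D \<and> w \<bullet> x = 1 \<and> G n *v x = l *\<^sub>R x \<and> s n * l \<ge> c) sequentially"
proof -
  \<comment> \<open>The limit map sends the slice to the line of \<open>u\<close>, where
    \<open>\<mu>\<close> takes the value \<open>2 * c\<close> on the slice; half of it leaves a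
    margin for the error.\<close>
  define c where "c = (\<mu> \<bullet> u) / 2"
  have c: "c > 0" using u by (simp add: c_def)
  define K where "K = {x \<in> D. w \<bullet> x = 1} \<inter> {x. c \<le> \<mu> \<bullet> x}"
  have K: "compact K" "convex K" "u \<in> K"
  proof -
    show "compact K" unfolding K_def by (intro compact_Int_closed compact_slice closed_halfspace_ge)
    have "{x \<in> D. w \<bullet> x = 1} = D \<inter> {x. w \<bullet> x = 1}" by auto
    then show "convex K" unfolding K_def
      by (simp add: convex_Int convex_closure convex_C convex_hyperplane convex_halfspace_ge)
    show "u \<in> K" using u by (simp add: K_def c_def)
  qed
  define E where "E n = s n *\<^sub>R G n - outer u \<mu>" for n
  have "E \<longlonglongrightarrow> outer u \<mu> - outer u \<mu>" unfolding E_def by (intro tendsto_diff lim tendsto_const)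
  then have E0: "E \<longlonglongrightarrow> 0" by simp
  define \<epsilon> where "\<epsilon> n = norm (E n) * M" for n
  have "\<epsilon> \<longlonglongrightarrow> norm (0 :: real^'n^'n) * M" unfolding \<epsilon>_def by (intro tendsto_intros E0)
  then have \<epsilon>0: "\<epsilon> \<longlonglongrightarrow> 0" by simp
  have lim1: "(\<lambda>n. (norm \<mu> + c * norm w) * \<epsilon> n) \<longlonglongrightarrow> (norm \<mu> + c * norm w) * 0"
    and lim2: "(\<lambda>n. norm w * \<epsilon> n) \<longlonglongrightarrow> norm w * 0" by (intro tendsto_intros \<epsilon>0)+
  \<comment> \<open>The first bound makes the slice invariant, as
    \<open>c * (\<mu> \<bullet> x)\<close> is at least \<open>c * c\<close> there. The second keeps
    \<open>s n * l\<close> above \<open>c / 2\<close>.\<close>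
  have "eventually (\<lambda>n. (norm \<mu> + c * norm w) * \<epsilon> n < c * c) sequentially"
    by (rule order_tendstoD(2)[OF lim1]) (simp add: c)
  moreover have "eventually (\<lambda>n. norm w * \<epsilon> n < c / 2) sequentially"
    by (rule order_tendstoD(2)[OF lim2]) (simp add: c)
  ultimately have "eventually (\<lambda>n. \<exists>x l. x \<in> D \<and> w \<bullet> x = 1 \<and> G n *v x = l *\<^sub>R x \<and> s n * l \<ge> c / 2) sequentially"
  proof eventually_elim
    case (elim n)
    have Gx: "w \<bullet> (G n *v x) > 0" "G n *v x \<in> D" if "x \<in> K" for x
    proof -
      have "x \<in> D" "x \<noteq> 0" using that by (auto simp: K_def)
      then show "G n *v x \<in> D" "w \<bullet> (G n *v x) > 0"
        using cone_aut_D[OF aut] cone_aut_nonzero[OF aut] pos_D by auto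
    qed
    have split: "s n *\<^sub>R (G n *v x) = (\<mu> \<bullet> x) *\<^sub>R u + E n *v x" for x
      by (simp add: E_def matrix_vector_mult_diff_rdistrib matrix_vector_scaleR_left outer_vector)
    have small: "norm (E n *v x) \<le> \<epsilon> n" if "x \<in> K" for x
    proof -
      have "norm (E n *v x) \<le> norm (E n) * norm x" by (rule norm_matrix_vector_le)
      also have "\<dots> \<le> norm (E n) * M" using bound_D[of x] that by (intro mult_left_mono) (auto simp: K_def)
      finally show ?thesis by (simp add: \<epsilon>_def)
    qed
    have wE: "\<bar>v \<bullet> (E n *v x)\<bar> \<le> norm v * \<epsilon> n" if "x \<in> K" for v x
      using Cauchy_Schwarz_ineq2[of v "E n *v x"] mult_left_mono[OF small[OF that], of "norm v"] by simp
    define f where "f x = (1 / (w \<bullet> (G n *v x))) *\<^sub>R (G n *v x)" for x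
    have "f ` K \<subseteq> K"
    proof (intro image_subsetI)
      fix x assume x: "x \<in> K"
      have fD: "f x \<in> D" using Gx[OF x] by (simp add: f_def scale_D)
      have fw: "w \<bullet> f x = 1" using Gx[OF x] by (simp add: f_def)
      have mx: "\<mu> \<bullet> x \<ge> c" using x by (simp add: K_def)
      have "s n * (\<mu> \<bullet> (G n *v x)) = (\<mu> \<bullet> x) * (\<mu> \<bullet> u) + \<mu> \<bullet> (E n *v x)"
        using arg_cong[OF split, of "\<lambda>y. \<mu> \<bullet> y" x] by (simp add: inner_add_right)
      then have num: "s n * (\<mu> \<bullet> (G n *v x)) \<ge> (\<mu> \<bullet> x) * (2 * c) - norm \<mu> * \<epsilon> n"
        using wE[OF x, of \<mu>] by (simp add: c_def)
      have "s n * (w \<bullet> (G n *v x)) = (\<mu> \<bullet> x) + w \<bullet> (E n *v x)"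
        using arg_cong[OF split, of "\<lambda>y. w \<bullet> y" x] u by (simp add: inner_add_right)
      then have "s n * (w \<bullet> (G n *v x)) \<le> (\<mu> \<bullet> x) + norm w * \<epsilon> n" using wE[OF x, of w] by simp
      then have "c * (s n * (w \<bullet> (G n *v x))) \<le> c * ((\<mu> \<bullet> x) + norm w * \<epsilon> n)" using c by simp
      also have "\<dots> \<le> (\<mu> \<bullet> x) * (2 * c) - norm \<mu> * \<epsilon> n"
      proof -
        have "c * c \<le> c * (\<mu> \<bullet> x)" using mx c by simp
        then show ?thesis using elim(1) by (simp add: algebra_simps)
      qed
      also note num
      finally have "s n * (c * (w \<bullet> (G n *v x))) \<le> s n * (\<mu> \<bullet> (G n *v x))" by (simp add: algebra_simps)
      then have "c * (w \<bullet> (G n *v x)) \<le> \<mu> \<bullet> (G n *v x)" using s[of n] by simp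
      then have "c \<le> \<mu> \<bullet> f x" using Gx[OF x] by (simp add: f_def field_simps)
      then show "f x \<in> K" using fD fw by (simp add: K_def)
    qed
    moreover have "continuous_on K f"
    proof -
      have "continuous_on K (\<lambda>x. G n *v x)"
        by (intro linear_continuous_on matrix_vector_mul_bounded_linear)
      moreover have "\<forall>x\<in>K. w \<bullet> (G n *v x) \<noteq> 0"
      proof
        fix x assume "x \<in> K"
        then show "w \<bullet> (G n *v x) \<noteq> 0" using Gx(1)[of x] by simp
      qed
      ultimately show ?thesis unfolding f_def by (intro continuous_intros) auto
    qed
    ultimately obtain x where x: "x \<in> K" "f x = x"
      using brouwer[of K f] K by blast
    let ?l = "w \<bullet> (G n *v x)"
    have "?l *\<^sub>R f x = G n *v x" using Gx(1)[OF x(1)] by (simp add: f_def)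
    then have "G n *v x = ?l *\<^sub>R x" using x(2) by simp
    moreover have "s n * ?l \<ge> c / 2"
    proof -
      have "s n * ?l = (\<mu> \<bullet> x) + w \<bullet> (E n *v x)"
        using arg_cong[OF split, of "\<lambda>y. w \<bullet> y" x] u by (simp add: inner_add_right)
      moreover have "\<mu> \<bullet> x \<ge> c" using x by (simp add: K_def)
      ultimately show ?thesis using wE[OF x(1), of w] elim(2) by simp
    qed
    ultimately show ?case using x(1) by (auto simp: K_def)
  qed
  then show thesis using that[of "c / 2"] c by simp
qed

text \<open>A half triangle means that two sums miss the open set \<open>C\<close>, which survives
  limits. The bounds \<open>c\<close> and \<open>d\<close> pass to the ends of every axis that has
  to be tested and force these ends to \<open>u\<close> and \<open>v\<close>; for the third vertices
  a convergent subsequence is enough.\<close>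

lemma half_triangles_persist:
  assumes g: "\<And>n. g n \<in> Aut \<Omega>" "\<And>n. e n \<noteq> 0" and aut: "\<And>n. cone_aut (e n *\<^sub>R g n) (G' n)"
    and st: "\<And>n. s n > 0" "\<And>n. t n > 0" "(\<lambda>n. s n * t n) \<longlonglongrightarrow> 0"
    and lim: "(\<lambda>n. s n *\<^sub>R (e n *\<^sub>R g n)) \<longlonglongrightarrow> outer u \<mu>" "(\<lambda>n. t n *\<^sub>R G' n) \<longlonglongrightarrow> outer v \<nu>"
    and uv: "w \<bullet> u = 1" "w \<bullet> v = 1" "u + v \<in> C"
    and half: "\<And>z. z \<in> bd \<Longrightarrow> u + z \<in> C \<or> z + v \<in> C"
    and x: "c > 0" "\<And>n. \<exists>x l. x \<in> D \<and> w \<bullet> x = 1 \<and> (e n *\<^sub>R g n) *v x = l *\<^sub>R x \<and> s n * l \<ge> c"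
    and y: "d > 0" "\<And>n. \<exists>y k. y \<in> D \<and> w \<bullet> y = 1 \<and> G' n *v y = k *\<^sub>R y \<and> t n * k \<ge> d"
  shows "\<exists>n. rank_one_isometry \<Omega> (g n)"
proof (rule ccontr)
  assume none: "\<not> ?thesis"
  let ?G = "\<lambda>n. e n *\<^sub>R g n"
  obtain x l where x': "\<And>n. x n \<in> D" "\<And>n. w \<bullet> x n = 1" "\<And>n. ?G n *v x n = l n *\<^sub>R x n" "\<And>n. s n * l n \<ge> c"
    using x(2) by metis
  obtain y k where y': "\<And>n. y n \<in> D" "\<And>n. w \<bullet> y n = 1" "\<And>n. G' n *v y n = k n *\<^sub>R y n" "\<And>n. t n * k n \<ge> d"
    using y(2) by metis
  have xu: "x \<longlonglongrightarrow> u" by (rule eigenvector_limit[OF lim(1) uv(1) x(1) x'])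
  have yv: "y \<longlonglongrightarrow> v" by (rule eigenvector_limit[OF lim(2) uv(2) y(1) y'])
  have kpos: "k n > 0" for n
    using y'(4)[of n] y(1) st(2)[of n] by (smt (verit) mult_nonneg_nonpos)
  have lpos: "l n > 0" for n
    using x'(4)[of n] x(1) st(1)[of n] by (smt (verit) mult_nonneg_nonpos)
  have "(\<lambda>n. x n + y n) \<longlonglongrightarrow> u + v" by (intro tendsto_add xu yv)
  then have ev1: "eventually (\<lambda>n. x n + y n \<in> C) sequentially" using open_C uv(3) by (rule topological_tendstoD)
  \<comment> \<open>Since \<open>(s n * l n) * (t n * k n)\<close> is at least \<open>c * d\<close>,
    this makes \<open>l n * k n\<close> exceed 1.\<close>
  have ev2: "eventually (\<lambda>n. s n * t n < c * d) sequentially" using st(3) x(1) y(1) by (intro order_tendstoD) auto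
  obtain N where N: "\<And>n. n \<ge> N \<Longrightarrow> x n + y n \<in> C \<and> s n * t n < c * d"
    using eventually_conj[OF ev1 ev2] unfolding eventually_sequentially by blast
  have "\<exists>p q z. p \<in> bd \<and> q \<in> bd \<and> z \<in> bd \<and> p + z \<notin> C \<and> z + q \<notin> C \<and>
      (\<exists>a. ?G n *v p = a *\<^sub>R p \<and> s n * a \<ge> c) \<and> (\<exists>b. G' n *v q = b *\<^sub>R q \<and> t n * b \<ge> d)" if n: "n \<ge> N" for n
  proof (rule ccontr)
    assume *: "\<not> ?thesis"
    have "rank_one_isometry \<Omega> (g n)"
    proof (rule rank_one_isometryI[OF g(1) aut g(2) x'(1) _ x'(3) y'(1) _ y'(3) _ kpos])
      show "x n \<noteq> 0" "y n \<noteq> 0" using x'(2)[of n] y'(2)[of n] by auto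
      show "x n + y n \<in> C" using N[OF n] by blast
      have "s n * t n < c * d" using N[OF n] by blast
      also have "c * d \<le> (s n * l n) * (t n * k n)"
        using x'(4) y'(4) y(1) st(1)[of n] lpos[of n] by (intro mult_mono) auto
      also have "\<dots> = (s n * t n) * (l n * k n)" by simp
      finally show "1 < l n * k n" using st(1)[of n] st(2)[of n] by (simp add: mult_less_cancel_left1)
    next
      fix p q a b z
      assume h: "p \<in> bd" "q \<in> bd" "?G n *v p = a *\<^sub>R p" "G' n *v q = b *\<^sub>R q" "l n \<le> a" "k n \<le> b" "z \<in> bd"
      have "s n * l n \<le> s n * a" "t n * k n \<le> t n * b" using h st(1,2) by (auto intro: mult_left_mono less_imp_le)
      then have "s n * a \<ge> c" "t n * b \<ge> d" using x'(4)[of n] y'(4)[of n] by linarith+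
      then show "p + z \<in> C \<or> z + q \<in> C" using * h by blast
    qed
    then show False using none by blast
  qed
  then have "\<forall>n. \<exists>p q z. p \<in> bd \<and> q \<in> bd \<and> z \<in> bd \<and> p + z \<notin> C \<and> z + q \<notin> C \<and>
      (\<exists>a. ?G (n + N) *v p = a *\<^sub>R p \<and> s (n + N) * a \<ge> c) \<and>
      (\<exists>b. G' (n + N) *v q = b *\<^sub>R q \<and> t (n + N) * b \<ge> d)" by simp
  then obtain p q z a b where pqz: "\<And>n. p n \<in> bd" "\<And>n. q n \<in> bd" "\<And>n. z n \<in> bd"
    "\<And>n. p n + z n \<notin> C" "\<And>n. z n + q n \<notin> C"
    and pa: "\<And>n. ?G (n + N) *v p n = a n *\<^sub>R p n" "\<And>n. s (n + N) * a n \<ge> c"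
    and qb: "\<And>n. G' (n + N) *v q n = b n *\<^sub>R q n" "\<And>n. t (n + N) * b n \<ge> d"
    by metis
  \<comment> \<open>The slice is compact, and by \<open>combo_C\<close> positive rescaling of two
    terms does not affect whether their sum is in \<open>C\<close>.\<close>
  define nrm where "nrm v = (1 / (w \<bullet> v)) *\<^sub>R v" for v
  have wpos: "w \<bullet> v > 0" if "v \<in> bd" for v using that by (auto simp: bd_def intro!: pos_D)
  have nrm_bd: "nrm v \<in> bd" and nrm_w: "w \<bullet> nrm v = 1" if "v \<in> bd" for v
    using wpos[OF that] that by (simp_all add: nrm_def scale_bd)
  have nrm_sum: "nrm v + nrm v' \<notin> C" if "v \<in> bd" "v' \<in> bd" "v + v' \<notin> C" for v v'
  proof
    assume "nrm v + nrm v' \<in> C"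
    then have "(w \<bullet> v) *\<^sub>R nrm v + (w \<bullet> v') *\<^sub>R nrm v' \<in> C"
      using wpos that nrm_bd bd_D by (intro combo_C) auto
    then show False using that(3) wpos[OF that(1)] wpos[OF that(2)] by (simp add: nrm_def)
  qed
  have pu: "(\<lambda>n. nrm (p n)) \<longlonglongrightarrow> u"
  proof (rule eigenvector_limit[OF LIMSEQ_ignore_initial_segment[OF lim(1), of N] uv(1) x(1), where l = a])
    show "?G (n + N) *v nrm (p n) = a n *\<^sub>R nrm (p n)" for n
      by (simp add: nrm_def matrix_vector_mult_scaleR pa)
  qed (use nrm_bd nrm_w pqz bd_D pa in auto)
  have qv: "(\<lambda>n. nrm (q n)) \<longlonglongrightarrow> v"
  proof (rule eigenvector_limit[OF LIMSEQ_ignore_initial_segment[OF lim(2), of N] uv(2) y(1), where l = b])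
    show "G' (n + N) *v nrm (q n) = b n *\<^sub>R nrm (q n)" for n
      by (simp add: nrm_def matrix_vector_mult_scaleR qb)
  qed (use nrm_bd nrm_w pqz bd_D qb in auto)
  have "\<forall>n. nrm (z n) \<in> {x \<in> D. w \<bullet> x = 1}" using nrm_bd nrm_w pqz bd_D by auto
  then obtain z0 r where z0: "z0 \<in> {x \<in> D. w \<bullet> x = 1}" and r: "strict_mono r" "((\<lambda>n. nrm (z n)) \<circ> r) \<longlonglongrightarrow> z0"
    by (rule seq_compactE[OF compact_imp_seq_compact[OF compact_slice[of 1]]])
  have notC: "l0 \<notin> C" if "f \<longlonglongrightarrow> l0" "\<And>n. f n \<notin> C" for f :: "nat \<Rightarrow> real^'n" and l0
  proof -
    have "closed (- C)" using open_C by (simp add: closed_Compl)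
    then have "l0 \<in> - C" by (rule closed_sequentially) (use that in auto)
    then show ?thesis by simp
  qed
  have zr: "(\<lambda>n. nrm (z (r n))) \<longlonglongrightarrow> z0" using r(2) by (simp add: o_def)
  have "z0 \<notin> C" by (rule notC[OF zr]) (use nrm_bd pqz in \<open>auto simp: bd_def\<close>)
  then have "z0 \<in> bd" using z0 by (auto simp: bd_def)
  moreover have "u + z0 \<notin> C"
    by (rule notC[OF tendsto_add[OF LIMSEQ_subseq_LIMSEQ[OF pu r(1)] zr]]) (use nrm_sum pqz in auto)
  moreover have "z0 + v \<notin> C"
    by (rule notC[OF tendsto_add[OF zr LIMSEQ_subseq_LIMSEQ[OF qv r(1)]]]) (use nrm_sum pqz in auto)
  ultimately show False using half by blast
qed

text \<open>The limit maps \<open>C\<close> into \<open>D\<close>, so \<open>\<mu>\<close> is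
  nonnegative on \<open>C\<close>; testing at \<open>x - d *\<^sub>R \<mu>\<close> makes it strictly
  positive.\<close>

lemma limit_functional_pos:
  assumes aut: "\<And>n. cone_aut (G n) (G' n)" and s: "\<And>n. s n > 0"
    and lim: "(\<lambda>n. s n *\<^sub>R G n) \<longlonglongrightarrow> outer u \<mu>" and u: "u \<in> bd" and \<mu>: "\<mu> \<noteq> 0" and x: "x \<in> C"
  shows "\<mu> \<bullet> x > 0"
proof -
  have wu: "w \<bullet> u > 0" using u by (auto simp: bd_def intro!: pos_D)
  obtain d where d: "d > 0" "x - d *\<^sub>R \<mu> \<in> C" using dominates[OF x] by blast
  have "outer u \<mu> *v (x - d *\<^sub>R \<mu>) \<in> D"
    using limit_matrix_D[OF lim _ C_sub_D[OF d(2)]] s cone_aut_C[OF aut] scale_C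
    by (simp add: matrix_vector_scaleR_left)
  then have "0 \<le> (\<mu> \<bullet> (x - d *\<^sub>R \<mu>)) * (w \<bullet> u)"
    using nonneg_D by (fastforce simp: outer_vector)
  then have "0 \<le> \<mu> \<bullet> (x - d *\<^sub>R \<mu>)" using wu by (simp add: zero_le_mult_iff)
  then have "\<mu> \<bullet> x \<ge> d * (\<mu> \<bullet> \<mu>)" by (simp add: inner_diff_right)
  moreover have "d * (\<mu> \<bullet> \<mu>) > 0" using d \<mu> by simp
  ultimately show ?thesis by linarith
qed

text \<open>The product of the rescaled matrices is \<open>s n * t n\<close> times the identity, yet
  its limit maps into the line of \<open>u\<close>. Applied to \<open>v\<close>, independent of
  \<open>u\<close>, this forces the factor to 0; the limit product is then zero, and evaluating it
  at \<open>\<nu>\<close> gives \<open>\<mu> \<bullet> v = 0\<close>.\<close>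

lemma inverse_limits:
  assumes inv: "\<And>n. G n ** G' n = mat 1"
    and lim: "(\<lambda>n. s n *\<^sub>R G n) \<longlonglongrightarrow> outer u \<mu>" "(\<lambda>n. t n *\<^sub>R G' n) \<longlonglongrightarrow> outer v \<nu>"
    and u: "u \<in> bd" and v: "v \<in> bd" and C: "u + v \<in> C" and \<nu>: "\<nu> \<noteq> 0"
  shows "(\<lambda>n. s n * t n) \<longlonglongrightarrow> 0" "\<mu> \<bullet> v = 0"
proof -
  have wu: "w \<bullet> u > 0" and wv: "w \<bullet> v > 0" using u v by (auto simp: bd_def intro!: pos_D)
  have "(\<lambda>n. (s n *\<^sub>R G n) ** (t n *\<^sub>R G' n)) \<longlonglongrightarrow> outer u \<mu> ** outer v \<nu>"
    by (intro tendsto_matrix_matrix_mult lim)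
  then have "(\<lambda>n. (s n * t n) *\<^sub>R mat 1) \<longlonglongrightarrow> outer u \<mu> ** outer v \<nu>"
    by (simp add: matrix_scaleR_mult inv)
  then have "(\<lambda>n. ((s n * t n) *\<^sub>R mat 1) *v x) \<longlonglongrightarrow> (outer u \<mu> ** outer v \<nu>) *v x" for x
    by (intro tendsto_matrix_vector_mult tendsto_const)
  then have lim_x: "(\<lambda>n. (s n * t n) *\<^sub>R x) \<longlonglongrightarrow> ((\<nu> \<bullet> x) * (\<mu> \<bullet> v)) *\<^sub>R u" for x
    by (simp add: matrix_vector_scaleR_left matrix_vector_mul_assoc[symmetric] outer_vector)
  define k where "k = (\<nu> \<bullet> v) * (\<mu> \<bullet> v)"
  have "(\<lambda>n. (w \<bullet> ((s n * t n) *\<^sub>R v)) / (w \<bullet> v)) \<longlonglongrightarrow> (w \<bullet> (k *\<^sub>R u)) / (w \<bullet> v)"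
    unfolding k_def using wv by (intro tendsto_intros lim_x) auto
  then have st: "(\<lambda>n. s n * t n) \<longlonglongrightarrow> k * (w \<bullet> u) / (w \<bullet> v)" using wv by simp
  then have "(\<lambda>n. (s n * t n) *\<^sub>R v) \<longlonglongrightarrow> (k * (w \<bullet> u) / (w \<bullet> v)) *\<^sub>R v" by (intro tendsto_intros)
  then have "(k * (w \<bullet> u) / (w \<bullet> v)) *\<^sub>R v = k *\<^sub>R u" unfolding k_def using lim_x by (rule LIMSEQ_unique)
  then have "k *\<^sub>R u + (- (k * (w \<bullet> u) / (w \<bullet> v))) *\<^sub>R v = 0" by simp
  then have k0: "k = 0" using bd_pair_independent[OF u v C] by blast
  then show st0: "(\<lambda>n. s n * t n) \<longlonglongrightarrow> 0" using st by simp
  have "(\<lambda>n. (s n * t n) *\<^sub>R \<nu>) \<longlonglongrightarrow> 0 *\<^sub>R \<nu>" by (intro tendsto_intros st0)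
  then have "0 *\<^sub>R \<nu> = ((\<nu> \<bullet> \<nu>) * (\<mu> \<bullet> v)) *\<^sub>R u" using lim_x by (rule LIMSEQ_unique)
  moreover have "u \<noteq> 0" using wu by auto
  ultimately show "\<mu> \<bullet> v = 0" using \<nu> by simp
qed

text \<open>\<open>\<mu>\<close> vanishes on \<open>v\<close> and is positive on
  \<open>u + v\<close>, hence on \<open>u\<close>: the image of the limit is not in its kernel, as
  \<open>eigenvector_exists\<close> requires. The same holds for \<open>\<nu>\<close> with the roles
  exchanged.\<close>

lemma transverse_limits_rank_one:
  assumes g: "\<And>n. g n \<in> Aut \<Omega>" "\<And>n. e n \<noteq> 0" and aut: "\<And>n. cone_aut (e n *\<^sub>R g n) (G' n)"
    and st: "\<And>n. s n > 0" "\<And>n. t n > 0"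
    and lim: "(\<lambda>n. s n *\<^sub>R (e n *\<^sub>R g n)) \<longlonglongrightarrow> outer u \<mu>" "(\<lambda>n. t n *\<^sub>R G' n) \<longlonglongrightarrow> outer v \<nu>"
    and \<mu>\<nu>: "\<mu> \<noteq> 0" "\<nu> \<noteq> 0"
    and u: "u \<in> bd" "w \<bullet> u = 1" and v: "v \<in> bd" "w \<bullet> v = 1" and C: "u + v \<in> C"
    and half: "\<And>z. z \<in> bd \<Longrightarrow> u + z \<in> C \<or> z + v \<in> C"
  shows "\<exists>n. rank_one_isometry \<Omega> (g n)"
proof -
  have inv: "(e n *\<^sub>R g n) ** G' n = mat 1" "G' n ** (e n *\<^sub>R g n) = mat 1" for n
    using aut[of n] by (auto simp: cone_aut_def)
  have C': "v + u \<in> C" using C by (simp add: add.commute)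
  have st0: "(\<lambda>n. s n * t n) \<longlonglongrightarrow> 0" and \<mu>v: "\<mu> \<bullet> v = 0"
    using inverse_limits[OF inv(1) lim u(1) v(1) C \<mu>\<nu>(2)] by auto
  have \<nu>u: "\<nu> \<bullet> u = 0" using inverse_limits[OF inv(2) lim(2,1) v(1) u(1) C' \<mu>\<nu>(1)] by auto
  have "\<mu> \<bullet> u > 0"
    using limit_functional_pos[OF aut st(1) lim(1) u(1) \<mu>\<nu>(1) C] \<mu>v by (simp add: inner_add_right)
  then obtain c where c: "c > 0"
    "eventually (\<lambda>n. \<exists>x l. x \<in> D \<and> w \<bullet> x = 1 \<and> (e n *\<^sub>R g n) *v x = l *\<^sub>R x \<and> s n * l \<ge> c) sequentially"
    using eigenvector_exists[OF aut st(1) lim(1) bd_D[OF u(1)] u(2)] by blast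
  have "\<nu> \<bullet> v > 0"
    using limit_functional_pos[OF cone_aut_sym[OF aut] st(2) lim(2) v(1) \<mu>\<nu>(2) C] \<nu>u by (simp add: inner_add_right)
  then obtain d where d: "d > 0"
    "eventually (\<lambda>n. \<exists>y k. y \<in> D \<and> w \<bullet> y = 1 \<and> G' n *v y = k *\<^sub>R y \<and> t n * k \<ge> d) sequentially"
    using eigenvector_exists[OF cone_aut_sym[OF aut] st(2) lim(2) bd_D[OF v(1)] v(2)] by blast
  obtain N1 where N1: "\<And>n. n \<ge> N1 \<Longrightarrow> \<exists>x l. x \<in> D \<and> w \<bullet> x = 1 \<and> (e n *\<^sub>R g n) *v x = l *\<^sub>R x \<and> s n * l \<ge> c"
    using c(2) unfolding eventually_sequentially by blast
  obtain N2 where N2: "\<And>n. n \<ge> N2 \<Longrightarrow> \<exists>y k. y \<in> D \<and> w \<bullet> y = 1 \<and> G' n *v y = k *\<^sub>R y \<and> t n * k \<ge> d"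
    using d(2) unfolding eventually_sequentially by blast
  let ?N = "N1 + N2"
  have "\<exists>n. rank_one_isometry \<Omega> (g (n + ?N))"
    by (rule half_triangles_persist[where e = "\<lambda>n. e (n + ?N)" and G' = "\<lambda>n. G' (n + ?N)"
          and s = "\<lambda>n. s (n + ?N)" and t = "\<lambda>n. t (n + ?N)",
          OF g aut st LIMSEQ_ignore_initial_segment[OF st0] LIMSEQ_ignore_initial_segment[OF lim(1)]
             LIMSEQ_ignore_initial_segment[OF lim(2)] u(2) v(2) C half c(1) N1 d(1) N2]) auto
  then show ?thesis by blast
qed

end

section \<open>From a rank one geodesic to a rank one isometry\<close>

context ordered_vec_domain
begin

text \<open>Normalising the inverses by their norms makes them accumulate at a nonzero
  \<open>N\<close> of unknown rank. The signs converge along the same subsequence and are absorbed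
  into \<open>\<phi>\<close>.\<close>

lemma proximal_cone_aut_sequence:
  assumes \<Gamma>: "\<Gamma> \<subseteq> carrier SL" "\<Gamma> \<subseteq> Aut \<Omega>" and u: "u \<in> bd" "proj u \<in> proximal_limit_set \<Gamma>"
  obtains g and e :: "nat \<Rightarrow> real" and A' s t \<phi> N where "\<And>n. g n \<in> \<Gamma>"
    "\<And>n. e n = 1 \<or> e n = -1" "\<And>n. cone_aut (e n *\<^sub>R g n) (A' n)" "\<And>n. s n > 0" "\<And>n. t n > 0" "(\<lambda>n. s n *\<^sub>R (e n *\<^sub>R g n)) \<longlonglongrightarrow> outer u \<phi>" "\<phi> \<noteq> 0"
    "(\<lambda>n. t n *\<^sub>R A' n) \<longlonglongrightarrow> N" "N \<noteq> 0"
proof -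
  have u0: "u \<noteq> 0" using u by (simp add: bd_def)
  obtain g s m where g: "\<And>n. g n \<in> \<Gamma>" "\<And>n. s n > 0" "(\<lambda>n. s n *\<^sub>R g n) \<longlonglongrightarrow> outer u m" "m \<noteq> 0"
    using proximal_rank_one_limit[OF u(2) u0 \<Gamma>(1)] by blast
  have "\<exists>(e::real) B. (e = 1 \<or> e = -1) \<and> cone_aut (e *\<^sub>R g n) B" for n
  proof -
    have "g n \<in> Aut \<Omega>" using g(1)[of n] \<Gamma>(2) by auto
    then obtain e :: real and B where "e = 1 \<or> e = -1" "cone_aut (e *\<^sub>R g n) B" by (rule Aut_cone_aut)
    then show ?thesis by auto
  qed
  then obtain e :: "nat \<Rightarrow> real" and B where e: "\<And>n. e n = 1 \<or> e n = -1" "\<And>n. cone_aut (e n *\<^sub>R g n) (B n)" by metis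
  have B0: "B n \<noteq> 0" for n
  proof
    assume "B n = 0"
    then have "u = 0" using cone_aut_inverse[OF e(2), of n u] by simp
    then show False using u0 by simp
  qed
  let ?S = "{1, -1 :: real} \<times> sphere (0 :: 'n sq_matrix) 1"
  have "compact {1, -1 :: real}" by (simp add: finite_imp_compact)
  then have "seq_compact ?S" by (intro compact_imp_seq_compact compact_Times compact_sphere)
  moreover have "\<forall>n. (e n, (1 / norm (B n)) *\<^sub>R B n) \<in> ?S" using e B0 by auto
  ultimately obtain L r where L: "L \<in> ?S" and r: "strict_mono r"
    and lim: "((\<lambda>n. (e n, (1 / norm (B n)) *\<^sub>R B n)) \<circ> r) \<longlonglongrightarrow> L"
    using seq_compactE[of ?S "\<lambda>n. (e n, (1 / norm (B n)) *\<^sub>R B n)"] by blast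
  have lim_e: "(\<lambda>n. e (r n)) \<longlonglongrightarrow> fst L" using tendsto_fst[OF lim] by (simp add: o_def)
  have lim_B: "(\<lambda>n. (1 / norm (B (r n))) *\<^sub>R B (r n)) \<longlonglongrightarrow> snd L" using tendsto_snd[OF lim] by (simp add: o_def)
  have lim_g: "(\<lambda>n. s (r n) *\<^sub>R g (r n)) \<longlonglongrightarrow> outer u m" using LIMSEQ_subseq_LIMSEQ[OF g(3) r] by (simp add: o_def)
  show thesis
  proof (rule that[of "g \<circ> r" "e \<circ> r" "B \<circ> r" "s \<circ> r" "\<lambda>n. 1 / norm (B (r n))" "fst L *\<^sub>R m" "snd L"])
    have "(\<lambda>n. e (r n) *\<^sub>R (s (r n) *\<^sub>R g (r n))) \<longlonglongrightarrow> fst L *\<^sub>R outer u m" by (intro tendsto_scaleR lim_e lim_g)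
    moreover have "fst L *\<^sub>R outer u m = outer u (fst L *\<^sub>R m)" by (simp add: outer_def vec_eq_iff)
    ultimately show "(\<lambda>n. (s \<circ> r) n *\<^sub>R ((e \<circ> r) n *\<^sub>R (g \<circ> r) n)) \<longlonglongrightarrow> outer u (fst L *\<^sub>R m)"
      by (simp add: mult.commute)
    show "fst L *\<^sub>R m \<noteq> 0" "snd L \<noteq> 0" using L g(4) by auto
  qed (use g e B0 lim_B in auto)
qed

lemma geodesic_imp_rank_one_geometry:
  assumes \<Gamma>: "subgroup \<Gamma> SL" and dense: "zariski_dense_in \<Gamma> (carrier SL)" and Aut: "\<Gamma> \<subseteq> Aut \<Omega>"
    and geo: "rank_one_geodesic \<Omega> a b" and ab: "a \<in> proximal_limit_set \<Gamma>" "b \<in> proximal_limit_set \<Gamma>"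
  shows "rank_one_hilbert_geometry \<Omega> \<Gamma>"
proof -
  have normalised: "\<exists>u\<in>bd. w \<bullet> u = 1 \<and> p = proj u" if p: "p \<in> frontier \<Omega>" for p
  proof -
    obtain u where u: "u \<in> bd" "p = proj u" using p by (rule frontier_obtain)
    have "w \<bullet> u > 0" using u by (auto simp: bd_def intro!: pos_D)
    then show ?thesis using u by (intro bexI[of _ "(1 / (w \<bullet> u)) *\<^sub>R u"]) (auto simp: scale_bd proj_scale)
  qed
  have "a \<in> frontier \<Omega>" "b \<in> frontier \<Omega>" using geo by (simp_all add: rank_one_geodesic_def)
  then obtain u v where u: "u \<in> bd" "w \<bullet> u = 1" "a = proj u" and v: "v \<in> bd" "w \<bullet> v = 1" "b = proj v"
    using normalised by metis
  have C: "u + v \<in> C" and half: "\<And>z. z \<in> bd \<Longrightarrow> u + z \<in> C \<or> z + v \<in> C"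
    using geo rank_one_geodesic_proj_iff[OF u(1) v(1)] u(3) v(3) by auto
  note sub = subgroup_SL_closed[OF \<Gamma>]
  obtain e1 :: "nat \<Rightarrow> real" and g1 A' s1 t1 \<phi> N1 where 1: "\<And>n. g1 n \<in> \<Gamma>" "\<And>n. e1 n = 1 \<or> e1 n = -1"
    "\<And>n. cone_aut (e1 n *\<^sub>R g1 n) (A' n)" "\<And>n. s1 n > 0" "\<And>n. t1 n > 0"
    "(\<lambda>n. s1 n *\<^sub>R (e1 n *\<^sub>R g1 n)) \<longlonglongrightarrow> outer u \<phi>" "\<phi> \<noteq> 0" "(\<lambda>n. t1 n *\<^sub>R A' n) \<longlonglongrightarrow> N1" "N1 \<noteq> 0"
    by (rule proximal_cone_aut_sequence[OF sub(1) Aut u(1) ab(1)[unfolded u(3)]]) (rule that; assumption)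
  obtain e2 :: "nat \<Rightarrow> real" and g2 B' s2 t2 \<psi> N2 where 2: "\<And>n. g2 n \<in> \<Gamma>" "\<And>n. e2 n = 1 \<or> e2 n = -1"
    "\<And>n. cone_aut (e2 n *\<^sub>R g2 n) (B' n)" "\<And>n. s2 n > 0" "\<And>n. t2 n > 0"
    "(\<lambda>n. s2 n *\<^sub>R (e2 n *\<^sub>R g2 n)) \<longlonglongrightarrow> outer v \<psi>" "\<psi> \<noteq> 0" "(\<lambda>n. t2 n *\<^sub>R B' n) \<longlonglongrightarrow> N2" "N2 \<noteq> 0"
    by (rule proximal_cone_aut_sequence[OF sub(1) Aut v(1) ab(2)[unfolded v(3)]]) (rule that; assumption)
  \<comment> \<open>The products with \<open>N1\<close> and \<open>N2\<close> only have to be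
    nonzero, so one vector outside each kernel suffices as a witness.\<close>
  obtain x1 where x1: "N1 *v x1 \<noteq> 0" using 1(9) by (auto simp: matrix_eq)
  obtain x2 where x2: "N2 *v x2 \<noteq> 0" using 2(9) by (auto simp: matrix_eq)
  obtain i :: 'n where i: "i \<noteq> index1" using two_indices[OF u(1) v(1) C] by blast
  obtain h where h: "h \<in> \<Gamma>" "\<phi> \<bullet> (h *v (N2 *v x2)) \<noteq> 0"
    "\<And>h'. h ** h' = mat 1 \<Longrightarrow> \<psi> \<bullet> (h' *v (N1 *v x1)) \<noteq> 0"
    using zariski_dense_generic[OF dense i 1(7) 2(7) x1 x2] by metis
  have "h \<in> Aut \<Omega>" using h(1) Aut by blast
  then obtain e :: real and H' where e: "e = 1 \<or> e = -1" "cone_aut (e *\<^sub>R h) H'" by (rule Aut_cone_aut)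
  \<comment> \<open>The matrix paired with a signed element inverts that element with its sign;
    moving the sign over gives the inverse inside the group.\<close>
  have inverse_scale: "A ** (c *\<^sub>R B) = mat 1" if "cone_aut (c *\<^sub>R A) B" for c A B
    using that matrix_scaleR_mult[of c A 1 B] matrix_scaleR_mult[of 1 A c B] by (simp add: cone_aut_def)
  define g where "g n = g1 n ** h ** (e2 n *\<^sub>R B' n)" for n
  define G' where "G' n = (e2 n *\<^sub>R g2 n) ** (H' ** A' n)" for n
  \<comment> \<open>The sign with which \<open>g n\<close> preserves \<open>C\<close>: its factor
    \<open>e2 n\<close> cancels the one already in \<open>g n\<close>.\<close>
  define E where "E n = e1 n * e * e2 n" for n
  define \<mu> where "\<mu> = transpose N2 *v (transpose (e *\<^sub>R h) *v \<phi>)"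
  define \<nu> where "\<nu> = transpose (H' ** N1) *v \<psi>"
  have g\<Gamma>: "g n \<in> \<Gamma>" for n
    unfolding g_def
    by (rule sub(3)[OF sub(3)[OF 1(1) h(1)] sub(4)[OF 2(1) inverse_scale[OF 2(3)]]])
  have Eg: "E n *\<^sub>R g n = (e1 n *\<^sub>R g1 n) ** (e *\<^sub>R h) ** B' n" for n
  proof -
    have "(e1 n *\<^sub>R g1 n) ** (e *\<^sub>R h) ** (e2 n *\<^sub>R (e2 n *\<^sub>R B' n)) = E n *\<^sub>R g n"
      unfolding matrix_scaleR_mult E_def g_def ..
    moreover have "e2 n * e2 n = 1" using 2(2)[of n] by auto
    ultimately show ?thesis by simp
  qed
  have aut: "cone_aut (E n *\<^sub>R g n) (G' n)" for n
    unfolding Eg G'_def by (intro cone_aut_mult cone_aut_sym[OF 2(3)] 1(3) e(2))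
  have lim_G: "(\<lambda>n. (s1 n * t2 n) *\<^sub>R (E n *\<^sub>R g n)) \<longlonglongrightarrow> outer u \<mu>"
  proof -
    have "(\<lambda>n. (s1 n *\<^sub>R (e1 n *\<^sub>R g1 n)) ** (e *\<^sub>R h) ** (t2 n *\<^sub>R B' n)) \<longlonglongrightarrow> outer u \<phi> ** (e *\<^sub>R h) ** N2"
      by (intro tendsto_matrix_matrix_mult 1(6) 2(8) tendsto_const)
    moreover have "(s1 n *\<^sub>R (e1 n *\<^sub>R g1 n)) ** (e *\<^sub>R h) ** (t2 n *\<^sub>R B' n)
        = (s1 n * t2 n) *\<^sub>R ((e1 n *\<^sub>R g1 n) ** (e *\<^sub>R h) ** B' n)" for n
      using matrix_scaleR_mult[of "s1 n" "e1 n *\<^sub>R g1 n" 1 "e *\<^sub>R h"]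
        matrix_scaleR_mult[of "s1 n" "(e1 n *\<^sub>R g1 n) ** (e *\<^sub>R h)" "t2 n" "B' n"] by simp
    ultimately show ?thesis unfolding Eg \<mu>_def outer_mult_matrix by simp
  qed
  have lim_G': "(\<lambda>n. (s2 n * t1 n) *\<^sub>R G' n) \<longlonglongrightarrow> outer v \<nu>"
  proof -
    have "(\<lambda>n. (s2 n *\<^sub>R (e2 n *\<^sub>R g2 n)) ** (H' ** (t1 n *\<^sub>R A' n))) \<longlonglongrightarrow> outer v \<psi> ** (H' ** N1)"
      by (intro tendsto_matrix_matrix_mult 2(6) 1(8) tendsto_const)
    moreover have "(s2 n *\<^sub>R (e2 n *\<^sub>R g2 n)) ** (H' ** (t1 n *\<^sub>R A' n)) = (s2 n * t1 n) *\<^sub>R G' n" for n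
      unfolding G'_def using matrix_scaleR_mult[of 1 H' "t1 n" "A' n"]
        matrix_scaleR_mult[of "s2 n" "e2 n *\<^sub>R g2 n" "t1 n" "H' ** A' n"] by simp
    ultimately show ?thesis unfolding \<nu>_def outer_mult_matrix by simp
  qed
  have u0: "u \<noteq> 0" and v0: "v \<noteq> 0" using u(1) v(1) by (auto simp: bd_def)
  have \<mu>0: "\<mu> \<noteq> 0"
  proof
    assume "\<mu> = 0"
    then have "outer u \<phi> ** (e *\<^sub>R h) ** N2 = outer u 0" unfolding \<mu>_def outer_mult_matrix by simp
    then have "(outer u \<phi> ** (e *\<^sub>R h) ** N2) *v x2 = 0" by (simp add: outer_vector)
    then have "(\<phi> \<bullet> (e *\<^sub>R (h *v (N2 *v x2)))) *\<^sub>R u = 0"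
      by (simp only: matrix_vector_mul_assoc[symmetric] outer_vector matrix_vector_scaleR_left)
    then show False using u0 h(2) e(1) by auto
  qed
  have \<nu>0: "\<nu> \<noteq> 0"
  proof
    assume "\<nu> = 0"
    then have "outer v \<psi> ** (H' ** N1) = outer v 0" unfolding \<nu>_def outer_mult_matrix by simp
    then have "(outer v \<psi> ** (H' ** N1)) *v x1 = 0" by (simp add: outer_vector)
    then have "(\<psi> \<bullet> (H' *v (N1 *v x1))) *\<^sub>R v = 0"
      by (simp only: matrix_vector_mul_assoc[symmetric] outer_vector)
    then have "\<psi> \<bullet> ((e *\<^sub>R H') *v (N1 *v x1)) = 0" using v0 by (simp add: matrix_vector_scaleR_left)
    then show False using h(3)[OF inverse_scale[OF e(2)]] by blast
  qed
  have "\<exists>n. rank_one_isometry \<Omega> (g n)"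
  proof (rule transverse_limits_rank_one[OF _ _ aut _ _ lim_G lim_G' \<mu>0 \<nu>0 u(1,2) v(1,2) C half])
    show "g n \<in> Aut \<Omega>" for n using g\<Gamma> Aut by blast
    show "E n \<noteq> 0" for n using 1(2)[of n] 2(2)[of n] e(1) by (auto simp: E_def)
    show "s1 n * t2 n > 0" "s2 n * t1 n > 0" for n using 1(4,5)[of n] 2(4,5)[of n] by simp_all
  qed
  then show ?thesis using g\<Gamma> by (auto simp: rank_one_hilbert_geometry_def)
qed

end

theorem mainTheorem10:
  fixes \<Gamma> :: "(real^('n::{finite,linorder})^('n::{finite,linorder})) set"
    and \<Omega> :: "(real^'n::{finite,linorder}) projective set"
  assumes "subgroup \<Gamma> SL"
    and "discrete \<Gamma>"
    and "zariski_dense_in \<Gamma> (carrier SL)"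
    and "properly_convex_domain \<Omega>"
    and "\<Gamma> \<subseteq> Aut \<Omega>"
  shows "rank_one_hilbert_geometry \<Omega> \<Gamma> \<longleftrightarrow>
    (\<exists>a b. rank_one_geodesic \<Omega> a b \<and>
           a \<in> proximal_limit_set \<Gamma> \<inter> frontier \<Omega> \<and>
           b \<in> proximal_limit_set \<Gamma> \<inter> frontier \<Omega>)"
proof -
  obtain C w M where "cone_domain C w M \<Omega>"
    using properly_convex_domain_cone[OF assms(4)] by blast
  then interpret ordered_vec_domain C w M \<Omega>
    unfolding ordered_vec_domain_def vec_domain_def .
  show ?thesis
    using rank_one_geometry_imp_geodesic[OF assms(1,5)]
      geodesic_imp_rank_one_geometry[OF assms(1,3,5)] by blast
qed

end
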